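(* Let $\Omega=[0,2\pi]^3$ and $N_x=N_y=N_z=N$ with $N$ a positive even integer, and let $\mathbf{H},\mathbf{E}$ be the exact solution of the three-dimensional Maxwell's equations $$\partial_t\mathbf{H}=-\tfrac1\mu\,\mathbf{curl}\,\mathbf{E},\quad \partial_t\mathbf{E}=\tfrac1\varepsilon\,\mathbf{curl}\,\mathbf{H},\quad \nabla\cdot(\varepsilon\mathbf{E})=0,\quad \nabla\cdot(\varepsilon\mathbf{H})=0$$ on $\Omega\times[0,t_{end}]$ with periodic boundary conditions and initial values $\mathbf{H}_0,\mathbf{E}_0$. Suppose that $\mathbf{H},\mathbf{E}\in C^1(0,t_{end};[H^r_p(\Omega)]^3)$ and that $\mathbf{H}_0,\mathbf{E}_0\in[H^r_p(\Omega)]^3$, where $r>3/2$, and that the initial values are bounded. Let $\mathbf{E}^{t_{end}}=(\mathbf{E}^{t_{end}}_x,\mathbf{E}^{t_{end}}_y,\mathbf{E}^{t_{end}}_z)^{\intercal}$ and $\mathbf{H}^{t_{end}}=(\mathbf{H}^{t_{end}}_x,\mathbf{H}^{t_{end}}_y,\mathbf{H}^{t_{end}}_z)^{\intercal}$ be the solutions produced at time $t_{end}$ by the fully discrete scheme defined in the context. Then, for any fixed $t_{end}$, there exists a positive constant $C$ independent of $\Delta t,h_x,h_y,h_z,t_{end},N,\mu,\varepsilon$ such that $$\Big(\mu\,\|\mathbf{H}^{t_{end}}-\mathbf{H}(t_{end})\|_N^2+\varepsilon\,\|\mathbf{E}^{t_{end}}-\mathbf{E}(t_{end})\|_N^2\Big)^{1/2}\le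 C\,(\sqrt{\mu}+\sqrt{\varepsilon})\,N^{-r}.$$
   Context: **Setting.** $\varepsilon,\mu>0$ are constants (homogeneous, isotropic, lossless medium); $\mathbf{H}=(H_x,H_y,H_z)^\intercal$ and $\mathbf{E}=(E_x,E_y,E_z)^\intercal$ are $\mathbb{R}^3$-valued functions on $\Omega\times[0,t_{end}]$, with $\mathbf{H}(\cdot,0)=\mathbf{H}_0$, $\mathbf{E}(\cdot,0)=\mathbf{E}_0$. **Function spaces and norm.** $C^\infty_p(\Omega)$ is the set of infinitely differentiable periodic functions with period $2\pi$ (in each variable), and $H^r_p(\Omega)$ is the closure of $C^\infty_p(\Omega)$ in the Sobolev space $H^r(\Omega)$. The discrete norm is $\|u\|_N^2=\langle u,u\rangle_N$, where $\langle u,v\rangle_N=\frac1{N^3}\sum_{j,k,l=1}^N u(x_j,y_k,z_l)\overline{v(x_j,y_k,z_l)}$, summed over the three components for vector fields. In $\|\mathbf{H}^{t_{end}}-\mathbf{H}(t_{end})\|_N$ (and similarly for $\mathbf{E}$) the exact solution is evaluated at the grid points. **Grid.** For $w\in\{x,y,z\}$ the domain in direction $w$ is $[w_L,w_R]$ (here $[0,2\pi]$), $h_w=(w_R-w_L)/N_w$, $N_w$ is an even integer, and $x_j=x_L+(j-1)h_x$, $y_k=y_L+(k-1)h_y$, $z_l=z_L+(l-1)h_z$ for $1\le j\le N_x$, $1\le k\le N_y$, $1\le l\le N_z$. Also $\Delta t=t_{end}/N_t$ for an integer $N_t$. A grid function is identified with the vector in $\mathbb{C}^{N_xN_yN_z}$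 whose entry number $N_xN_y(l-1)+N_x(k-1)+j$ is its value at $(x_j,y_k,z_l)$. $I_m$ is the $m\times m$ identity and $\otimes$ the Kronecker product. **Matrices.** $\nu_w=2\pi/(w_R-w_L)$. $\mathcal{F}_{N_w}$ is the DFT matrix with entries $(e^{2\pi\mathrm{i}/N_w})^{-jk}$, $0\le j,k\le N_w-1$, and $\mathcal{F}_{N_w}^{-1}$ its inverse, with entries $\frac1{N_w}(e^{2\pi\mathrm{i}/N_w})^{jk}$. Put $\Omega_w=\nu_w\,\mathrm{diag}(0,1,\ldots,\frac{N_w}2-1,0,-\frac{N_w}2+1,\ldots,-2,-1)$, $\Omega_1=I_{N_z}\otimes I_{N_y}\otimes\Omega_x$, $\Omega_2=I_{N_z}\otimes\Omega_y\otimes I_{N_x}$, $\Omega_3=\Omega_z\otimes I_{N_y}\otimes I_{N_x}$. For $\tau\ge0$ put $\Psi=\tau^2(\Omega_1^2+\Omega_2^2+\Omega_3^2)$ and let $A=\frac{\cosh(\sqrt{-\Psi})-I}{\Psi}$, $B=\frac{\sinh(\sqrt{-\Psi})}{\sqrt{-\Psi}}$ be the diagonal matrices obtained entrywise (with the value by continuity, $-1/2$ and $1$ respectively, where the diagonal entry of $\Psi$ is $0$). Define $\mathbf{c}_{11}=I+\tau^2(\Omega_3^2+\Omega_2^2)A$, $\mathbf{c}_{22}=I+\tau^2(\Omega_3^2+\Omega_1^2)A$, $\mathbf{c}_{33}=I+\tau^2(\Omega_2^2+\Omega_1^2)A$, $\mathbf{c}_{12}=-\tau^2\Omega_2\Omega_1A$,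 $\mathbf{c}_{13}=-\tau^2\Omega_3\Omega_1A$, $\mathbf{c}_{23}=-\tau^2\Omega_3\Omega_2A$, $\mathbf{s}_{12}=\mathrm{i}\tau\Omega_3B$, $\mathbf{s}_{13}=\mathrm{i}\tau\Omega_2B$, $\mathbf{s}_{23}=\mathrm{i}\tau\Omega_1B$. **Fully discrete scheme.** Let $\mathbf{E}^0_w,\mathbf{H}^0_w$ be the vectors of values of $E_w(\cdot,0),H_w(\cdot,0)$ at the grid points, and $\widehat{\mathbf{E}}^0_w=(\mathcal{F}_{N_z}\otimes\mathcal{F}_{N_y}\otimes\mathcal{F}_{N_x})\mathbf{E}^0_w$, $\widehat{\mathbf{H}}^0_w=(\mathcal{F}_{N_z}\otimes\mathcal{F}_{N_y}\otimes\mathcal{F}_{N_x})\mathbf{H}^0_w$. With $\tau=t_{end}/\sqrt{\mu\varepsilon}$, $$\mathbf{c}=\begin{pmatrix}\mathbf{c}_{11}&\mathbf{c}_{12}&\mathbf{c}_{13}\\\mathbf{c}_{12}&\mathbf{c}_{22}&\mathbf{c}_{23}\\\mathbf{c}_{13}&\mathbf{c}_{23}&\mathbf{c}_{33}\end{pmatrix},\qquad \mathbf{s}=\begin{pmatrix}\mathbf{0}&-\mathbf{s}_{12}&\mathbf{s}_{13}\\\mathbf{s}_{12}&\mathbf{0}&-\mathbf{s}_{23}\\-\mathbf{s}_{13}&\mathbf{s}_{23}&\mathbf{0}\end{pmatrix},$$ and $\widehat{\mathbf{E}}=(\widehat{\mathbf{E}}_x,\widehat{\mathbf{E}}_y,\widehat{\mathbf{E}}_z)^\intercal$,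 $\widehat{\mathbf{H}}=(\widehat{\mathbf{H}}_x,\widehat{\mathbf{H}}_y,\widehat{\mathbf{H}}_z)^\intercal$ (stacked), set $$\sqrt\mu\,\widehat{\mathbf{H}}^{t_{end}}=\sqrt\mu\,\mathbf{c}\,\widehat{\mathbf{H}}^0-\sqrt\varepsilon\,\mathbf{s}\,\widehat{\mathbf{E}}^0,\qquad \sqrt\varepsilon\,\widehat{\mathbf{E}}^{t_{end}}=\sqrt\varepsilon\,\mathbf{c}\,\widehat{\mathbf{E}}^0+\sqrt\mu\,\mathbf{s}\,\widehat{\mathbf{H}}^0,$$ and $\mathbf{E}^{t_{end}}_w=(\mathcal{F}^{-1}_{N_z}\otimes\mathcal{F}^{-1}_{N_y}\otimes\mathcal{F}^{-1}_{N_x})\widehat{\mathbf{E}}^{t_{end}}_w$, $\mathbf{H}^{t_{end}}_w=(\mathcal{F}^{-1}_{N_z}\otimes\mathcal{F}^{-1}_{N_y}\otimes\mathcal{F}^{-1}_{N_x})\widehat{\mathbf{H}}^{t_{end}}_w$ for $w=x,y,z$. *)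

theory Defs
  imports "HOL-Analysis.Analysis" "Jordan_Normal_Form.Matrix"
begin

(* The dollar sign is kept for components of real^3; entries of the dynamically sized
   vectors of Jordan_Normal_Form are written with vec_index. *)
no_notation vec_index (infixl "$" 100)

section \<open>The domain and smooth functions\<close>

definition wL :: real where "wL = 0"
definition wR :: real where "wR = 2 * pi"

definition cube :: "(real^3) set" where
  "cube = cbox (\<chi> i. wL) (\<chi> i. wR)"

abbreviation cube_measure :: "(real^3) measure" where
  "cube_measure \<equiv> lebesgue_on cube"

definition partial_deriv :: "3 \<Rightarrow> (real^3 \<Rightarrow> real) \<Rightarrow> real^3 \<Rightarrow> real" where
  "partial_deriv i f = (\<lambda>x. frechet_derivative f (at x) (axis i 1))"

fun Ck :: "nat \<Rightarrow> (real^3 \<Rightarrow> real) \<Rightarrow> bool" where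
  "Ck 0 f \<longleftrightarrow> continuous_on UNIV f"
| "Ck (Suc k) f \<longleftrightarrow> (\<forall>x. f differentiable (at x)) \<and> (\<forall>i. Ck k (partial_deriv i f))"

definition smooth :: "(real^3 \<Rightarrow> real) \<Rightarrow> bool" where
  "smooth f \<longleftrightarrow> (\<forall>k. Ck k f)"

definition Cinf_per :: "(real^3 \<Rightarrow> real) set" where
  "Cinf_per = {\<phi>. smooth \<phi> \<and> (\<forall>x i. \<phi> (x + axis i (2 * pi)) = \<phi> x)}"

definition test_functions :: "(real^3 \<Rightarrow> real) set" where
  "test_functions = {\<phi>. smooth \<phi> \<and> closure {x. \<phi> x \<noteq> 0} \<subseteq> interior cube}"

section \<open>Sobolev spaces of real order\<close>

type_synonym mindex = "3 \<Rightarrow> nat"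

definition mlen :: "mindex \<Rightarrow> nat" where
  "mlen \<alpha> = (\<Sum>i\<in>UNIV. \<alpha> i)"

definition unit_index :: "3 \<Rightarrow> mindex" where
  "unit_index i = (\<lambda>j. if j = i then 1 else 0)"

definition mderiv :: "mindex \<Rightarrow> (real^3 \<Rightarrow> real) \<Rightarrow> real^3 \<Rightarrow> real" where
  "mderiv \<alpha> f = (partial_deriv 1 ^^ \<alpha> 1) ((partial_deriv 2 ^^ \<alpha> 2) ((partial_deriv 3 ^^ \<alpha> 3) f))"

definition L2 :: "(real^3 \<Rightarrow> real) set" where
  "L2 = {u. u \<in> borel_measurable cube_measure \<and> integrable cube_measure (\<lambda>x. (u x)\<^sup>2)}"

definition has_weak_deriv :: "(real^3 \<Rightarrow> real) \<Rightarrow> mindex \<Rightarrow> (real^3 \<Rightarrow> real) \<Rightarrow> bool" where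
  "has_weak_deriv u \<alpha> v \<longleftrightarrow> u \<in> L2 \<and> v \<in> L2 \<and>
     (\<forall>\<phi>\<in>test_functions.
        (LINT x|cube_measure. u x * mderiv \<alpha> \<phi> x) =
        (-1) ^ mlen \<alpha> * (LINT x|cube_measure. v x * \<phi> x))"

(* Weak derivatives are unique almost everywhere; a representative is chosen. *)
definition weak_deriv :: "mindex \<Rightarrow> (real^3 \<Rightarrow> real) \<Rightarrow> real^3 \<Rightarrow> real" where
  "weak_deriv \<alpha> u = (SOME v. has_weak_deriv u \<alpha> v)"

(* Square of the Sobolev-Slobodeckij (Gagliardo) seminorm of order s in (0,1) on the cube;
   the exponent is the dimension 3 plus 2s. *)
definition gagliardo :: "real \<Rightarrow> (real^3 \<Rightarrow> real) \<Rightarrow> ennreal" where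
  "gagliardo s v = (\<integral>\<^sup>+x. (\<integral>\<^sup>+y. ennreal ((v x - v y)\<^sup>2 / norm (x - y) powr (3 + 2 * s))
     \<partial>cube_measure) \<partial>cube_measure)"

(* H^r for real r >= 0: with m the integer part of r, weak derivatives up to order m lie in L2
   and, if r is not an integer, those of order m have finite seminorm of order r - m. *)
definition sobolev :: "real \<Rightarrow> (real^3 \<Rightarrow> real) set" where
  "sobolev r = {u. (\<forall>\<alpha>. mlen \<alpha> \<le> nat \<lfloor>r\<rfloor> \<longrightarrow> (\<exists>v. has_weak_deriv u \<alpha> v)) \<and>
     (frac r \<noteq> 0 \<longrightarrow>
       (\<forall>\<alpha>. mlen \<alpha> = nat \<lfloor>r\<rfloor> \<longrightarrow> gagliardo (frac r) (weak_deriv \<alpha> u) < \<infinity>))}"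

definition sobolev_norm :: "real \<Rightarrow> (real^3 \<Rightarrow> real) \<Rightarrow> real" where
  "sobolev_norm r u = sqrt (
     (\<Sum>\<alpha> | mlen \<alpha> \<le> nat \<lfloor>r\<rfloor>. LINT x|cube_measure. (weak_deriv \<alpha> u x)\<^sup>2) +
     (if frac r = 0 then 0
      else \<Sum>\<alpha> | mlen \<alpha> = nat \<lfloor>r\<rfloor>. enn2real (gagliardo (frac r) (weak_deriv \<alpha> u))))"

definition sobolev_per :: "real \<Rightarrow> (real^3 \<Rightarrow> real) set" where
  "sobolev_per r = {u \<in> sobolev r.
     \<forall>e>0. \<exists>\<phi>\<in>Cinf_per. sobolev_norm r (\<lambda>x. u x - \<phi> x) < e}"

definition vsobolev_per :: "real \<Rightarrow> (real^3 \<Rightarrow> real^3) set" where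
  "vsobolev_per r = {F. \<forall>i. (\<lambda>x. F x $ i) \<in> sobolev_per r}"

definition vsobolev_norm :: "real \<Rightarrow> (real^3 \<Rightarrow> real^3) \<Rightarrow> real" where
  "vsobolev_norm r F = sqrt (\<Sum>i\<in>UNIV. (sobolev_norm r (\<lambda>x. F x $ i))\<^sup>2)"

section \<open>Maxwell's equations\<close>

definition weak_partial :: "3 \<Rightarrow> (real^3 \<Rightarrow> real) \<Rightarrow> real^3 \<Rightarrow> real" where
  "weak_partial i = weak_deriv (unit_index i)"

definition curl :: "(real^3 \<Rightarrow> real^3) \<Rightarrow> real^3 \<Rightarrow> real^3" where
  "curl F x = vector [
     weak_partial 2 (\<lambda>y. F y $ 3) x - weak_partial 3 (\<lambda>y. F y $ 2) x,
     weak_partial 3 (\<lambda>y. F y $ 1) x - weak_partial 1 (\<lambda>y. F y $ 3) x,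
     weak_partial 1 (\<lambda>y. F y $ 2) x - weak_partial 2 (\<lambda>y. F y $ 1) x]"

definition divergence :: "(real^3 \<Rightarrow> real^3) \<Rightarrow> real^3 \<Rightarrow> real" where
  "divergence F x = (\<Sum>i\<in>UNIV. weak_partial i (\<lambda>y. F y $ i) x)"

(* U is of class C^1 with values in [H^r_p]^3 and time derivative U': continuous on [0,T],
   continuously differentiable on (0,T), everything with respect to the H^r norm. *)
definition C1_sobolev_per ::
  "real \<Rightarrow> real \<Rightarrow> (real \<Rightarrow> real^3 \<Rightarrow> real^3) \<Rightarrow> (real \<Rightarrow> real^3 \<Rightarrow> real^3) \<Rightarrow> bool" where
  "C1_sobolev_per r T U U' \<longleftrightarrow>
     (\<forall>t\<in>{0..T}. U t \<in> vsobolev_per r \<and>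
        ((\<lambda>s. vsobolev_norm r (\<lambda>x. U s x - U t x)) \<longlongrightarrow> 0) (at t within {0..T})) \<and>
     (\<forall>t\<in>{0<..<T}. U' t \<in> vsobolev_per r \<and>
        ((\<lambda>s. vsobolev_norm r (\<lambda>x. (U s x - U t x) /\<^sub>R (s - t) - U' t x)) \<longlongrightarrow> 0) (at t) \<and>
        ((\<lambda>s. vsobolev_norm r (\<lambda>x. U' s x - U' t x)) \<longlongrightarrow> 0) (at t))"

(* The periodic boundary conditions are contained in the membership in [H^r_p]^3.  The equations
   hold in the L2 sense, i.e. almost everywhere.  Since r > 3/2, elements of H^r_p have a
   continuous representative on the closed cube; point values (and hence values at grid points)
   refer to it, so U t is required to be that representative. *)
definition maxwell_solution ::
  "real \<Rightarrow> real \<Rightarrow> real \<Rightarrow> real \<Rightarrow> (real^3 \<Rightarrow> real^3) \<Rightarrow> (real^3 \<Rightarrow> real^3) \<Rightarrow>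
   (real \<Rightarrow> real^3 \<Rightarrow> real^3) \<Rightarrow> (real \<Rightarrow> real^3 \<Rightarrow> real^3) \<Rightarrow> bool" where
  "maxwell_solution r \<mu> \<epsilon> T H0 E0 H E \<longleftrightarrow>
     (\<exists>H' E'.
        C1_sobolev_per r T H H' \<and> C1_sobolev_per r T E E' \<and>
        (\<forall>t\<in>{0<..<T}. AE x in cube_measure. H' t x = - ((1 / \<mu>) *\<^sub>R curl (E t) x)) \<and>
        (\<forall>t\<in>{0<..<T}. AE x in cube_measure. E' t x = (1 / \<epsilon>) *\<^sub>R curl (H t) x)) \<and>
     (\<forall>t\<in>{0..T}. AE x in cube_measure. divergence (\<lambda>y. \<epsilon> *\<^sub>R E t y) x = 0) \<and>
     (\<forall>t\<in>{0..T}. AE x in cube_measure. divergence (\<lambda>y. \<epsilon> *\<^sub>R H t y) x = 0) \<and>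
     (\<forall>t\<in>{0..T}. continuous_on cube (H t) \<and> continuous_on cube (E t)) \<and>
     (\<forall>x\<in>cube. H 0 x = H0 x \<and> E 0 x = E0 x)"

section \<open>Grid functions\<close>

definition hstep :: "nat \<Rightarrow> real" where
  "hstep N = (wR - wL) / real N"

definition grid_point :: "nat \<Rightarrow> nat \<Rightarrow> nat \<Rightarrow> nat \<Rightarrow> real^3" where
  "grid_point N j k l = vector [wL + (real j - 1) * hstep N, wL + (real k - 1) * hstep N,
     wL + (real l - 1) * hstep N]"

(* Zero-based position of the (one-based) grid index (j,k,l). *)
definition grid_index :: "nat \<Rightarrow> nat \<Rightarrow> nat \<Rightarrow> nat \<Rightarrow> nat" where
  "grid_index N j k l = N * N * (l - 1) + N * (k - 1) + (j - 1)"

definition grid_vec :: "nat \<Rightarrow> (real^3 \<Rightarrow> real) \<Rightarrow> complex Matrix.vec" where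
  "grid_vec N f = Matrix.vec (N ^ 3) (\<lambda>p. complex_of_real
     (f (grid_point N (p mod N + 1) ((p div N) mod N + 1) (p div (N * N) + 1))))"

definition grid_field :: "nat \<Rightarrow> (real^3 \<Rightarrow> real^3) \<Rightarrow> 3 \<Rightarrow> complex Matrix.vec" where
  "grid_field N F = (\<lambda>i. grid_vec N (\<lambda>x. F x $ i))"

definition grid_inner :: "nat \<Rightarrow> complex Matrix.vec \<Rightarrow> complex Matrix.vec \<Rightarrow> complex" where
  "grid_inner N u v = 1 / of_nat N ^ 3 *
     (\<Sum>j=1..N. \<Sum>k=1..N. \<Sum>l=1..N.
        vec_index u (grid_index N j k l) * cnj (vec_index v (grid_index N j k l)))"

definition grid_norm :: "nat \<Rightarrow> (3 \<Rightarrow> complex Matrix.vec) \<Rightarrow> real" where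
  "grid_norm N F = sqrt (Re (\<Sum>i\<in>UNIV. grid_inner N (F i) (F i)))"

section \<open>The matrices of the scheme\<close>

definition kron :: "complex Matrix.mat \<Rightarrow> complex Matrix.mat \<Rightarrow> complex Matrix.mat"
    (infixr "\<otimes>\<^sub>K" 72) where
  "A \<otimes>\<^sub>K B = Matrix.mat (dim_row A * dim_row B) (dim_col A * dim_col B)
     (\<lambda>(i, j). A $$ (i div dim_row B, j div dim_col B) * B $$ (i mod dim_row B, j mod dim_col B))"

definition DFT :: "nat \<Rightarrow> complex Matrix.mat" where
  "DFT N = Matrix.mat N N (\<lambda>(j, k). exp (2 * pi * \<i> / of_nat N) powi (- int (j * k)))"

definition IDFT :: "nat \<Rightarrow> complex Matrix.mat" where
  "IDFT N = Matrix.mat N N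
     (\<lambda>(j, k). 1 / of_nat N * exp (2 * pi * \<i> / of_nat N) powi (int (j * k)))"

definition DFT3 :: "nat \<Rightarrow> complex Matrix.mat" where
  "DFT3 N = DFT N \<otimes>\<^sub>K DFT N \<otimes>\<^sub>K DFT N"

definition IDFT3 :: "nat \<Rightarrow> complex Matrix.mat" where
  "IDFT3 N = IDFT N \<otimes>\<^sub>K IDFT N \<otimes>\<^sub>K IDFT N"

definition nu :: real where
  "nu = 2 * pi / (wR - wL)"

(* The diagonal 0, 1, ..., N/2-1, 0, -N/2+1, ..., -2, -1. *)
definition freq :: "nat \<Rightarrow> nat \<Rightarrow> int" where
  "freq N j = (if j < N div 2 then int j else if j = N div 2 then 0 else int j - int N)"

definition Omega :: "nat \<Rightarrow> complex Matrix.mat" where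
  "Omega N = complex_of_real nu \<cdot>\<^sub>m mat_diag N (\<lambda>j. of_int (freq N j))"

definition Omega1 :: "nat \<Rightarrow> complex Matrix.mat" where
  "Omega1 N = 1\<^sub>m N \<otimes>\<^sub>K 1\<^sub>m N \<otimes>\<^sub>K Omega N"

definition Omega2 :: "nat \<Rightarrow> complex Matrix.mat" where
  "Omega2 N = 1\<^sub>m N \<otimes>\<^sub>K Omega N \<otimes>\<^sub>K 1\<^sub>m N"

definition Omega3 :: "nat \<Rightarrow> complex Matrix.mat" where
  "Omega3 N = Omega N \<otimes>\<^sub>K 1\<^sub>m N \<otimes>\<^sub>K 1\<^sub>m N"

definition Psi :: "nat \<Rightarrow> complex \<Rightarrow> complex Matrix.mat" where
  "Psi N \<tau> = \<tau>\<^sup>2 \<cdot>\<^sub>m (Omega1 N * Omega1 N + Omega2 N * Omega2 N + Omega3 N * Omega3 N)"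

definition matA :: "nat \<Rightarrow> complex \<Rightarrow> complex Matrix.mat" where
  "matA N \<tau> = mat_diag (N ^ 3) (\<lambda>p. let \<psi> = Psi N \<tau> $$ (p, p) in
     if \<psi> = 0 then - 1 / 2 else (cosh (csqrt (- \<psi>)) - 1) / \<psi>)"

definition matB :: "nat \<Rightarrow> complex \<Rightarrow> complex Matrix.mat" where
  "matB N \<tau> = mat_diag (N ^ 3) (\<lambda>p. let \<psi> = Psi N \<tau> $$ (p, p) in
     if \<psi> = 0 then 1 else sinh (csqrt (- \<psi>)) / csqrt (- \<psi>))"

definition c11 :: "nat \<Rightarrow> complex \<Rightarrow> complex Matrix.mat" where
  "c11 N \<tau> = 1\<^sub>m (N ^ 3) + \<tau>\<^sup>2 \<cdot>\<^sub>m ((Omega3 N * Omega3 N + Omega2 N * Omega2 N) * matA N \<tau>)"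

definition c22 :: "nat \<Rightarrow> complex \<Rightarrow> complex Matrix.mat" where
  "c22 N \<tau> = 1\<^sub>m (N ^ 3) + \<tau>\<^sup>2 \<cdot>\<^sub>m ((Omega3 N * Omega3 N + Omega1 N * Omega1 N) * matA N \<tau>)"

definition c33 :: "nat \<Rightarrow> complex \<Rightarrow> complex Matrix.mat" where
  "c33 N \<tau> = 1\<^sub>m (N ^ 3) + \<tau>\<^sup>2 \<cdot>\<^sub>m ((Omega2 N * Omega2 N + Omega1 N * Omega1 N) * matA N \<tau>)"

definition c12 :: "nat \<Rightarrow> complex \<Rightarrow> complex Matrix.mat" where
  "c12 N \<tau> = - (\<tau>\<^sup>2) \<cdot>\<^sub>m (Omega2 N * Omega1 N * matA N \<tau>)"

definition c13 :: "nat \<Rightarrow> complex \<Rightarrow> complex Matrix.mat" where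
  "c13 N \<tau> = - (\<tau>\<^sup>2) \<cdot>\<^sub>m (Omega3 N * Omega1 N * matA N \<tau>)"

definition c23 :: "nat \<Rightarrow> complex \<Rightarrow> complex Matrix.mat" where
  "c23 N \<tau> = - (\<tau>\<^sup>2) \<cdot>\<^sub>m (Omega3 N * Omega2 N * matA N \<tau>)"

definition s12 :: "nat \<Rightarrow> complex \<Rightarrow> complex Matrix.mat" where
  "s12 N \<tau> = (\<i> * \<tau>) \<cdot>\<^sub>m (Omega3 N * matB N \<tau>)"

definition s13 :: "nat \<Rightarrow> complex \<Rightarrow> complex Matrix.mat" where
  "s13 N \<tau> = (\<i> * \<tau>) \<cdot>\<^sub>m (Omega2 N * matB N \<tau>)"

definition s23 :: "nat \<Rightarrow> complex \<Rightarrow> complex Matrix.mat" where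
  "s23 N \<tau> = (\<i> * \<tau>) \<cdot>\<^sub>m (Omega1 N * matB N \<tau>)"

(* The 3n x 3n matrix assembled from a 3 x 3 array of n x n blocks. *)
definition block3 :: "nat \<Rightarrow> complex Matrix.mat list list \<Rightarrow> complex Matrix.mat" where
  "block3 n M = Matrix.mat (3 * n) (3 * n)
     (\<lambda>(i, j). (M ! (i div n) ! (j div n)) $$ (i mod n, j mod n))"

definition cmat :: "nat \<Rightarrow> complex \<Rightarrow> complex Matrix.mat" where
  "cmat N \<tau> = block3 (N ^ 3)
     [[c11 N \<tau>, c12 N \<tau>, c13 N \<tau>],
      [c12 N \<tau>, c22 N \<tau>, c23 N \<tau>],
      [c13 N \<tau>, c23 N \<tau>, c33 N \<tau>]]"

definition smat :: "nat \<Rightarrow> complex \<Rightarrow> complex Matrix.mat" where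
  "smat N \<tau> = block3 (N ^ 3)
     [[0\<^sub>m (N ^ 3) (N ^ 3), - s12 N \<tau>, s13 N \<tau>],
      [s12 N \<tau>, 0\<^sub>m (N ^ 3) (N ^ 3), - s23 N \<tau>],
      [- s13 N \<tau>, s23 N \<tau>, 0\<^sub>m (N ^ 3) (N ^ 3)]]"

section \<open>The fully discrete scheme\<close>

definition stack :: "(3 \<Rightarrow> complex Matrix.vec) \<Rightarrow> complex Matrix.vec" where
  "stack F = F 1 @\<^sub>v F 2 @\<^sub>v F 3"

definition unstack :: "nat \<Rightarrow> complex Matrix.vec \<Rightarrow> 3 \<Rightarrow> complex Matrix.vec" where
  "unstack n V = (\<lambda>i. Matrix.vec n (\<lambda>p. vec_index V
     (if i = 1 then p else if i = 2 then n + p else 2 * n + p)))"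

definition hat_field :: "nat \<Rightarrow> (real^3 \<Rightarrow> real^3) \<Rightarrow> complex Matrix.vec" where
  "hat_field N F = stack (\<lambda>i. DFT3 N *\<^sub>v grid_field N F i)"

definition tau :: "real \<Rightarrow> real \<Rightarrow> real \<Rightarrow> complex" where
  "tau \<mu> \<epsilon> T = complex_of_real (T / sqrt (\<mu> * \<epsilon>))"

definition hat_H_end ::
  "nat \<Rightarrow> real \<Rightarrow> real \<Rightarrow> real \<Rightarrow> (real^3 \<Rightarrow> real^3) \<Rightarrow> (real^3 \<Rightarrow> real^3) \<Rightarrow> complex Matrix.vec" where
  "hat_H_end N \<mu> \<epsilon> T H0 E0 = complex_of_real (1 / sqrt \<mu>) \<cdot>\<^sub>v
     (complex_of_real (sqrt \<mu>) \<cdot>\<^sub>v (cmat N (tau \<mu> \<epsilon> T) *\<^sub>v hat_field N H0)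
      - complex_of_real (sqrt \<epsilon>) \<cdot>\<^sub>v (smat N (tau \<mu> \<epsilon> T) *\<^sub>v hat_field N E0))"

definition hat_E_end ::
  "nat \<Rightarrow> real \<Rightarrow> real \<Rightarrow> real \<Rightarrow> (real^3 \<Rightarrow> real^3) \<Rightarrow> (real^3 \<Rightarrow> real^3) \<Rightarrow> complex Matrix.vec" where
  "hat_E_end N \<mu> \<epsilon> T H0 E0 = complex_of_real (1 / sqrt \<epsilon>) \<cdot>\<^sub>v
     (complex_of_real (sqrt \<epsilon>) \<cdot>\<^sub>v (cmat N (tau \<mu> \<epsilon> T) *\<^sub>v hat_field N E0)
      + complex_of_real (sqrt \<mu>) \<cdot>\<^sub>v (smat N (tau \<mu> \<epsilon> T) *\<^sub>v hat_field N H0))"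

definition H_end ::
  "nat \<Rightarrow> real \<Rightarrow> real \<Rightarrow> real \<Rightarrow> (real^3 \<Rightarrow> real^3) \<Rightarrow> (real^3 \<Rightarrow> real^3) \<Rightarrow> 3 \<Rightarrow> complex Matrix.vec" where
  "H_end N \<mu> \<epsilon> T H0 E0 = (\<lambda>i. IDFT3 N *\<^sub>v unstack (N ^ 3) (hat_H_end N \<mu> \<epsilon> T H0 E0) i)"

definition E_end ::
  "nat \<Rightarrow> real \<Rightarrow> real \<Rightarrow> real \<Rightarrow> (real^3 \<Rightarrow> real^3) \<Rightarrow> (real^3 \<Rightarrow> real^3) \<Rightarrow> 3 \<Rightarrow> complex Matrix.vec" where
  "E_end N \<mu> \<epsilon> T H0 E0 = (\<lambda>i. IDFT3 N *\<^sub>v unstack (N ^ 3) (hat_E_end N \<mu> \<epsilon> T H0 E0) i)"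

definition grid_error ::
  "nat \<Rightarrow> (3 \<Rightarrow> complex Matrix.vec) \<Rightarrow> (real^3 \<Rightarrow> real^3) \<Rightarrow> real" where
  "grid_error N V F = grid_norm N (\<lambda>i. V i - grid_field N F i)"

end

theory Submission
  imports Defs
begin

text \<open>Expand the components in Fourier series over the cube, with frequencies k in Z^3.  For a solution,
  every pair of vector coefficients solves a linear constant coefficient system which, because
  k is orthogonal to both coefficients, is solved by the closed formulas of the scheme evaluated
  at the frequency k.  On the grid the scheme acts on exp(i k.x) through the same formulas,
  evaluated at the representative of k modulo N that is used in the diagonal matrices; for all k with
  entries smaller than N/2 this is k itself.  Hence the error is a Fourier series over high
  frequencies only, whose coefficients are bounded by those of the initial data uniformly
  in time, and its grid norm is estimated by comparing frequencies that coincide modulo N.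

  Only integer order derivatives are used, although r is real.  The time derivatives, that is the
  curls, lie in the periodic Sobolev space too, and together with the vanishing
  divergence this gains one derivative: at interior times, and then by propagation at time 0,
  the coefficients are square summable with weight |k|^(2M) for M = floor r + 1 > r.
  (For r - 1/2 an integer, membership in the closure of the smooth periodic functions does not by itself
  give square summability with weight |k|^(2r), so this gain is needed.)

  Weak derivatives are never identified almost everywhere.  It suffices that any two weak derivatives
  of a function have the same Fourier coefficients, which follows by testing with cut-off exponentials.\<close>

section \<open>Smooth functions\<close>

text \<open>The constant may depend on \<open>H0\<close> and \<open>E0\<close> only, yet their extra
  smoothness is extracted from a solution, whose parameters \<mu>, \<epsilon>, T are arbitrary. If
  no parameters admit a solution, the estimate is vacuous; otherwise one solution is fixed and
  serves only to show that certain weighted sums of the coefficients of \<open>H0\<close> and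
  \<open>E0\<close> are finite. These sums then bound the error of every other solution with the
  same data. Uniformity in time and in the medium comes from bounds on the closed formulas that
  contain neither the frequency nor the time. At an aliased frequency the coefficients need not be
  orthogonal to the representative that the scheme uses. The closed formulas are therefore kept in
  their full form, with the component along the frequency, and are bounded without the divergence
  condition. Since M >= 2, the weights |k|^(2M) also make the Fourier series absolutely convergent,
  which links the coefficients to the point values on the grid. The factor obtained is N^(-M), which
  is at most N^(-r).\<close>

lemma partial_deriv_eqI:
  assumes "(f has_derivative f') (at x)"
  shows "partial_deriv i f x = f' (axis i 1)"
  using frechet_derivative_at[OF assms] by (simp add: partial_deriv_def)

lemma has_derivative_frechet:
  "f differentiable (at x) \<Longrightarrow> (f has_derivative frechet_derivative f (at x)) (at x)"
  by (simp add: frechet_derivative_works)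

lemma Ck_Suc_D: "Ck (Suc k) f \<Longrightarrow> Ck k f"
proof (induction k arbitrary: f)
  case 0
  then show ?case
    by (simp add: continuous_on_eq_continuous_at differentiable_imp_continuous_within)
next
  case (Suc k)
  then show ?case by simp
qed

lemma Ck_const: "Ck k (\<lambda>x. c)"
proof (induction k arbitrary: c)
  case (Suc k)
  have "partial_deriv i (\<lambda>x. c) = (\<lambda>x. 0)" for i
    by (rule ext, subst partial_deriv_eqI[OF has_derivative_const]) simp
  then show ?case using Suc by simp
qed simp

lemma Ck_add: "Ck k f \<Longrightarrow> Ck k g \<Longrightarrow> Ck k (\<lambda>x. f x + g x)"
proof (induction k arbitrary: f g)
  case 0
  then show ?case by (simp add: continuous_on_add)
next
  case (Suc k)
  have "partial_deriv i (\<lambda>x. f x + g x) = (\<lambda>x. partial_deriv i f x + partial_deriv i g x)" for i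
    using Suc.prems
    by (intro ext, subst partial_deriv_eqI[OF has_derivative_add[OF has_derivative_frechet has_derivative_frechet]])
       (auto simp: partial_deriv_def)
  then show ?case using Suc by simp
qed

lemma partial_deriv_mult:
  assumes "f differentiable (at x)" "g differentiable (at x)"
  shows "partial_deriv i (\<lambda>x. f x * g x) x = f x * partial_deriv i g x + partial_deriv i f x * g x"
  using assms
  by (subst partial_deriv_eqI[OF has_derivative_mult[OF has_derivative_frechet has_derivative_frechet]])
     (auto simp: partial_deriv_def)

lemma Ck_mult: "Ck k f \<Longrightarrow> Ck k g \<Longrightarrow> Ck k (\<lambda>x. f x * g x)"
proof (induction k arbitrary: f g)
  case 0
  then show ?case by (simp add: continuous_on_mult)
next
  case (Suc k)
  have "partial_deriv i (\<lambda>x. f x * g x) = (\<lambda>x. f x * partial_deriv i g x + partial_deriv i f x * g x)" for i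
    using Suc.prems by (intro ext partial_deriv_mult) auto
  moreover have "Ck k f" "Ck k g"
    using Suc.prems by (auto intro: Ck_Suc_D simp del: Ck.simps)
  ultimately show ?case using Suc by (simp add: Ck_add)
qed

lemma partial_deriv_compose_real:
  assumes "(\<phi> has_real_derivative d) (at (g x))" "g differentiable (at x)"
  shows "((\<lambda>x. \<phi> (g x)) has_derivative (\<lambda>h. frechet_derivative g (at x) h * d)) (at x)"
    and "partial_deriv i (\<lambda>x. \<phi> (g x)) x = d * partial_deriv i g x"
proof -
  show 1: "((\<lambda>x. \<phi> (g x)) has_derivative (\<lambda>h. frechet_derivative g (at x) h * d)) (at x)"
    by (rule DERIV_compose_FDERIV[OF assms(1) has_derivative_frechet[OF assms(2)]])
  show "partial_deriv i (\<lambda>x. \<phi> (g x)) x = d * partial_deriv i g x"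
    by (subst partial_deriv_eqI[OF 1]) (simp add: partial_deriv_def)
qed

text \<open>The outer function comes as a sequence \<open>D\<close> of successive derivatives. The
  induction keeps n arbitrary, because the chain rule replaces \<open>D n\<close> by
  \<open>D (Suc n)\<close>.\<close>

lemma Ck_compose_real:
  fixes D :: "nat \<Rightarrow> real \<Rightarrow> real"
  assumes D: "\<And>n t. (D n has_real_derivative D (Suc n) t) (at t)"
  assumes "Ck k g"
  shows "Ck k (\<lambda>x. D n (g x))"
  using assms(2)
proof (induction k arbitrary: n)
  case 0
  have "continuous_on UNIV (D n)"
    by (intro continuous_at_imp_continuous_on ballI DERIV_isCont[OF D])
  then have "continuous_on UNIV (\<lambda>x. D n (g x))"
    using 0 by (intro continuous_on_compose2[of UNIV "D n" UNIV g]) auto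
  then show ?case by simp
next
  case (Suc k)
  have "partial_deriv i (\<lambda>x. D n (g x)) = (\<lambda>x. D (Suc n) (g x) * partial_deriv i g x)" for i
    using Suc.prems by (intro ext partial_deriv_compose_real(2)[OF D]) auto
  moreover have "Ck k (\<lambda>x. D (Suc n) (g x))"
    using Suc Ck_Suc_D by blast
  moreover have "(\<lambda>x. D n (g x)) differentiable at x" for x
    using partial_deriv_compose_real(1)[OF D] Suc.prems differentiable_def by fastforce
  ultimately show ?case
    using Suc.prems by (simp add: Ck_mult)
qed

lemma Ck_linear:
  assumes "bounded_linear f"
  shows "Ck k f"
proof (cases k)
  case 0
  then show ?thesis using assms by (simp add: linear_continuous_on)
next
  case (Suc n)
  have "(f has_derivative f) (at x)" for x
    using assms bounded_linear_imp_has_derivative by blast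
  then have "partial_deriv i f = (\<lambda>x. f (axis i 1))" "f differentiable (at x)" for i x
    using partial_deriv_eqI by (auto simp: differentiable_def)
  then show ?thesis by (simp add: Ck_const Suc)
qed

lemma smooth_const: "smooth (\<lambda>x. c)" by (simp add: smooth_def Ck_const)
lemma smooth_add: "smooth f \<Longrightarrow> smooth g \<Longrightarrow> smooth (\<lambda>x. f x + g x)" by (simp add: smooth_def Ck_add)
lemma smooth_mult: "smooth f \<Longrightarrow> smooth g \<Longrightarrow> smooth (\<lambda>x. f x * g x)" by (simp add: smooth_def Ck_mult)
lemma smooth_linear: "bounded_linear f \<Longrightarrow> smooth f" by (simp add: smooth_def Ck_linear)
lemma smooth_compose_real:
  fixes D :: "nat \<Rightarrow> real \<Rightarrow> real"
  assumes "\<And>n t. (D n has_real_derivative D (Suc n) t) (at t)" "smooth g"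
  shows "smooth (\<lambda>x. D n (g x))"
  using assms by (simp add: smooth_def Ck_compose_real)

lemma smooth_partial_deriv: "smooth f \<Longrightarrow> smooth (partial_deriv i f)"
  unfolding smooth_def by (metis Ck.simps(2))

lemma smooth_funpow_partial_deriv: "smooth f \<Longrightarrow> smooth ((partial_deriv i ^^ n) f)"
  by (induction n) (auto intro: smooth_partial_deriv)

lemma smooth_differentiable: "smooth f \<Longrightarrow> f differentiable (at x)"
  unfolding smooth_def by (metis Ck.simps(2))

lemma smooth_continuous: "smooth f \<Longrightarrow> continuous_on A f"
  unfolding smooth_def by (metis Ck.simps(1) continuous_on_subset subset_UNIV)

lemma smooth_prod: "finite A \<Longrightarrow> (\<And>i. i \<in> A \<Longrightarrow> smooth (f i)) \<Longrightarrow> smooth (\<lambda>x. \<Prod>i\<in>A. f i x)"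
  by (induction A rule: finite_induct) (auto intro: smooth_const smooth_mult)

text \<open>Each derivative of the cosine is a shift by a quarter period, so the sequence of
  derivatives has a closed form.\<close>

lemma smooth_cos:
  assumes "smooth g"
  shows "smooth (\<lambda>x. cos (g x))"
proof -
  have "((\<lambda>t. cos (t + real n * (pi / 2))) has_real_derivative cos (t + real (Suc n) * (pi / 2))) (at t)" for n t
  proof -
    have "t + real (Suc n) * (pi / 2) = (t + real n * (pi / 2)) + pi / 2"
      by (simp add: field_simps)
    then have "cos (t + real (Suc n) * (pi / 2)) = - sin (t + real n * (pi / 2))"
      by (simp only: cos_add) simp
    moreover have "((\<lambda>t. cos (t + real n * (pi / 2))) has_real_derivative - sin (t + real n * (pi / 2)) * (1 + 0)) (at t)"
      by (auto intro!: derivative_eq_intros)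
    ultimately show ?thesis by simp
  qed
  from smooth_compose_real[of "\<lambda>n t. cos (t + real n * (pi / 2))", OF this assms, of 0] show ?thesis
    by simp
qed

section \<open>Cut-off functions\<close>

text \<open>With z = 1/t, the n-th derivative of exp(-1/t) on t > 0 is p_n(z) exp(-z). Since dz/dt =
  -z^2, differentiating gives p_(n+1) = z^2 (p_n - p_n').\<close>

primrec bump_poly :: "nat \<Rightarrow> real poly" where
  "bump_poly 0 = 1"
| "bump_poly (Suc n) = [:0, 0, 1:] * (bump_poly n - pderiv (bump_poly n))"

definition bump_deriv :: "nat \<Rightarrow> real \<Rightarrow> real" where
  "bump_deriv n t = (if t \<le> 0 then 0 else poly (bump_poly n) (1 / t) * exp (- (1 / t)))"

lemma poly_exp_tendsto_0: "((\<lambda>y. poly p y * exp (- y)) \<longlongrightarrow> 0) (at_top :: real filter)"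
proof -
  have "((\<lambda>y. \<Sum>i\<le>degree p. coeff p i * (y ^ i / exp y)) \<longlongrightarrow> (\<Sum>i\<le>degree p. coeff p i * 0)) at_top"
    by (intro tendsto_intros tendsto_power_div_exp_0)
  then show ?thesis
    by (simp add: poly_altdef sum_distrib_right exp_minus field_class.field_divide_inverse mult.assoc)
qed

text \<open>Only t = 0 is delicate: there the difference quotient from the right is a polynomial in
  1/h times exp(-1/h), which tends to 0.\<close>

lemma bump_deriv_has_derivative:
  "(bump_deriv n has_real_derivative bump_deriv (Suc n) t) (at t)"
proof (cases "t < 0" "t = 0" rule: case_split[case_product case_split])
  case (True_False)
  then have "eventually (\<lambda>s. bump_deriv n s = 0) (nhds t)"
    by (intro eventually_nhds[THEN iffD2] exI[of _ "{..<0}"]) (auto simp: bump_deriv_def)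
  moreover have "bump_deriv (Suc n) t = 0" using True_False by (simp add: bump_deriv_def)
  ultimately show ?thesis
    using DERIV_cong_ev[of t t "bump_deriv n" "\<lambda>_. 0" 0 0] by auto
next
  case (False_False)
  then have t: "t > 0" by simp
  then have ev: "eventually (\<lambda>s. bump_deriv n s = poly (bump_poly n) (1 / s) * exp (- (1 / s))) (nhds t)"
    by (intro eventually_nhds[THEN iffD2] exI[of _ "{0<..}"]) (auto simp: bump_deriv_def)
  have inv: "((\<lambda>s. 1 / s) has_real_derivative - (1 / t)\<^sup>2) (at t)"
    using t by (auto intro!: derivative_eq_intros simp: power2_eq_square)
  have "((\<lambda>s. poly (bump_poly n) (1 / s) * exp (- (1 / s))) has_real_derivative
      (poly (pderiv (bump_poly n)) (1 / t) * - (1 / t)\<^sup>2) * exp (- (1 / t))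
      + (exp (- (1 / t)) * - (- (1 / t)\<^sup>2)) * poly (bump_poly n) (1 / t)) (at t)"
    by (intro DERIV_mult DERIV_chain2[OF poly_DERIV] inv DERIV_chain2[OF DERIV_exp] DERIV_minus)
  also have "(poly (pderiv (bump_poly n)) (1 / t) * - (1 / t)\<^sup>2) * exp (- (1 / t))
      + (exp (- (1 / t)) * - (- (1 / t)\<^sup>2)) * poly (bump_poly n) (1 / t) = bump_deriv (Suc n) t"
  proof -
    have "poly (bump_poly (Suc n)) z = z\<^sup>2 * (poly (bump_poly n) z - poly (pderiv (bump_poly n)) z)" for z
      by (simp add: power2_eq_square mult.assoc)
    then show ?thesis using t
      by (simp add: bump_deriv_def del: bump_poly.simps) (simp only: algebra_simps)
  qed
  finally have "((\<lambda>s. poly (bump_poly n) (1 / s) * exp (- (1 / s))) has_real_derivative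
      bump_deriv (Suc n) t) (at t)" .
  then show ?thesis
    using DERIV_cong_ev[OF refl ev refl] by simp
next
  case (False_True)
  have "((\<lambda>h. bump_deriv n h / h) \<longlongrightarrow> 0) (at 0)"
  proof (rule filterlim_split_at)
    have "eventually (\<lambda>h. bump_deriv n h / h = 0) (at_left 0)"
      by (auto simp: eventually_at_filter bump_deriv_def)
    then show "((\<lambda>h. bump_deriv n h / h) \<longlongrightarrow> 0) (at_left 0)"
      by (simp add: tendsto_eventually)
    \<comment> \<open>\<open>pCons 0\<close> multiplies the polynomial by its variable 1/h, which
      accounts for the division by h in the difference quotient.\<close>
    have "((\<lambda>h. poly (pCons 0 (bump_poly n)) (inverse h) * exp (- inverse h)) \<longlongrightarrow> 0) (at_right 0)"
      using poly_exp_tendsto_0 filterlim_inverse_at_top_right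
      by (rule filterlim_compose)
    moreover have "eventually (\<lambda>h. poly (pCons 0 (bump_poly n)) (inverse h) * exp (- inverse h) = bump_deriv n h / h) (at_right 0)"
    proof -
      have "poly (pCons 0 (bump_poly n)) (inverse h) * exp (- inverse h) = bump_deriv n h / h" if "h > 0" for h
        using that by (simp add: bump_deriv_def inverse_eq_divide)
      then show ?thesis by (intro eventually_mono[OF eventually_at_right_less[of "0::real"]])
    qed
    ultimately show "((\<lambda>h. bump_deriv n h / h) \<longlongrightarrow> 0) (at_right 0)"
      by (rule Lim_transform_eventually)
  qed
  then show ?thesis using False_True
    by (simp add: DERIV_def bump_deriv_def)
qed auto

definition bump :: "real \<Rightarrow> real" where "bump = bump_deriv 0"

lemma bump_bounds: "0 \<le> bump t" "bump t \<le> 1" "bump t = 0 \<longleftrightarrow> t \<le> 0"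
  by (auto simp: bump_def bump_deriv_def)

lemma smooth_bump: "smooth g \<Longrightarrow> smooth (\<lambda>x. bump (g x))"
  unfolding bump_def by (rule smooth_compose_real[of bump_deriv, OF bump_deriv_has_derivative])

lemma bump_at_top: "(bump \<longlongrightarrow> 1) at_top"
proof -
  have "((\<lambda>t::real. exp (- inverse t)) \<longlongrightarrow> exp (- 0)) at_top"
    by (intro tendsto_intros tendsto_inverse_0_at_top filterlim_ident)
  moreover have "eventually (\<lambda>t. exp (- inverse t) = bump t) at_top"
    using eventually_gt_at_top[of 0] by eventually_elim (simp add: bump_def bump_deriv_def field_simps)
  ultimately show ?thesis using Lim_transform_eventually by fastforce
qed

text \<open>For n >= 1 this is positive exactly when the i-th entry lies strictly between 1/n and 2
  pi - 1/n. The factor n drives it to infinity at every interior point; as \<open>bump\<close> tends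
  to 1 at infinity, the cut-offs converge to 1 pointwise in the interior.\<close>

definition cutoff_arg :: "nat \<Rightarrow> 3 \<Rightarrow> real^3 \<Rightarrow> real" where
  "cutoff_arg n i x = real n * ((x $ i - 1 / real n) * (2 * pi - 1 / real n - x $ i))"

definition cutoff :: "nat \<Rightarrow> real^3 \<Rightarrow> real" where
  "cutoff n x = (\<Prod>i\<in>UNIV. bump (cutoff_arg n i x))"

lemma cube_alt: "cube = cbox 0 (\<chi> i. 2 * pi)"
  unfolding cube_def wL_def wR_def by (rule arg_cong2[where f = cbox]) (simp_all add: Finite_Cartesian_Product.vec_eq_iff)

lemma mem_cube: "x \<in> cube \<longleftrightarrow> (\<forall>i. 0 \<le> x $ i \<and> x $ i \<le> 2 * pi)"
  by (simp add: cube_alt mem_box_cart)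

lemma mem_interior_cube: "x \<in> interior cube \<longleftrightarrow> (\<forall>i. 0 < x $ i \<and> x $ i < 2 * pi)"
  by (simp add: cube_alt mem_box_cart interior_cbox)

lemma smooth_cutoff: "smooth (cutoff n)"
proof -
  have lin: "smooth (\<lambda>x. x $ i)" for i
    by (rule smooth_linear) (rule bounded_linear_vec_nth)
  have "smooth (\<lambda>x. real n * ((x $ i + (- 1 / real n)) * ((2 * pi - 1 / real n) + (-1) * x $ i)))" for i
    by (intro smooth_mult smooth_add smooth_const lin)
  then have "smooth (cutoff_arg n i)" for i
    by (simp add: cutoff_arg_def[abs_def])
  then show ?thesis
    unfolding cutoff_def[abs_def] by (intro smooth_prod smooth_bump) auto
qed

lemma cutoff_bounds: "0 \<le> cutoff n x" "cutoff n x \<le> 1"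
  unfolding cutoff_def by (auto intro!: prod_nonneg prod_le_1 bump_bounds)

lemma cutoff_support:
  assumes "n \<ge> 1"
  shows "closure {x. cutoff n x \<noteq> 0} \<subseteq> interior cube"
proof -
  have "{x. cutoff n x \<noteq> 0} \<subseteq> cbox (\<chi> i. 1 / real n) (\<chi> i. 2 * pi - 1 / real n)"
  proof
    fix x assume "x \<in> {x. cutoff n x \<noteq> 0}"
    then have "cutoff_arg n i x > 0" for i
      by (simp add: cutoff_def bump_bounds not_le)
    then have *: "(x $ i - 1 / real n) * (2 * pi - 1 / real n - x $ i) > 0" for i
      using assms by (simp add: cutoff_arg_def zero_less_mult_iff)
    have "1 / real n \<le> x $ i \<and> x $ i \<le> 2 * pi - 1 / real n" for i
    proof -
      \<comment> \<open>The product is also positive if both factors are negative; this is excluded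
        because 1/n lies below 2 pi - 1/n.\<close>
      have "1 / real n \<le> 1" "pi > 3" using assms pi_gt3 by auto
      then show ?thesis using *[of i] by (auto simp: zero_less_mult_iff)
    qed
    then show "x \<in> cbox (\<chi> i. 1 / real n) (\<chi> i. 2 * pi - 1 / real n)"
      by (simp add: mem_box_cart)
  qed
  then have "closure {x. cutoff n x \<noteq> 0} \<subseteq> cbox (\<chi> i. 1 / real n) (\<chi> i. 2 * pi - 1 / real n)"
    by (rule closure_minimal) (rule closed_cbox)
  also have "\<dots> \<subseteq> interior cube"
  proof
    fix x :: "real^3" assume "x \<in> cbox (\<chi> i. 1 / real n) (\<chi> i. 2 * pi - 1 / real n)"
    then have "1 / real n \<le> x $ i" "x $ i \<le> 2 * pi - 1 / real n" for i
      by (auto simp: mem_box_cart)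
    moreover have "1 / real n > 0" using assms by simp
    ultimately show "x \<in> interior cube"
      unfolding mem_interior_cube by (smt (verit))
  qed
  finally show ?thesis .
qed

lemma cutoff_mult_test:
  assumes "n \<ge> 1" "smooth \<psi>"
  shows "(\<lambda>x. cutoff n x * \<psi> x) \<in> test_functions"
proof -
  have "closure {x. cutoff n x * \<psi> x \<noteq> 0} \<subseteq> closure {x. cutoff n x \<noteq> 0}"
    by (intro closure_mono) auto
  then show ?thesis
    using assms cutoff_support[OF assms(1)] by (auto simp: test_functions_def intro: smooth_mult smooth_cutoff)
qed

lemma cutoff_tendsto:
  assumes "x \<in> interior cube"
  shows "(\<lambda>n. cutoff n x) \<longlonglongrightarrow> 1"
proof -
  have "(\<lambda>n. bump (cutoff_arg n i x)) \<longlonglongrightarrow> 1" for i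
  proof (rule filterlim_compose[OF bump_at_top])
    have pos: "0 < x $ i * (2 * pi - x $ i)" using assms by (simp add: mem_interior_cube)
    have "(\<lambda>n. (x $ i - 1 / real n) * (2 * pi - 1 / real n - x $ i)) \<longlonglongrightarrow> (x $ i - 0) * (2 * pi - 0 - x $ i)"
      by (intro tendsto_mult tendsto_diff tendsto_const lim_1_over_n)
    then have "(\<lambda>n. (x $ i - 1 / real n) * (2 * pi - 1 / real n - x $ i)) \<longlonglongrightarrow> x $ i * (2 * pi - x $ i)"
      by simp
    from filterlim_tendsto_pos_mult_at_top[OF this pos filterlim_real_sequentially]
    show "filterlim (\<lambda>n. cutoff_arg n i x) at_top sequentially"
      unfolding cutoff_arg_def by (subst mult.commute)
  qed
  then have "(\<lambda>n. \<Prod>i\<in>(UNIV::3 set). bump (cutoff_arg n i x)) \<longlonglongrightarrow> (\<Prod>i\<in>(UNIV::3 set). 1)"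
    by (intro tendsto_prod)
  then show ?thesis by (simp add: cutoff_def[abs_def])
qed

section \<open>Integration by parts\<close>

text \<open>The cube with its i-th side replaced by the interval from s to t: shifts in direction i
  are handled by cutting and regluing such boxes.\<close>

abbreviation slab :: "3 \<Rightarrow> real \<Rightarrow> real \<Rightarrow> (real^3) set" where
  "slab i s t \<equiv> cbox (\<chi> j. if j = i then s else 0) (\<chi> j. if j = i then t else 2 * pi)"

lemma mem_slab:
  "x \<in> slab i s t \<longleftrightarrow> s \<le> x $ i \<and> x $ i \<le> t \<and> (\<forall>j. j \<noteq> i \<longrightarrow> 0 \<le> x $ j \<and> x $ j \<le> 2 * pi)"
proof
  assume "x \<in> slab i s t"
  then have "(if j = i then s else 0) \<le> x $ j \<and> x $ j \<le> (if j = i then t else 2 * pi)" for j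
    by (simp add: mem_box_cart)
  then show "s \<le> x $ i \<and> x $ i \<le> t \<and> (\<forall>j. j \<noteq> i \<longrightarrow> 0 \<le> x $ j \<and> x $ j \<le> 2 * pi)"
    by presburger
qed (auto simp: mem_box_cart)

lemma integral_slab_split:
  fixes F :: "real^3 \<Rightarrow> real"
  assumes "continuous_on UNIV F" "s \<le> t" "t \<le> u"
  shows "integral (slab i s u) F = integral (slab i s t) F + integral (slab i t u) F"
proof -
  have "F integrable_on slab i s u"
    using assms(1) continuous_on_subset by (intro integrable_continuous) blast
  from integral_split[OF this, of "axis i 1" t]
  have "integral (slab i s u) F = integral (slab i s u \<inter> {x. x $ i \<le> t}) F +
      integral (slab i s u \<inter> {x. x $ i \<ge> t}) F"
    by (simp add: axis_in_Basis_iff inner_axis)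
  moreover have "slab i s u \<inter> {x. x $ i \<le> t} = slab i s t"
    using assms(2,3) by (auto simp: mem_slab simp del: mem_box_cart)
  moreover have "slab i s u \<inter> {x. x $ i \<ge> t} = slab i t u"
    using assms(2,3) by (auto simp: mem_slab simp del: mem_box_cart)
  ultimately show ?thesis by simp
qed

lemma integral_slab_shift:
  fixes F :: "real^3 \<Rightarrow> real"
  assumes "continuous_on UNIV F"
  shows "integral (slab i (s + c) (t + c)) F = integral (slab i s t) (\<lambda>x. F (x + axis i c))"
proof -
  have "F integrable_on slab i (s + c) (t + c)"
    using assms continuous_on_subset by (intro integrable_continuous) blast
  then have "(F has_integral integral (slab i (s + c) (t + c)) F) (slab i (s + c) (t + c))"
    by (rule integrable_integral)
  moreover have "slab i (s + c) (t + c) = cbox ((\<chi> j. if j = i then s else 0) + axis i c)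
      ((\<chi> j. if j = i then t else 2 * pi) + axis i c)"
    by (rule arg_cong2[where f = cbox]) (auto simp: Finite_Cartesian_Product.vec_eq_iff axis_def)
  ultimately have "((F \<circ> ((+) (axis i c))) has_integral integral (slab i (s + c) (t + c)) F) (slab i s t)"
    by (simp add: has_integral_shift_cbox_iff)
  then show ?thesis
    by (simp add: o_def add.commute integral_unique)
qed

lemma cube_slab: "cube = slab i 0 (2 * pi)"
  unfolding cube_alt by (rule arg_cong2[where f = cbox]) (simp_all add: Finite_Cartesian_Product.vec_eq_iff)

text \<open>The part of the shifted cube beyond the far face is moved back by one period and fills
  the gap at the near face. Periodicity is required only for the points moved in this way, so that
  functions vanishing near both faces are covered too.\<close>

lemma integral_shifted_cube:
  fixes F :: "real^3 \<Rightarrow> real"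
  assumes cont: "continuous_on UNIV F" and h: "0 \<le> h" "h \<le> 2 * pi"
    and per: "\<And>x. x \<in> cube \<Longrightarrow> x $ i \<le> h \<Longrightarrow> F (x + axis i (2 * pi)) = F x"
  shows "integral cube (\<lambda>x. F (x + axis i h)) = integral cube F"
proof -
  have "integral cube (\<lambda>x. F (x + axis i h)) = integral (slab i (0 + h) (2 * pi + h)) F"
    unfolding integral_slab_shift[OF cont] cube_slab[of i] ..
  also have "\<dots> = integral (slab i h (2 * pi)) F + integral (slab i (0 + 2 * pi) (h + 2 * pi)) F"
    using integral_slab_split[OF cont, of h "2 * pi" "2 * pi + h" i] h by (simp only: add_0_left add.commute[of h])
  also have "integral (slab i (0 + 2 * pi) (h + 2 * pi)) F = integral (slab i 0 h) (\<lambda>x. F (x + axis i (2 * pi)))"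
    by (rule integral_slab_shift[OF cont])
  also have "\<dots> = integral (slab i 0 h) F"
  proof (rule integral_cong)
    fix x assume x: "x \<in> slab i 0 h"
    then have "0 \<le> x $ j \<and> x $ j \<le> 2 * pi" for j
      using h(2) unfolding mem_slab by (cases "j = i") auto
    moreover have "x $ i \<le> h"
      using x unfolding mem_slab by simp
    ultimately have "x \<in> cube" "x $ i \<le> h"
      by (simp_all add: mem_cube)
    then show "F (x + axis i (2 * pi)) = F x" by (rule per)
  qed
  also have "integral (slab i h (2 * pi)) F + integral (slab i 0 h) F = integral (slab i 0 (2 * pi)) F"
    using integral_slab_split[OF cont, of 0 h "2 * pi" i] h by simp
  finally show ?thesis by (simp add: cube_slab[of i])
qed

text \<open>The integral of F over the shifted cube does not depend on the shift, while its
  derivative at shift 0, taken under the integral sign, is the integral of the partial derivative. A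
  one-sided derivative suffices for this comparison, and iterated integrals are avoided.\<close>

lemma integral_partial_deriv_0:
  assumes F: "smooth F" and \<delta>: "\<delta> > 0"
    and per: "\<And>x. x \<in> cube \<Longrightarrow> x $ i \<le> \<delta> \<Longrightarrow> F (x + axis i (2 * pi)) = F x"
  shows "integral cube (partial_deriv i F) = 0"
proof -
  \<comment> \<open>The shifts must not exceed one period, otherwise the boxes in
    \<open>integral_shifted_cube\<close> do not fit together.\<close>
  define \<eta> where "\<eta> = min \<delta> (2 * pi)"
  have \<eta>: "\<eta> > 0" "\<eta> \<le> \<delta>" "\<eta> \<le> 2 * pi" using \<delta> by (auto simp: \<eta>_def)
  note cF = smooth_continuous[OF F, of UNIV]
  note cD = smooth_continuous[OF smooth_partial_deriv[OF F], of UNIV i]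
  have ax: "axis i h = h *\<^sub>R axis i (1::real)" for h
    by (simp add: Finite_Cartesian_Product.vec_eq_iff axis_def)
  have "((\<lambda>h. integral (cbox 0 (\<chi> i. 2 * pi)) (\<lambda>x. F (x + axis i h))) has_field_derivative
      integral (cbox 0 (\<chi> i. 2 * pi)) (\<lambda>x. partial_deriv i F (x + axis i 0))) (at 0 within {0..\<eta>})"
  proof (rule leibniz_rule_field_derivative)
    fix h :: real and t :: "real^3"
    have "((\<lambda>h. t + h *\<^sub>R axis i 1) has_derivative (\<lambda>h. h *\<^sub>R axis i 1)) (at h within {0..\<eta>})"
      by (auto intro!: derivative_eq_intros)
    from has_derivative_compose[OF this has_derivative_frechet[OF smooth_differentiable[OF F]]]
    have "((\<lambda>h. F (t + h *\<^sub>R axis i 1)) has_derivative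
        (\<lambda>s. frechet_derivative F (at (t + h *\<^sub>R axis i 1)) (s *\<^sub>R axis i 1))) (at h within {0..\<eta>})" .
    moreover have "frechet_derivative F (at y) (s *\<^sub>R axis i 1) = partial_deriv i F y * s" for y s
      using linear_scale[OF linear_frechet_derivative[OF smooth_differentiable[OF F]]]
      by (simp add: partial_deriv_def)
    ultimately show "((\<lambda>h. F (t + axis i h)) has_field_derivative partial_deriv i F (t + axis i h)) (at h within {0..\<eta>})"
      by (simp add: has_field_derivative_def ax[symmetric])
  next
    fix h
    show "(\<lambda>x. F (x + axis i h)) integrable_on cbox 0 (\<chi> i. 2 * pi)"
      by (intro integrable_continuous continuous_on_compose2[OF cF] continuous_intros) auto
  next
    have "continuous_on ({0..\<eta>} \<times> cbox 0 (\<chi> i. 2 * pi)) (\<lambda>z. partial_deriv i F (snd z + fst z *\<^sub>R axis i 1))"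
      by (intro continuous_on_compose2[OF cD] continuous_intros) auto
    then show "continuous_on ({0..\<eta>} \<times> cbox 0 (\<chi> i. 2 * pi)) (\<lambda>(h, t). partial_deriv i F (t + axis i h))"
      by (simp add: case_prod_beta ax[symmetric])
  qed (use \<eta> in auto)
  then have "((\<lambda>h. integral cube (\<lambda>x. F (x + axis i h))) has_field_derivative
      integral cube (partial_deriv i F)) (at 0 within {0..\<eta>})"
    by (simp add: cube_alt ax[of 0])
  moreover have "((\<lambda>h. integral cube (\<lambda>x. F (x + axis i h))) has_field_derivative 0) (at 0 within {0..\<eta>})"
  proof (rule has_field_derivative_transform_within[where f = "\<lambda>h. integral cube F" and d = 1])
    fix h assume "h \<in> {0..\<eta>}"
    then show "integral cube F = integral cube (\<lambda>x. F (x + axis i h))"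
      using \<eta> by (intro integral_shifted_cube[symmetric] cF per) auto
  qed (use \<eta> in auto)
  moreover have "at 0 within {0..\<eta>} \<noteq> bot"
    using \<eta> by (simp add: trivial_limit_within islimpt_Icc)
  ultimately show ?thesis
    using has_field_derivative_unique by blast
qed

lemma integrable_cube: "continuous_on cube f \<Longrightarrow> integrable cube_measure f"
  for f :: "real^3 \<Rightarrow> 'b::euclidean_space"
  unfolding cube_alt by (rule continuous_imp_integrable)

lemma cube_sets [simp]: "cube \<in> sets lebesgue"
  by (simp add: cube_alt)

lemma LINT_cube: "continuous_on cube f \<Longrightarrow> integral\<^sup>L cube_measure f = integral cube f"
  for f :: "real^3 \<Rightarrow> 'b::euclidean_space"
  by (intro lebesgue_integral_eq_integral integrable_cube) simp_all

text \<open>The condition concerns the product alone. It holds if both factors are periodic and also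
  if one factor is a test function, whatever the other one is.\<close>

lemma LINT_by_parts:
  assumes "smooth f" "smooth g" "\<delta> > 0"
    and per: "\<And>x. x \<in> cube \<Longrightarrow> x $ i \<le> \<delta> \<Longrightarrow>
      f (x + axis i (2 * pi)) * g (x + axis i (2 * pi)) = f x * g x"
  shows "(LINT x|cube_measure. f x * partial_deriv i g x) = - (LINT x|cube_measure. partial_deriv i f x * g x)"
proof -
  note cont = smooth_continuous[OF assms(1), of cube] smooth_continuous[OF assms(2), of cube]
    smooth_continuous[OF smooth_partial_deriv[OF assms(1)], of cube i]
    smooth_continuous[OF smooth_partial_deriv[OF assms(2)], of cube i]
  have "integral cube (partial_deriv i (\<lambda>x. f x * g x)) = 0"
    using integral_partial_deriv_0[OF smooth_mult[OF assms(1,2)] assms(3), of i] per by simp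
  also have "partial_deriv i (\<lambda>x. f x * g x) = (\<lambda>x. f x * partial_deriv i g x + partial_deriv i f x * g x)"
    by (intro ext partial_deriv_mult smooth_differentiable assms)
  finally have "(LINT x|cube_measure. f x * partial_deriv i g x + partial_deriv i f x * g x) = 0"
    by (subst LINT_cube) (auto intro!: continuous_intros cont)
  then show ?thesis
    by (subst (asm) Bochner_Integration.integral_add) (auto intro!: integrable_cube continuous_intros cont)
qed

lemma partial_deriv_eq_0_outside:
  assumes "x \<notin> closure {x. f x \<noteq> 0}"
  shows "partial_deriv i f x = 0"
proof -
  have "((\<lambda>x. 0) has_derivative (\<lambda>h. 0)) (at x)" by simp
  then have "(f has_derivative (\<lambda>h. 0)) (at x)"
    by (rule has_derivative_transform_within_open[of _ _ _ _ "- closure {x. f x \<noteq> 0}"])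
       (use assms closure_subset[of "{x. f x \<noteq> 0}"] in auto)
  then show ?thesis by (simp add: partial_deriv_eqI)
qed

lemma test_functions_partial_deriv:
  assumes "\<phi> \<in> test_functions"
  shows "partial_deriv i \<phi> \<in> test_functions"
proof -
  have "{x. partial_deriv i \<phi> x \<noteq> 0} \<subseteq> closure {x. \<phi> x \<noteq> 0}"
    using partial_deriv_eq_0_outside by blast
  then have "closure {x. partial_deriv i \<phi> x \<noteq> 0} \<subseteq> closure {x. \<phi> x \<noteq> 0}"
    by (simp add: closure_minimal)
  then show ?thesis
    using assms by (auto simp: test_functions_def intro: smooth_partial_deriv)
qed

text \<open>The support is compact and lies in the open cube, so its i-th coordinate has a positive
  minimum. The margin makes a test function vanish both near the face x_i = 0 and at the points one
  period further, as \<open>LINT_by_parts\<close> asks.\<close>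

lemma test_function_margin:
  assumes "\<phi> \<in> test_functions"
  obtains \<delta> where "\<delta> > 0" "\<And>x. x $ i \<le> \<delta> \<Longrightarrow> \<phi> x = 0" "\<And>x. x $ i \<ge> 2 * pi \<Longrightarrow> \<phi> x = 0"
proof -
  define K where "K = closure {x. \<phi> x \<noteq> 0}"
  have K: "K \<subseteq> interior cube" using assms by (simp add: K_def test_functions_def)
  have out: "\<phi> x = 0" if "x \<notin> K" for x
    using that closure_subset[of "{x. \<phi> x \<noteq> 0}"] by (auto simp: K_def)
  have "bounded K"
    by (rule bounded_subset[of cube]) (use order_trans[OF K interior_subset] bounded_cbox in \<open>simp_all add: cube_alt\<close>)
  then have "compact K" by (simp add: compact_eq_bounded_closed K_def)
  show thesis
  proof (cases "K = {}")
    case True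
    then show thesis using that[of 1] out by auto
  next
    case False
    have "continuous_on K (\<lambda>x. x $ i)" by (intro continuous_intros)
    from continuous_attains_inf[OF \<open>compact K\<close> False this]
    obtain x0 where x0: "x0 \<in> K" "\<And>x. x \<in> K \<Longrightarrow> x0 $ i \<le> x $ i" by auto
    have "x0 $ i > 0" using x0 K by (auto simp: mem_interior_cube)
    then show thesis
    proof (intro that[of "x0 $ i / 2"])
      fix x :: "real^3" assume "x $ i \<le> x0 $ i / 2"
      then have "x \<notin> K" using x0(2)[of x] \<open>x0 $ i > 0\<close> by auto
      then show "\<phi> x = 0" by (rule out)
    next
      fix x :: "real^3" assume "x $ i \<ge> 2 * pi"
      then have "x \<notin> K" using K mem_interior_cube[of x] by (meson not_le subsetD)
      then show "\<phi> x = 0" by (rule out)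
    qed simp
  qed
qed

lemma LINT_by_parts_test:
  assumes "smooth f" "\<phi> \<in> test_functions"
  shows "(LINT x|cube_measure. f x * partial_deriv i \<phi> x) = - (LINT x|cube_measure. partial_deriv i f x * \<phi> x)"
proof -
  obtain \<delta> where \<delta>: "\<delta> > 0" "\<And>x. x $ i \<le> \<delta> \<Longrightarrow> \<phi> x = 0" "\<And>x. x $ i \<ge> 2 * pi \<Longrightarrow> \<phi> x = 0"
    using test_function_margin[OF assms(2), of i] by metis
  show ?thesis
  proof (rule LINT_by_parts[OF assms(1) _ \<delta>(1)])
    show "smooth \<phi>" using assms by (simp add: test_functions_def)
    show "f (x + axis i (2 * pi)) * \<phi> (x + axis i (2 * pi)) = f x * \<phi> x" if "x \<in> cube" "x $ i \<le> \<delta>" for x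
      using \<delta>(2)[OF that(2)] \<delta>(3)[of "x + axis i (2 * pi)"] that(1) by (simp add: mem_cube)
  qed
qed

lemma LINT_by_parts_test_funpow:
  assumes "smooth f" "\<phi> \<in> test_functions"
  shows "(LINT x|cube_measure. f x * (partial_deriv i ^^ n) \<phi> x) =
    (-1) ^ n * (LINT x|cube_measure. (partial_deriv i ^^ n) f x * \<phi> x)"
  using assms
proof (induction n arbitrary: f)
  case (Suc n)
  have t: "(partial_deriv i ^^ n) \<phi> \<in> test_functions"
    using Suc.prems(2) by (induction n) (auto intro: test_functions_partial_deriv)
  have "(LINT x|cube_measure. f x * (partial_deriv i ^^ Suc n) \<phi> x) =
      - (LINT x|cube_measure. partial_deriv i f x * (partial_deriv i ^^ n) \<phi> x)"
    using LINT_by_parts_test[OF Suc.prems(1) t] by simp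
  also have "\<dots> = (-1) ^ Suc n * (LINT x|cube_measure. (partial_deriv i ^^ n) (partial_deriv i f) x * \<phi> x)"
    using Suc by (simp add: smooth_partial_deriv)
  finally show ?case by (simp add: funpow_swap1)
qed simp

section \<open>Differentiation and integration by parts of smooth periodic functions\<close>

lemma Cinf_per_partial_deriv:
  assumes "\<phi> \<in> Cinf_per"
  shows "partial_deriv i \<phi> \<in> Cinf_per"
proof -
  have sm: "smooth \<phi>" and per: "\<And>x j. \<phi> (x + axis j (2 * pi)) = \<phi> x"
    using assms by (auto simp: Cinf_per_def)
  have "partial_deriv i \<phi> (x + axis j (2 * pi)) = partial_deriv i \<phi> x" for x j
  proof -
    have d: "((\<lambda>x. x + axis j (2 * pi)) has_derivative (\<lambda>h. h)) (at x)"
      by (auto intro!: derivative_eq_intros)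
    have "((\<lambda>x. \<phi> (x + axis j (2 * pi))) has_derivative frechet_derivative \<phi> (at (x + axis j (2 * pi)))) (at x)"
      using has_derivative_compose[OF d has_derivative_frechet[OF smooth_differentiable[OF sm]]] by simp
    then have "(\<phi> has_derivative frechet_derivative \<phi> (at (x + axis j (2 * pi)))) (at x)"
      by (simp add: per)
    then show ?thesis by (simp add: partial_deriv_eqI) (simp add: partial_deriv_def)
  qed
  then show ?thesis by (auto simp: Cinf_per_def smooth_partial_deriv sm)
qed

lemma LINT_by_parts_per_funpow:
  assumes "\<phi> \<in> Cinf_per" "\<psi> \<in> Cinf_per"
  shows "(LINT x|cube_measure. (partial_deriv i ^^ n) \<phi> x * \<psi> x) =
    (-1) ^ n * (LINT x|cube_measure. \<phi> x * (partial_deriv i ^^ n) \<psi> x)"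
  using assms
proof (induction n arbitrary: \<psi>)
  case (Suc n)
  have t: "(partial_deriv i ^^ n) \<phi> \<in> Cinf_per"
    using Suc.prems(1) by (induction n) (auto intro: Cinf_per_partial_deriv)
  have "(LINT x|cube_measure. \<psi> x * partial_deriv i ((partial_deriv i ^^ n) \<phi>) x) =
      - (LINT x|cube_measure. partial_deriv i \<psi> x * (partial_deriv i ^^ n) \<phi> x)"
    by (rule LINT_by_parts[where \<delta> = 1]) (use t Suc.prems in \<open>auto simp: Cinf_per_def\<close>)
  also have "\<dots> = - ((-1) ^ n * (LINT x|cube_measure. \<phi> x * (partial_deriv i ^^ n) (partial_deriv i \<psi>) x))"
    using Suc.IH[OF Suc.prems(1) Cinf_per_partial_deriv[OF Suc.prems(2)]] by (simp add: mult.commute)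
  finally show ?case by (simp add: funpow_swap1 mult.commute)
qed simp

section \<open>Weak derivatives and Fourier coefficients\<close>

lemma emeasure_cube_finite: "emeasure cube_measure (space cube_measure) < \<infinity>"
  by (simp add: cube_alt emeasure_restrict_space emeasure_lborel_cbox_eq)

lemma finite_measure_cube: "finite_measure cube_measure"
  using emeasure_cube_finite by (intro finite_measureI) auto

lemma integrable_const_cube: "integrable cube_measure (\<lambda>x. c)"
  for c :: "'b::{banach,second_countable_topology}"
  by (rule finite_measure.integrable_const[OF finite_measure_cube])

lemma measure_cube: "measure cube_measure (space cube_measure) = (2 * pi) ^ 3"
proof -
  have "measure cube_measure (space cube_measure) = measure lebesgue cube"
    by (simp add: measure_restrict_space)
  also have "\<dots> = (2 * pi) ^ 3"
  proof -
    have "box 0 (\<chi> i. 2 * pi) \<noteq> ({} :: (real^3) set)"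
      by (simp add: interval_ne_empty_cart)
    then have "cbox 0 (\<chi> i. 2 * pi) \<noteq> ({} :: (real^3) set)"
      using box_subset_cbox by blast
    from content_cbox_cart[OF this] show ?thesis
      by (simp add: cube_alt power_mult_distrib)
  qed
  finally show ?thesis .
qed

lemma LINT_cube_const: "(LINT x|cube_measure. c) = (2 * pi) ^ 3 * c" for c :: real
  using measure_cube by simp

lemma L2_measurable: "u \<in> L2 \<Longrightarrow> u \<in> borel_measurable cube_measure"
  and L2_integrable_power2: "u \<in> L2 \<Longrightarrow> integrable cube_measure (\<lambda>x. (u x)\<^sup>2)"
  by (auto simp: L2_def)

lemma continuous_measurable_cube: "continuous_on cube f \<Longrightarrow> f \<in> borel_measurable cube_measure"
  for f :: "real^3 \<Rightarrow> 'b::euclidean_space"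
  using integrable_cube borel_measurable_integrable by blast

lemma continuous_L2: "continuous_on cube f \<Longrightarrow> f \<in> L2"
  unfolding L2_def by (auto intro!: continuous_measurable_cube integrable_cube continuous_intros)

lemma L2_integrable_mult:
  assumes "u \<in> L2" "v \<in> L2"
  shows "integrable cube_measure (\<lambda>x. u x * v x)"
proof (rule Bochner_Integration.integrable_bound)
  show "integrable cube_measure (\<lambda>x. (u x)\<^sup>2 + (v x)\<^sup>2)"
    using assms by (auto intro!: L2_integrable_power2)
  show "(\<lambda>x. u x * v x) \<in> borel_measurable cube_measure"
    using assms[THEN L2_measurable] by (rule borel_measurable_times)
  have "\<bar>a * b\<bar> \<le> a\<^sup>2 + b\<^sup>2" for a b :: real
  proof -
    have "2 * \<bar>a * b\<bar> \<le> a\<^sup>2 + b\<^sup>2"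
      using sum_squares_bound[of "\<bar>a\<bar>" "\<bar>b\<bar>"] by (simp add: abs_mult)
    then show ?thesis using abs_ge_zero[of "a * b"] by linarith
  qed
  then show "AE x in cube_measure. norm (u x * v x) \<le> norm ((u x)\<^sup>2 + (v x)\<^sup>2)"
    by simp
qed

lemma L2_integrable_mult_continuous:
  "u \<in> L2 \<Longrightarrow> continuous_on cube g \<Longrightarrow> integrable cube_measure (\<lambda>x. u x * g x)"
  by (rule L2_integrable_mult[OF _ continuous_L2])

lemma L2_lincomb:
  assumes "u \<in> L2" "v \<in> L2"
  shows "(\<lambda>x. a * u x + b * v x) \<in> L2"
proof -
  have "integrable cube_measure (\<lambda>x. a\<^sup>2 * (u x)\<^sup>2 + 2 * a * b * (u x * v x) + b\<^sup>2 * (v x)\<^sup>2)"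
    by (intro Bochner_Integration.integrable_add integrable_mult_right L2_integrable_power2 L2_integrable_mult assms)
  then have "integrable cube_measure (\<lambda>x. (a * u x + b * v x)\<^sup>2)"
    by (rule Bochner_Integration.integrable_cong[THEN iffD1, rotated 2]) (auto simp: power2_eq_square algebra_simps)
  then show ?thesis
    using assms by (auto simp: L2_def)
qed

lemma L2_cmult: "u \<in> L2 \<Longrightarrow> (\<lambda>x. a * u x) \<in> L2"
  using L2_lincomb[of u u a 0] by simp

lemma L2_diff: "u \<in> L2 \<Longrightarrow> v \<in> L2 \<Longrightarrow> (\<lambda>x. u x - v x) \<in> L2"
  using L2_lincomb[of u v 1 "-1"] by simp

lemma smooth_mderiv: "smooth f \<Longrightarrow> smooth (mderiv \<alpha> f)"
  unfolding mderiv_def by (intro smooth_funpow_partial_deriv)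

lemma test_functions_smooth: "\<phi> \<in> test_functions \<Longrightarrow> smooth \<phi>"
  by (simp add: test_functions_def)

lemma has_weak_deriv_L2: "has_weak_deriv u \<alpha> v \<Longrightarrow> u \<in> L2" "has_weak_deriv u \<alpha> v \<Longrightarrow> v \<in> L2"
  by (auto simp: has_weak_deriv_def)

lemma has_weak_deriv_lincomb:
  assumes "has_weak_deriv u \<alpha> v" "has_weak_deriv u' \<alpha> v'"
  shows "has_weak_deriv (\<lambda>x. a * u x + b * u' x) \<alpha> (\<lambda>x. a * v x + b * v' x)"
  unfolding has_weak_deriv_def
proof (intro conjI ballI L2_lincomb has_weak_deriv_L2[OF assms(1)] has_weak_deriv_L2[OF assms(2)])
  fix \<phi> assume \<phi>: "\<phi> \<in> test_functions"
  have lin: "(LINT x|cube_measure. (a * f x + b * g x) * \<psi> x) =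
      a * (LINT x|cube_measure. f x * \<psi> x) + b * (LINT x|cube_measure. g x * \<psi> x)"
    if "f \<in> L2" "g \<in> L2" "smooth \<psi>" for f g \<psi>
  proof -
    have "(LINT x|cube_measure. (a * f x + b * g x) * \<psi> x) =
        (LINT x|cube_measure. a * (f x * \<psi> x) + b * (g x * \<psi> x))"
      by (simp add: algebra_simps)
    also have "\<dots> = a * (LINT x|cube_measure. f x * \<psi> x) + b * (LINT x|cube_measure. g x * \<psi> x)"
      using that by (subst Bochner_Integration.integral_add)
        (auto intro!: integrable_mult_right L2_integrable_mult_continuous smooth_continuous)
    finally show ?thesis .
  qed
  have "(LINT x|cube_measure. (a * u x + b * u' x) * mderiv \<alpha> \<phi> x) =
      a * ((-1) ^ mlen \<alpha> * (LINT x|cube_measure. v x * \<phi> x)) +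
      b * ((-1) ^ mlen \<alpha> * (LINT x|cube_measure. v' x * \<phi> x))"
    using assms \<phi> by (subst lin) (auto simp: has_weak_deriv_def intro: smooth_mderiv test_functions_smooth)
  also have "\<dots> = (-1) ^ mlen \<alpha> * (LINT x|cube_measure. (a * v x + b * v' x) * \<phi> x)"
    using assms \<phi> by (subst lin) (auto simp: algebra_simps intro: test_functions_smooth has_weak_deriv_L2)
  finally show "(LINT x|cube_measure. (a * u x + b * u' x) * mderiv \<alpha> \<phi> x) =
      (-1) ^ mlen \<alpha> * (LINT x|cube_measure. (a * v x + b * v' x) * \<phi> x)" .
qed

lemma has_weak_deriv_weak_deriv: "has_weak_deriv u \<alpha> v \<Longrightarrow> has_weak_deriv u \<alpha> (weak_deriv \<alpha> u)"
  unfolding weak_deriv_def by (rule someI[of "has_weak_deriv u \<alpha>"])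

text \<open>Derivatives in a single direction are enough: together they control every |k_i|^n and
  thereby all powers of |k|.\<close>

definition pure_index :: "3 \<Rightarrow> nat \<Rightarrow> mindex" where
  "pure_index i n = (\<lambda>j. if j = i then n else 0)"

lemma unit_index_pure: "unit_index i = pure_index i 1"
  by (simp add: unit_index_def pure_index_def fun_eq_iff)

lemma mlen_pure [simp]: "mlen (pure_index i n) = n"
  by (simp add: mlen_def pure_index_def)

lemma mderiv_pure: "mderiv (pure_index i n) f = (partial_deriv i ^^ n) f"
  using exhaust_3[of i] by (auto simp: mderiv_def pure_index_def)

lemma has_weak_deriv_smooth:
  assumes "smooth f"
  shows "has_weak_deriv f (pure_index i n) ((partial_deriv i ^^ n) f)"
  unfolding has_weak_deriv_def mderiv_pure mlen_pure
  using assms LINT_by_parts_test_funpow[OF assms]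
  by (auto intro!: continuous_L2 smooth_continuous smooth_funpow_partial_deriv)

lemma has_weak_deriv_0: "u \<in> L2 \<Longrightarrow> has_weak_deriv u (pure_index i 0) u"
  by (simp add: has_weak_deriv_def mderiv_pure)

lemma AE_interior_cube: "AE x in cube_measure. x \<in> interior cube"
proof -
  have "negligible (cube - interior cube)"
    unfolding cube_alt interior_cbox by (rule negligible_frontier_interval)
  then have "cube - interior cube \<in> null_sets lebesgue"
    by (simp add: negligible_iff_null_sets)
  then have "AE x in lebesgue. x \<notin> cube - interior cube"
    by (rule AE_not_in)
  then show ?thesis
    by (subst AE_restrict_space_iff) (auto elim: eventually_mono)
qed

text \<open>The products of \<psi> with the cut-offs are test functions, and they converge to \<psi>
  almost everywhere, because the boundary of the cube is a null set. The cut-offs take values in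
  [0,1], so |w \<psi>| is a dominating function. The index is \<open>Suc n\<close> because the
  support of \<open>cutoff\<close> is located for indices from 1 on.\<close>

lemma LINT_eq_0_from_test:
  assumes w: "w \<in> L2" and 0: "\<And>\<phi>. \<phi> \<in> test_functions \<Longrightarrow> (LINT x|cube_measure. w x * \<phi> x) = 0"
    and \<psi>: "smooth \<psi>"
  shows "(LINT x|cube_measure. w x * \<psi> x) = 0"
proof -
  note c\<psi> = smooth_continuous[OF \<psi>, of cube]
  have "(\<lambda>n. LINT x|cube_measure. w x * (cutoff (Suc n) x * \<psi> x)) \<longlonglongrightarrow> (LINT x|cube_measure. w x * \<psi> x)"
  proof (rule integral_dominated_convergence[where w = "\<lambda>x. norm (w x * \<psi> x)"])
    show "(\<lambda>x. w x * \<psi> x) \<in> borel_measurable cube_measure"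
      using L2_integrable_mult_continuous[OF w c\<psi>] by simp
    show "(\<lambda>x. w x * (cutoff (Suc n) x * \<psi> x)) \<in> borel_measurable cube_measure" for n
      using L2_integrable_mult_continuous[OF w, of "\<lambda>x. cutoff (Suc n) x * \<psi> x"]
      by (auto intro!: continuous_intros smooth_continuous[OF smooth_cutoff] c\<psi>)
    show "integrable cube_measure (\<lambda>x. norm (w x * \<psi> x))"
      using L2_integrable_mult_continuous[OF w c\<psi>] by (rule integrable_norm)
    show "AE x in cube_measure. (\<lambda>n. w x * (cutoff (Suc n) x * \<psi> x)) \<longlonglongrightarrow> w x * \<psi> x"
      using AE_interior_cube
    proof eventually_elim
      case (elim x)
      have "(\<lambda>n. w x * (cutoff (Suc n) x * \<psi> x)) \<longlonglongrightarrow> w x * (1 * \<psi> x)"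
        by (intro tendsto_intros filterlim_compose[OF cutoff_tendsto[OF elim] filterlim_Suc])
      then show ?case by simp
    qed
    have "\<bar>w x * (cutoff (Suc n) x * \<psi> x)\<bar> \<le> \<bar>w x * \<psi> x\<bar>" for n x
    proof -
      have "cutoff (Suc n) x * \<bar>w x * \<psi> x\<bar> \<le> 1 * \<bar>w x * \<psi> x\<bar>"
        by (intro mult_right_mono cutoff_bounds) auto
      then show ?thesis by (simp add: abs_mult cutoff_bounds mult_ac)
    qed
    then show "AE x in cube_measure. norm (w x * (cutoff (Suc n) x * \<psi> x)) \<le> norm (w x * \<psi> x)" for n
      by simp
  qed
  moreover have "(LINT x|cube_measure. w x * (cutoff (Suc n) x * \<psi> x)) = 0" for n
    by (rule 0) (rule cutoff_mult_test[OF _ \<psi>], simp)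
  ultimately show ?thesis
    by (simp add: LIMSEQ_const_iff)
qed

text \<open>The difference of two weak derivatives annihilates all test functions, hence all smooth
  functions. This makes the arbitrary choice inside \<open>weak_deriv\<close> invisible to Fourier
  coefficients.\<close>

lemma weak_deriv_pairing_unique:
  assumes "has_weak_deriv u \<alpha> v" "has_weak_deriv u \<alpha> w" "smooth \<psi>"
  shows "(LINT x|cube_measure. v x * \<psi> x) = (LINT x|cube_measure. w x * \<psi> x)"
proof -
  have L: "v \<in> L2" "w \<in> L2" using assms has_weak_deriv_L2 by blast+
  have diff: "(LINT x|cube_measure. (v x - w x) * \<phi> x) =
      (LINT x|cube_measure. v x * \<phi> x) - (LINT x|cube_measure. w x * \<phi> x)" if "smooth \<phi>" for \<phi>
    unfolding left_diff_distrib using L that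
    by (intro Bochner_Integration.integral_diff L2_integrable_mult_continuous smooth_continuous)
  have "(LINT x|cube_measure. (v x - w x) * \<psi> x) = 0"
  proof (rule LINT_eq_0_from_test[OF L2_diff[OF L] _ assms(3)])
    fix \<phi> assume \<phi>: "\<phi> \<in> test_functions"
    have "(-1) ^ mlen \<alpha> * (LINT x|cube_measure. v x * \<phi> x) = (-1) ^ mlen \<alpha> * (LINT x|cube_measure. w x * \<phi> x)"
      using assms(1)[unfolded has_weak_deriv_def, THEN conjunct2, THEN conjunct2, THEN bspec, OF \<phi>]
        assms(2)[unfolded has_weak_deriv_def, THEN conjunct2, THEN conjunct2, THEN bspec, OF \<phi>]
      by (rule trans[OF sym])
    then show "(LINT x|cube_measure. (v x - w x) * \<phi> x) = 0"
      unfolding diff[OF test_functions_smooth[OF \<phi>]] by simp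
  qed
  then show ?thesis using diff[OF assms(3)] by simp
qed

section \<open>Real plane waves and their pairings with Sobolev functions\<close>

definition kvec :: "int^3 \<Rightarrow> real^3" where
  "kvec k = (\<chi> i. real_of_int (k $ i))"

lemma kvec_nth [simp]: "kvec k $ i = real_of_int (k $ i)" by (simp add: kvec_def)

lemma smooth_phase: "smooth (\<lambda>x. kvec k \<bullet> x + \<theta>)"
  by (intro smooth_add smooth_const smooth_linear bounded_linear_inner_right)

lemma cos_phase_Cinf_per: "(\<lambda>x. cos (kvec k \<bullet> x + \<theta>)) \<in> Cinf_per"
proof -
  have "cos (kvec k \<bullet> (x + axis i (2 * pi)) + \<theta>) = cos (kvec k \<bullet> x + \<theta>)" for x i
  proof -
    have "cos (kvec k \<bullet> (x + axis i (2 * pi)) + \<theta>) = cos ((kvec k \<bullet> x + \<theta>) + 2 * pi * real_of_int (k $ i))"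
      by (simp add: inner_add_right inner_axis algebra_simps)
    also have "\<dots> = cos (kvec k \<bullet> x + \<theta>)"
      by (simp only: cos_add[of "kvec k \<bullet> x + \<theta>" "2 * pi * _"] sin_int_2pin cos_int_2pin mult_1_right mult_zero_right diff_0_right)
    finally show ?thesis .
  qed
  then show ?thesis by (auto simp: Cinf_per_def intro: smooth_cos smooth_phase)
qed

lemma partial_deriv_cos_phase:
  "partial_deriv i (\<lambda>x. c * cos (kvec k \<bullet> x + \<theta>)) = (\<lambda>x. c * real_of_int (k $ i) * cos (kvec k \<bullet> x + (\<theta> + pi / 2)))"
proof
  fix x
  have "((\<lambda>x. c * cos (kvec k \<bullet> x + \<theta>)) has_derivative (\<lambda>h. c * - (sin (kvec k \<bullet> x + \<theta>) * (kvec k \<bullet> h)))) (at x)"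
    by (auto intro!: derivative_eq_intros)
  then have "partial_deriv i (\<lambda>x. c * cos (kvec k \<bullet> x + \<theta>)) x = c * - (sin (kvec k \<bullet> x + \<theta>) * real_of_int (k $ i))"
    by (simp add: partial_deriv_eqI inner_axis)
  also have "\<dots> = c * real_of_int (k $ i) * cos (kvec k \<bullet> x + \<theta> + pi / 2)"
    by (simp only: cos_add) simp
  finally show "partial_deriv i (\<lambda>x. c * cos (kvec k \<bullet> x + \<theta>)) x = c * real_of_int (k $ i) * cos (kvec k \<bullet> x + (\<theta> + pi / 2))"
    by (simp add: add.assoc)
qed

lemma funpow_partial_deriv_cos_phase:
  "(partial_deriv i ^^ n) (\<lambda>x. cos (kvec k \<bullet> x + \<theta>)) =
    (\<lambda>x. real_of_int (k $ i) ^ n * cos (kvec k \<bullet> x + (\<theta> + real n * (pi / 2))))"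
proof (induction n)
  case (Suc n)
  have "\<theta> + real n * (pi / 2) + pi / 2 = \<theta> + real (Suc n) * (pi / 2)"
    by (simp add: distrib_right)
  then show ?case
    by (simp only: funpow.simps o_apply Suc partial_deriv_cos_phase power_Suc2)
qed simp

text \<open>A shift of the phase by pi/2 turns cosines into sines, so this single real family carries both parts of
  a Fourier coefficient and is closed under differentiation.\<close>

definition pairing :: "(real^3 \<Rightarrow> real) \<Rightarrow> int^3 \<Rightarrow> real \<Rightarrow> real" where
  "pairing u k \<theta> = (LINT x|cube_measure. u x * cos (kvec k \<bullet> x + \<theta>))"

lemma pairing_lincomb:
  assumes "u \<in> L2" "v \<in> L2"
  shows "pairing (\<lambda>x. a * u x + b * v x) k \<theta> = a * pairing u k \<theta> + b * pairing v k \<theta>"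
proof -
  have "pairing (\<lambda>x. a * u x + b * v x) k \<theta> =
      (LINT x|cube_measure. a * (u x * cos (kvec k \<bullet> x + \<theta>)) + b * (v x * cos (kvec k \<bullet> x + \<theta>)))"
    by (simp add: pairing_def algebra_simps)
  also have "\<dots> = a * pairing u k \<theta> + b * pairing v k \<theta>"
    unfolding pairing_def using assms by (subst Bochner_Integration.integral_add)
      (auto intro!: integrable_mult_right L2_integrable_mult_continuous continuous_intros)
  finally show ?thesis .
qed

text \<open>An elementary replacement for the Cauchy-Schwarz inequality: |w| <= w^2/e + e holds
  pointwise and is integrated over the cube of volume (2 pi)^3.\<close>

lemma abs_pairing_le:
  assumes "w \<in> L2" "e > 0" "(LINT x|cube_measure. (w x)\<^sup>2) \<le> e\<^sup>2"
  shows "\<bar>pairing w k \<theta>\<bar> \<le> e * (1 + (2 * pi) ^ 3)"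
proof -
  have pt: "\<bar>w x * cos (kvec k \<bullet> x + \<theta>)\<bar> \<le> (w x)\<^sup>2 / e + e" for x
  proof -
    have "\<bar>w x * cos (kvec k \<bullet> x + \<theta>)\<bar> \<le> \<bar>w x\<bar> * 1"
      unfolding abs_mult by (intro mult_left_mono) auto
    also have "\<dots> \<le> (w x)\<^sup>2 / e + e"
    proof -
      have "e * \<bar>w x\<bar> \<le> (w x)\<^sup>2 + e * e"
        using sum_squares_bound[of "\<bar>w x\<bar>" e] assms(2) by (simp add: power2_eq_square mult.commute) (use mult_nonneg_nonneg[of e "\<bar>w x\<bar>"] assms(2) in linarith)
      then show ?thesis using assms(2) by (simp add: field_simps)
    qed
    finally show ?thesis .
  qed
  have int: "integrable cube_measure (\<lambda>x. w x * cos (kvec k \<bullet> x + \<theta>))"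
    using assms(1) by (intro L2_integrable_mult_continuous continuous_intros)
  have "\<bar>pairing w k \<theta>\<bar> \<le> (LINT x|cube_measure. \<bar>w x * cos (kvec k \<bullet> x + \<theta>)\<bar>)"
    unfolding pairing_def by (rule integral_abs_bound)
  also have "\<dots> \<le> (LINT x|cube_measure. (w x)\<^sup>2 / e + e)"
    by (intro integral_mono) (auto intro!: integrable_abs int Bochner_Integration.integrable_add
        integrable_divide L2_integrable_power2 assms integrable_const_cube simp: pt[simplified] simp del: abs_mult)
  also have "\<dots> = (LINT x|cube_measure. (w x)\<^sup>2) / e + (2 * pi) ^ 3 * e"
  proof -
    have "(LINT x|cube_measure. (w x)\<^sup>2 / e + e) = (LINT x|cube_measure. (w x)\<^sup>2 / e) + (LINT x|cube_measure. e)"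
      by (intro Bochner_Integration.integral_add integrable_divide L2_integrable_power2 assms integrable_const_cube)
    then show ?thesis by (simp only: LINT_cube_const integral_divide_zero)
  qed
  also have "\<dots> \<le> e\<^sup>2 / e + (2 * pi) ^ 3 * e"
    using assms by (intro add_mono divide_right_mono) auto
  finally show ?thesis using assms(2) by (simp add: power2_eq_square algebra_simps)
qed

lemma finite_mindex: "finite {\<alpha>. mlen \<alpha> \<le> n}"
proof (rule finite_subset)
  show "{\<alpha>. mlen \<alpha> \<le> n} \<subseteq> {\<alpha>. \<forall>i. (i \<in> UNIV \<longrightarrow> \<alpha> i \<in> {..n}) \<and> (i \<notin> UNIV \<longrightarrow> \<alpha> i = 0)}"
  proof
    fix \<alpha> assume "\<alpha> \<in> {\<alpha>. mlen \<alpha> \<le> n}"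
    moreover have "\<alpha> i \<le> mlen \<alpha>" for i
      unfolding mlen_def by (rule member_le_sum) auto
    ultimately show "\<alpha> \<in> {\<alpha>. \<forall>i. (i \<in> UNIV \<longrightarrow> \<alpha> i \<in> {..n}) \<and> (i \<notin> UNIV \<longrightarrow> \<alpha> i = 0)}"
      by (auto intro: order_trans)
  qed
  show "finite {\<alpha>::mindex. \<forall>i. (i \<in> UNIV \<longrightarrow> \<alpha> i \<in> {..n}) \<and> (i \<notin> UNIV \<longrightarrow> \<alpha> i = 0)}"
    by (rule finite_set_of_finite_funs) auto
qed

lemma LINT_weak_deriv_le_sobolev_norm:
  assumes "mlen \<alpha> \<le> nat \<lfloor>r\<rfloor>"
  shows "(LINT x|cube_measure. (weak_deriv \<alpha> u x)\<^sup>2) \<le> (sobolev_norm r u)\<^sup>2"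
proof -
  have "(LINT x|cube_measure. (weak_deriv \<alpha> u x)\<^sup>2) \<le>
      (\<Sum>\<alpha> | mlen \<alpha> \<le> nat \<lfloor>r\<rfloor>. LINT x|cube_measure. (weak_deriv \<alpha> u x)\<^sup>2)"
    using assms by (intro member_le_sum finite_mindex) auto
  moreover have "0 \<le> (if frac r = 0 then 0
      else \<Sum>\<alpha> | mlen \<alpha> = nat \<lfloor>r\<rfloor>. enn2real (gagliardo (frac r) (weak_deriv \<alpha> u)))"
    by (auto intro: sum_nonneg)
  moreover have "0 \<le> (\<Sum>\<alpha> | mlen \<alpha> \<le> nat \<lfloor>r\<rfloor>. LINT x|cube_measure. (weak_deriv \<alpha> u x)\<^sup>2)"
    by (auto intro: sum_nonneg)
  ultimately show ?thesis unfolding sobolev_norm_def by (subst real_sqrt_pow2) linarith+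
qed

text \<open>The norm contains a chosen weak derivative of order 0 and not u itself; both have the
  same pairings, and this suffices. The strict bound makes e positive, as
  \<open>abs_pairing_le\<close> requires.\<close>

lemma abs_pairing_le_sobolev_norm:
  assumes "u \<in> L2" "sobolev_norm r u < e"
  shows "\<bar>pairing u k \<theta>\<bar> \<le> e * (1 + (2 * pi) ^ 3)"
proof -
  define w where "w = weak_deriv (pure_index 1 0) u"
  have w: "has_weak_deriv u (pure_index 1 0) w"
    unfolding w_def using has_weak_deriv_0[OF assms(1)] by (rule has_weak_deriv_weak_deriv)
  have nn: "0 \<le> sobolev_norm r u"
    unfolding sobolev_norm_def by (intro real_sqrt_ge_zero add_nonneg_nonneg sum_nonneg) (auto intro: sum_nonneg)
  have "(LINT x|cube_measure. (w x)\<^sup>2) \<le> (sobolev_norm r u)\<^sup>2"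
    unfolding w_def by (rule LINT_weak_deriv_le_sobolev_norm) simp
  also have "\<dots> \<le> e\<^sup>2" using assms(2) nn by (intro power_mono) auto
  finally have "\<bar>pairing w k \<theta>\<bar> \<le> e * (1 + (2 * pi) ^ 3)"
    using w nn assms(2) by (intro abs_pairing_le) (auto intro: has_weak_deriv_L2)
  moreover have "pairing w k \<theta> = pairing u k \<theta>"
    unfolding pairing_def
    by (rule weak_deriv_pairing_unique[OF w has_weak_deriv_0[OF assms(1)]]) (rule smooth_cos[OF smooth_phase])
  ultimately show ?thesis by simp
qed

text \<open>The cosines do not vanish at the boundary, so they are not test functions, and the
  definition of weak derivatives does not apply to them. Here the periodic closure enters: for a
  smooth periodic \<phi> close to u the identity is classical integration by parts, and the norm of
  u - \<phi> controls the pairings of order 0 and of order n alike.\<close>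

lemma pairing_weak_deriv:
  assumes u: "u \<in> sobolev_per r" and n: "n \<le> nat \<lfloor>r\<rfloor>" and v: "has_weak_deriv u (pure_index i n) v"
  shows "pairing v k \<theta> = (- real_of_int (k $ i)) ^ n * pairing u k (\<theta> + real n * (pi / 2))"
    (is "_ = ?c * pairing u k ?\<theta>")
proof -
  let ?V = "1 + (2 * pi) ^ 3"
  have "\<bar>pairing v k \<theta> - ?c * pairing u k ?\<theta>\<bar> \<le> 0 + e" if "e > 0" for e
  proof -
    \<comment> \<open>The error is at most d V from order n plus |c| d V from order 0; this d makes
      the total equal to e.\<close>
    define d where "d = e / (?V * (1 + \<bar>?c\<bar>))"
    have V: "?V > 0" by (simp add: add_pos_pos)
    have d: "d > 0" using that V by (simp add: d_def zero_less_mult_iff add_pos_nonneg)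
    obtain \<phi> where \<phi>: "\<phi> \<in> Cinf_per" "sobolev_norm r (\<lambda>x. u x - \<phi> x) < d"
      using u d unfolding sobolev_per_def by blast
    have sm: "smooth \<phi>" using \<phi>(1) by (simp add: Cinf_per_def)
    define z where "z = (\<lambda>x. u x - \<phi> x)"
    \<comment> \<open>The norm speaks about this chosen derivative; its pairings agree with those of
      the explicit one, v minus the derivative of \<phi>.\<close>
    define w where "w = weak_deriv (pure_index i n) z"
    have z1: "has_weak_deriv z (pure_index i n) (\<lambda>x. v x - (partial_deriv i ^^ n) \<phi> x)"
      using has_weak_deriv_lincomb[OF v has_weak_deriv_smooth[OF sm], of 1 "-1"] by (simp add: z_def)
    have w: "has_weak_deriv z (pure_index i n) w"
      unfolding w_def by (rule has_weak_deriv_weak_deriv[OF z1])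
    have zL: "z \<in> L2" "w \<in> L2" using has_weak_deriv_L2[OF w] .
    have L: "u \<in> L2" "v \<in> L2" "\<phi> \<in> L2" "(partial_deriv i ^^ n) \<phi> \<in> L2"
      using has_weak_deriv_L2[OF v] has_weak_deriv_L2[OF has_weak_deriv_smooth[OF sm]] by auto
    have "(LINT x|cube_measure. (w x)\<^sup>2) \<le> (sobolev_norm r z)\<^sup>2"
      unfolding w_def by (rule LINT_weak_deriv_le_sobolev_norm) (simp add: n)
    also have "\<dots> \<le> d\<^sup>2"
      using \<phi>(2) unfolding z_def[symmetric]
      by (intro power_mono) (auto simp: sobolev_norm_def intro!: real_sqrt_ge_zero add_nonneg_nonneg sum_nonneg)
    finally have b1: "\<bar>pairing w k \<theta>\<bar> \<le> d * ?V"
      by (intro abs_pairing_le zL d)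
    have "pairing w k \<theta> = pairing (\<lambda>x. v x - (partial_deriv i ^^ n) \<phi> x) k \<theta>"
      unfolding pairing_def by (rule weak_deriv_pairing_unique[OF w z1]) (rule smooth_cos[OF smooth_phase])
    also have "\<dots> = pairing v k \<theta> - pairing ((partial_deriv i ^^ n) \<phi>) k \<theta>"
      using pairing_lincomb[OF L(2,4), of 1 "-1"] by simp
    also have "pairing ((partial_deriv i ^^ n) \<phi>) k \<theta> =
        (-1) ^ n * (LINT x|cube_measure. real_of_int (k $ i) ^ n * (\<phi> x * cos (kvec k \<bullet> x + ?\<theta>)))"
      unfolding pairing_def LINT_by_parts_per_funpow[OF \<phi>(1) cos_phase_Cinf_per]
        funpow_partial_deriv_cos_phase
      by (simp only: mult.left_commute)
    also have "\<dots> = ?c * pairing \<phi> k ?\<theta>"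
      unfolding pairing_def power_minus[of "real_of_int (k $ i)"] by (simp only: integral_mult_right_zero mult.assoc)
    finally have 1: "pairing w k \<theta> = pairing v k \<theta> - ?c * pairing \<phi> k ?\<theta>" .
    have b2: "\<bar>pairing z k ?\<theta>\<bar> \<le> d * ?V"
      by (rule abs_pairing_le_sobolev_norm[OF zL(1)]) (use \<phi>(2) z_def in simp)
    have "pairing z k ?\<theta> = pairing u k ?\<theta> - pairing \<phi> k ?\<theta>"
      unfolding z_def using pairing_lincomb[OF L(1,3), of 1 "-1"] by simp
    then have "pairing v k \<theta> - ?c * pairing u k ?\<theta> = pairing w k \<theta> - ?c * pairing z k ?\<theta>"
      unfolding 1 by (simp only: right_diff_distrib)
    also have "\<bar>\<dots>\<bar> \<le> \<bar>pairing w k \<theta>\<bar> + \<bar>?c\<bar> * \<bar>pairing z k ?\<theta>\<bar>"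
      using abs_triangle_ineq4[of "pairing w k \<theta>" "?c * pairing z k ?\<theta>"] by (simp only: abs_mult)
    also have "\<dots> \<le> d * ?V + \<bar>?c\<bar> * (d * ?V)"
      by (intro add_mono mult_left_mono b1 b2) auto
    also have "\<dots> = d * (?V * (1 + \<bar>?c\<bar>))" by (simp only: algebra_simps)
    also have "\<dots> = e"
    proof -
      have "?V * (1 + \<bar>?c\<bar>) \<noteq> 0" using V by (smt (verit) mult_pos_pos abs_ge_zero)
      then show ?thesis unfolding d_def by simp
    qed
    finally show ?thesis by simp
  qed
  then have "\<bar>pairing v k \<theta> - ?c * pairing u k ?\<theta>\<bar> \<le> 0" by (rule field_le_epsilon)
  then show ?thesis by simp
qed

section \<open>Fourier series\<close>

definition fcoef :: "(real^3 \<Rightarrow> complex) \<Rightarrow> int^3 \<Rightarrow> complex" where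
  "fcoef f k = (LINT x|cube_measure. f x * cis (- (kvec k \<bullet> x))) / of_real ((2 * pi) ^ 3)"

lemma fcoef_eqI:
  assumes "(LINT x|cube_measure. f x * cis (- (kvec k \<bullet> x))) = of_real ((2 * pi) ^ 3) * c"
  shows "fcoef f k = c"
  unfolding fcoef_def assms by simp

lemma LINT_fcoef:
  "(LINT x|cube_measure. f x * cis (- (kvec k \<bullet> x))) = of_real ((2 * pi) ^ 3) * fcoef f k"
  unfolding fcoef_def by simp

lemma fcoef_cong:
  assumes "\<And>x. x \<in> cube \<Longrightarrow> f x = g x"
  shows "fcoef f k = fcoef g k"
  unfolding fcoef_def using assms by (intro arg_cong2[where f = "(/)"] Bochner_Integration.integral_cong) auto

lemma continuous_on_cis_inner [continuous_intros]: "continuous_on A (\<lambda>x. cis (kvec k \<bullet> x))"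
  by (intro continuous_intros)

lemma continuous_on_cis_minus [continuous_intros]: "continuous_on A (\<lambda>x. cis (- (kvec k \<bullet> x)))"
  by (intro continuous_intros)

lemma kvec_add: "kvec (k + l) = kvec k + kvec l" and kvec_diff: "kvec (k - l) = kvec k - kvec l"
  and kvec_0 [simp]: "kvec 0 = 0"
  by (simp_all add: Finite_Cartesian_Product.vec_eq_iff)

text \<open>Since cos(t + pi/2) = - sin t, the phases 0 and pi/2 give the real and the imaginary
  part of exp(-it).\<close>

lemma fcoef_pairing:
  assumes "u \<in> L2"
  shows "of_real ((2 * pi) ^ 3) * fcoef (\<lambda>x. of_real (u x)) k = Complex (pairing u k 0) (pairing u k (pi / 2))"
proof -
  have eq: "complex_of_real (u x) * cis (- (kvec k \<bullet> x)) =
      complex_of_real (u x * cos (kvec k \<bullet> x + 0)) + \<i> * complex_of_real (u x * cos (kvec k \<bullet> x + pi / 2))" for x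
    by (simp add: complex_eq_iff) (simp add: cos_add)
  have int: "integrable cube_measure (\<lambda>x. complex_of_real (u x * cos (kvec k \<bullet> x + \<theta>)))" for \<theta>
    by (intro integrable_of_real L2_integrable_mult_continuous assms continuous_intros)
  have "(LINT x|cube_measure. complex_of_real (u x) * cis (- (kvec k \<bullet> x))) =
      complex_of_real (pairing u k 0) + \<i> * complex_of_real (pairing u k (pi / 2))"
    unfolding eq pairing_def
      Bochner_Integration.integral_add[OF int[of 0] integrable_mult_right[OF int[of "pi / 2"]]]
    by (simp only: integral_complex_of_real integral_mult_right_zero)
  then show ?thesis unfolding LINT_fcoef by (simp add: complex_eq_iff)
qed

text \<open>After a shift by a quarter period, k_i times the integrand is the i-th partial
  derivative of a periodic cosine, and such derivatives have integral 0.\<close>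

lemma LINT_cos_phase:
  assumes "k \<noteq> 0"
  shows "(LINT x|cube_measure. cos (kvec k \<bullet> x + \<theta>)) = 0"
proof -
  obtain i where i: "k $ i \<noteq> 0" using assms by (auto simp: Finite_Cartesian_Product.vec_eq_iff)
  define F where "F = (\<lambda>x. cos (kvec k \<bullet> x + (\<theta> - pi / 2)))"
  have F: "F \<in> Cinf_per" unfolding F_def by (rule cos_phase_Cinf_per)
  have "integral cube (partial_deriv i F) = 0"
    by (rule integral_partial_deriv_0[where \<delta> = 1]) (use F in \<open>auto simp: Cinf_per_def\<close>)
  moreover have "partial_deriv i F = (\<lambda>x. real_of_int (k $ i) * cos (kvec k \<bullet> x + \<theta>))"
    using partial_deriv_cos_phase[of i 1 k "\<theta> - pi / 2"] by (simp add: F_def)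
  ultimately have "(LINT x|cube_measure. real_of_int (k $ i) * cos (kvec k \<bullet> x + \<theta>)) = 0"
    by (subst LINT_cube) (auto intro!: continuous_intros)
  then show ?thesis using i by simp
qed

lemma LINT_cis:
  "(LINT x|cube_measure. cis (kvec k \<bullet> x)) = (if k = 0 then of_real ((2 * pi) ^ 3) else 0)"
proof (cases "k = 0")
  case True
  have "(LINT x|cube_measure. cis (kvec k \<bullet> x)) = (LINT x|cube_measure. complex_of_real 1)"
    by (simp only: True kvec_0 inner_zero_left cis_zero of_real_1)
  also have "\<dots> = of_real ((2 * pi) ^ 3 * 1)"
    by (simp only: integral_complex_of_real LINT_cube_const)
  finally show ?thesis using True by simp
next
  case False
  have eq: "cis (kvec k \<bullet> x) = complex_of_real (cos (kvec k \<bullet> x + 0)) + \<i> * complex_of_real (cos (kvec k \<bullet> x + (- pi / 2)))" for x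
    by (simp add: complex_eq_iff) (simp add: cos_diff)
  have int: "integrable cube_measure (\<lambda>x. complex_of_real (cos (kvec k \<bullet> x + \<theta>)))" for \<theta>
    by (intro integrable_of_real integrable_cube continuous_intros)
  have "(LINT x|cube_measure. cis (kvec k \<bullet> x)) =
      complex_of_real (LINT x|cube_measure. cos (kvec k \<bullet> x + 0)) + \<i> * complex_of_real (LINT x|cube_measure. cos (kvec k \<bullet> x + (- pi / 2)))"
    unfolding eq
      Bochner_Integration.integral_add[OF int[of 0] integrable_mult_right[OF int[of "- pi / 2"]]]
    by (simp only: integral_complex_of_real integral_mult_right_zero)
  then show ?thesis using False by (simp only: LINT_cos_phase[OF False]) simp
qed

lemma LINT_sum_cis:
  assumes "finite F"
  shows "(LINT x|cube_measure. (\<Sum>k\<in>F. a k * cis (kvec k \<bullet> x)) * cis (- (kvec l \<bullet> x))) =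
    of_real ((2 * pi) ^ 3) * (if l \<in> F then a l else 0)"
proof -
  have "(\<Sum>k\<in>F. a k * cis (kvec k \<bullet> x)) * cis (- (kvec l \<bullet> x)) = (\<Sum>k\<in>F. a k * cis (kvec (k - l) \<bullet> x))" for x
    by (simp add: sum_distrib_right mult.assoc cis_mult kvec_diff inner_diff_left)
  then have "(LINT x|cube_measure. (\<Sum>k\<in>F. a k * cis (kvec k \<bullet> x)) * cis (- (kvec l \<bullet> x))) =
      (\<Sum>k\<in>F. LINT x|cube_measure. a k * cis (kvec (k - l) \<bullet> x))"
    by (simp only:) (intro Bochner_Integration.integral_sum integrable_cube continuous_intros)
  also have "\<dots> = (\<Sum>k\<in>F. if k = l then of_real ((2 * pi) ^ 3) * a l else 0)"
    by (intro sum.cong refl) (simp only: integral_mult_right_zero LINT_cis, auto)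
  also have "\<dots> = of_real ((2 * pi) ^ 3) * (if l \<in> F then a l else 0)"
    using assms by simp
  finally show ?thesis .
qed

text \<open>Expand the integral of |u - S|^2, which is nonnegative. The mixed product and |S|^2 both
  integrate to (2 pi)^3 Q, so the integral of u^2 minus (2 pi)^3 Q remains.\<close>

lemma bessel:
  assumes u: "u \<in> L2" and F: "finite F"
  shows "(2 * pi) ^ 3 * (\<Sum>k\<in>F. (cmod (fcoef (\<lambda>x. of_real (u x)) k))\<^sup>2) \<le> (LINT x|cube_measure. (u x)\<^sup>2)"
proof -
  define c where "c = fcoef (\<lambda>x. of_real (u x))"
  define S where "S = (\<lambda>x. \<Sum>k\<in>F. c k * cis (kvec k \<bullet> x))"
  define Q where "Q = (\<Sum>k\<in>F. (cmod (c k))\<^sup>2)"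
  have cS [continuous_intros]: "continuous_on A S" for A unfolding S_def by (intro continuous_intros)
  have cu: "integrable cube_measure (\<lambda>x. complex_of_real (u x) * g x)" if "continuous_on cube g" for g
  proof -
    have "integrable cube_measure (\<lambda>x. complex_of_real (u x * Re (g x)) + \<i> * complex_of_real (u x * Im (g x)))"
      using that by (intro Bochner_Integration.integrable_add integrable_mult_right integrable_of_real
        L2_integrable_mult_continuous u continuous_intros)
    then show ?thesis
      by (rule Bochner_Integration.integrable_cong[THEN iffD1, rotated 2]) (auto simp: complex_eq_iff)
  qed
  have cnjS: "cnj (S x) = (\<Sum>k\<in>F. cnj (c k) * cis (- (kvec k \<bullet> x)))" for x
    by (simp add: S_def cis_cnj)
  have 1: "(LINT x|cube_measure. complex_of_real (u x) * cnj (S x)) = of_real ((2 * pi) ^ 3 * Q)"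
  proof -
    have "(LINT x|cube_measure. complex_of_real (u x) * cnj (S x)) =
        (LINT x|cube_measure. (\<Sum>k\<in>F. cnj (c k) * (complex_of_real (u x) * cis (- (kvec k \<bullet> x)))))"
      unfolding cnjS by (simp add: sum_distrib_left mult_ac)
    also have "\<dots> = (\<Sum>k\<in>F. LINT x|cube_measure. cnj (c k) * (complex_of_real (u x) * cis (- (kvec k \<bullet> x))))"
      by (intro Bochner_Integration.integral_sum integrable_mult_right cu continuous_intros)
    also have "\<dots> = (\<Sum>k\<in>F. cnj (c k) * (of_real ((2 * pi) ^ 3) * c k))"
      by (intro sum.cong refl) (simp only: integral_mult_right_zero LINT_fcoef c_def)
    also have "\<dots> = (\<Sum>k\<in>F. of_real ((2 * pi) ^ 3) * of_real ((cmod (c k))\<^sup>2))"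
      by (intro sum.cong refl) (simp only: complex_norm_square mult_ac)
    finally show ?thesis by (simp add: Q_def sum_distrib_left)
  qed
  have 2: "(LINT x|cube_measure. S x * cnj (S x)) = of_real ((2 * pi) ^ 3 * Q)"
  proof -
    have "(LINT x|cube_measure. S x * cnj (S x)) =
        (LINT x|cube_measure. (\<Sum>l\<in>F. cnj (c l) * (S x * cis (- (kvec l \<bullet> x)))))"
      unfolding cnjS by (simp add: sum_distrib_left mult_ac)
    also have "\<dots> = (\<Sum>l\<in>F. LINT x|cube_measure. cnj (c l) * (S x * cis (- (kvec l \<bullet> x))))"
      by (intro Bochner_Integration.integral_sum integrable_cube continuous_intros)
    also have "\<dots> = (\<Sum>l\<in>F. cnj (c l) * (of_real ((2 * pi) ^ 3) * c l))"
      unfolding integral_mult_right_zero S_def LINT_sum_cis[OF F] by (intro sum.cong refl) simp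
    also have "\<dots> = (\<Sum>k\<in>F. of_real ((2 * pi) ^ 3) * of_real ((cmod (c k))\<^sup>2))"
      by (intro sum.cong refl) (simp only: complex_norm_square mult_ac)
    finally show ?thesis by (simp add: Q_def sum_distrib_left)
  qed
  have i1: "integrable cube_measure (\<lambda>x. complex_of_real (u x) * cnj (S x))"
    by (intro cu continuous_intros)
  have i2: "integrable cube_measure (\<lambda>x. S x * cnj (S x))"
    by (intro integrable_cube continuous_intros)
  have "0 \<le> (LINT x|cube_measure. (cmod (complex_of_real (u x) - S x))\<^sup>2)"
    by (rule Bochner_Integration.integral_nonneg) simp
  also have "\<dots> = (LINT x|cube_measure. (u x)\<^sup>2 - 2 * Re (complex_of_real (u x) * cnj (S x)) + Re (S x * cnj (S x)))"
    by (intro Bochner_Integration.integral_cong refl)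
       (unfold cmod_power2, simp add: power2_eq_square algebra_simps)
  also have "\<dots> = (LINT x|cube_measure. (u x)\<^sup>2) - 2 * (2 * pi) ^ 3 * Q + (2 * pi) ^ 3 * Q"
  proof -
    have "(LINT x|cube_measure. (u x)\<^sup>2 - 2 * Re (complex_of_real (u x) * cnj (S x)) + Re (S x * cnj (S x))) =
        (LINT x|cube_measure. (u x)\<^sup>2) - 2 * (LINT x|cube_measure. Re (complex_of_real (u x) * cnj (S x)))
         + (LINT x|cube_measure. Re (S x * cnj (S x)))"
      using integrable_mult_right[OF integrable_Re[OF i1], of 2] integrable_Re[OF i2] L2_integrable_power2[OF u]
      by (simp only: Bochner_Integration.integral_add Bochner_Integration.integral_diff
        Bochner_Integration.integrable_diff integral_mult_right_zero)
    then show ?thesis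
      by (simp only: integral_Re[OF i1] integral_Re[OF i2] 1 2 Re_complex_of_real mult.assoc)
  qed
  finally show ?thesis by (simp add: Q_def c_def)
qed

text \<open>The powers of q concentrate at its unique maximum; with a trigonometric polynomial for q
  this replaces the Stone-Weierstrass theorem, and no periodicity of w is needed.\<close>

lemma continuous_peak_eq_0:
  fixes w q :: "real^3 \<Rightarrow> real"
  assumes w: "continuous_on cube w" and q: "continuous_on cube q"
    and q0: "\<And>x. x \<in> cube \<Longrightarrow> 0 \<le> q x" and q1: "\<And>x. x \<in> cube \<Longrightarrow> x \<noteq> x0 \<Longrightarrow> q x < 1"
    and x0: "x0 \<in> interior cube" "q x0 = 1"
    and int: "\<And>n. (LINT x|cube_measure. w x * q x ^ n) = 0"
  shows "w x0 \<le> 0"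
proof (rule ccontr)
  assume "\<not> w x0 \<le> 0"
  define a where "a = w x0 / 2"
  have a: "a > 0" "w x0 > a" using \<open>\<not> w x0 \<le> 0\<close> by (auto simp: a_def)
  have x0c: "x0 \<in> cube" using x0 interior_subset by blast
  obtain \<delta>0 where \<delta>0: "\<delta>0 > 0" "ball x0 \<delta>0 \<subseteq> cube"
    using x0(1) by (auto simp: mem_interior)
  obtain \<delta>1 where \<delta>1: "\<delta>1 > 0" "\<And>x. x \<in> cube \<Longrightarrow> dist x x0 < \<delta>1 \<Longrightarrow> dist (w x) (w x0) < w x0 - a"
    using w a x0c unfolding continuous_on_iff by (metis diff_gt_0_iff_gt)
  define \<delta> where "\<delta> = min \<delta>0 \<delta>1"
  have \<delta>: "\<delta> > 0" "ball x0 \<delta> \<subseteq> cube" using \<delta>0 \<delta>1 by (auto simp: \<delta>_def)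
  have w_gt: "w x > a" if "x \<in> cube" "dist x x0 < \<delta>" for x
    using \<delta>1(2)[of x] that by (auto simp: \<delta>_def dist_real_def)
  have cptc: "compact cube" by (simp add: cube_alt)
  have cpt: "compact (cube - ball x0 \<delta>)"
    using cptc by (simp add: compact_diff)
  obtain \<rho> where \<rho>: "0 \<le> \<rho>" "\<rho> < 1" "\<And>x. x \<in> cube - ball x0 \<delta> \<Longrightarrow> q x \<le> \<rho>"
  proof (cases "cube - ball x0 \<delta> = {}")
    case True
    show ?thesis by (rule that[of 0]) (use True in auto)
  next
    case False
    obtain y where "y \<in> cube - ball x0 \<delta>" "\<And>x. x \<in> cube - ball x0 \<delta> \<Longrightarrow> q x \<le> q y"
      using continuous_attains_sup[OF cpt False, of q] continuous_on_subset[OF q] by blast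
    moreover have "y \<noteq> x0" using calculation(1) \<delta>(1) by auto
    ultimately show ?thesis using q0[of y] q1[of y] by (intro that[of "q y"]) auto
  qed
  \<comment> \<open>A value strictly between \<rho>, which bounds q away from \<open>x0\<close>, and
    the maximum 1: close to \<open>x0\<close> one has q >= \<rho>', and powers of \<rho>' eventually
    dominate powers of \<rho>.\<close>
  define \<rho>' where "\<rho>' = (\<rho> + 1) / 2"
  have \<rho>': "\<rho> < \<rho>'" "\<rho>' < 1" "0 < \<rho>'" using \<rho> by (auto simp: \<rho>'_def)
  obtain \<eta>1 where \<eta>1: "\<eta>1 > 0" "\<And>x. x \<in> cube \<Longrightarrow> dist x x0 < \<eta>1 \<Longrightarrow> dist (q x) (q x0) < 1 - \<rho>'"
    using q \<rho>' x0c unfolding continuous_on_iff by (metis diff_gt_0_iff_gt)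
  define \<eta> where "\<eta> = min \<delta> \<eta>1"
  have \<eta>: "\<eta> > 0" "ball x0 \<eta> \<subseteq> cube" using \<eta>1 \<delta> by (auto simp: \<eta>_def)
  have q_gt: "q x \<ge> \<rho>'" if "x \<in> cube" "dist x x0 < \<eta>" for x
    using \<eta>1(2)[of x] that x0(2) by (auto simp: \<eta>_def dist_real_def)
  obtain M where M: "\<And>x. x \<in> cube \<Longrightarrow> \<bar>w x\<bar> \<le> M" "M \<ge> 0"
  proof -
    have "bounded (w ` cube)" using w cptc by (simp add: compact_continuous_image compact_imp_bounded)
    then obtain M where "M > 0" "\<And>x. x \<in> cube \<Longrightarrow> \<bar>w x\<bar> \<le> M"
      unfolding bounded_pos by auto
    then show thesis using that[of M] by auto
  qed
  define \<mu> where "\<mu> = measure lebesgue (ball x0 \<eta>)"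
  have \<mu>: "\<mu> > 0" using content_ball_pos[OF \<eta>(1), of x0] by (simp add: \<mu>_def)
  \<comment> \<open>The small ball contributes at least a \<mu> \<rho>'^n to the vanishing integral,
    and the region outside the larger ball at least - M (2 pi)^3 \<rho>^n. Between the two balls the
    integrand is nonnegative.\<close>
  have key: "a * \<mu> \<le> M * (2 * pi) ^ 3 * (\<rho> / \<rho>') ^ n" for n
  proof -
    have pt: "a * \<rho>' ^ n * indicat_real (ball x0 \<eta>) x - M * \<rho> ^ n \<le> w x * q x ^ n" if x: "x \<in> cube" for x
    proof (cases "dist x x0 < \<delta>")
      case True
      have w: "w x \<ge> a" using w_gt[OF x True] by simp
      have "a * \<rho>' ^ n * indicat_real (ball x0 \<eta>) x \<le> w x * q x ^ n"
      proof (cases "dist x x0 < \<eta>")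
        case True
        have "a * \<rho>' ^ n \<le> w x * q x ^ n"
          using w a \<rho>' q_gt[OF x True] by (intro mult_mono power_mono) auto
        then show ?thesis using True by (simp add: dist_commute)
      next
        case False
        then show ?thesis using w a q0[OF x] by (simp add: dist_commute)
      qed
      then show ?thesis using M(2) \<rho>(1) by (smt (verit) mult_nonneg_nonneg zero_le_power)
    next
      case False
      then have "x \<in> cube - ball x0 \<delta>" using x by (simp add: dist_commute)
      then have "q x ^ n \<le> \<rho> ^ n" using \<rho>(3) q0[OF x] by (intro power_mono) auto
      then have "\<bar>w x\<bar> * q x ^ n \<le> M * \<rho> ^ n"
        using M(1)[OF x] M(2) q0[OF x] by (intro mult_mono) auto
      moreover have "- (\<bar>w x\<bar> * q x ^ n) \<le> w x * q x ^ n"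
      proof -
        have "- \<bar>w x\<bar> * q x ^ n \<le> w x * q x ^ n"
          using q0[OF x] by (intro mult_right_mono) auto
        then show ?thesis by simp
      qed
      moreover have "x \<notin> ball x0 \<eta>" using False by (simp add: \<eta>_def dist_commute)
      ultimately show ?thesis by simp
    qed
    have ball_sets: "ball x0 \<eta> \<in> sets cube_measure"
      using \<eta>(2) by (subst sets_restrict_space_iff) (auto simp: inf_absorb1)
    have mb: "measure cube_measure (ball x0 \<eta>) = \<mu>"
      unfolding \<mu>_def by (rule measure_restrict_space) (use \<eta>(2) in auto)
    have ii: "integrable cube_measure (indicat_real (ball x0 \<eta>))"
      using ball_sets finite_measure.emeasure_finite[OF finite_measure_cube] by (simp add: top.not_eq_extremum)
    have "(LINT x|cube_measure. a * \<rho>' ^ n * indicat_real (ball x0 \<eta>) x - M * \<rho> ^ n)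
        \<le> (LINT x|cube_measure. w x * q x ^ n)"
      by (intro integral_mono Bochner_Integration.integrable_diff integrable_mult_right ii integrable_const_cube
        integrable_cube continuous_intros w q) (use pt in auto)
    also have "\<dots> = 0" by (rule int)
    also have "(LINT x|cube_measure. a * \<rho>' ^ n * indicat_real (ball x0 \<eta>) x - M * \<rho> ^ n) =
        a * \<rho>' ^ n * (LINT x|cube_measure. indicat_real (ball x0 \<eta>) x) - (2 * pi) ^ 3 * (M * \<rho> ^ n)"
      using integrable_mult_right[OF ii, of "a * \<rho>' ^ n"] integrable_const_cube[of "M * \<rho> ^ n"]
      unfolding LINT_cube_const[of "M * \<rho> ^ n", symmetric]
      by (simp only: Bochner_Integration.integral_diff integral_mult_right_zero)
    also have "(LINT x|cube_measure. indicat_real (ball x0 \<eta>) x) = \<mu>"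
      using ball_sets mb by (simp add: inf_absorb1 \<eta>(2))
    finally have "a * \<mu> * \<rho>' ^ n \<le> M * (2 * pi) ^ 3 * \<rho> ^ n" by (simp add: mult_ac)
    then show ?thesis using \<rho>'(3) by (simp add: power_divide field_simps)
  qed
  have "(\<lambda>n. M * (2 * pi) ^ 3 * (\<rho> / \<rho>') ^ n) \<longlonglongrightarrow> M * (2 * pi) ^ 3 * 0"
    using \<rho> \<rho>' by (intro tendsto_mult tendsto_const LIMSEQ_power_zero) auto
  from LIMSEQ_le_const[OF this, of "a * \<mu>"] have "a * \<mu> \<le> 0" using key by auto
  then show False using a \<mu> by (simp add: mult_le_0_iff)
qed

text \<open>The mean of three raised cosines (1 + cos)/2: it lies between 0 and 1 and equals 1 only
  at points congruent to y modulo 2 pi.\<close>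

definition peak :: "real^3 \<Rightarrow> real^3 \<Rightarrow> real" where
  "peak y x = (\<Sum>i\<in>UNIV. (1 + cos (x $ i - y $ i)) / 6)"

text \<open>\<open>peak y\<close> is a trigonometric polynomial with frequencies 0 and plus or minus
  the unit vectors, so each coefficient of the product is a combination of coefficients of f at k
  and at its neighbours.\<close>

lemma fcoef_mult_peak:
  assumes f: "continuous_on cube f" and 0: "\<And>k. fcoef f k = 0"
  shows "fcoef (\<lambda>x. f x * of_real (peak y x)) k = 0"
proof (rule fcoef_eqI)
  define e where "e = (\<lambda>i. axis i (1::int) :: int^3)"
  have ke: "kvec (e i) \<bullet> x = x $ i" for i x
  proof -
    have "kvec (e i) = axis i 1" by (simp add: e_def Finite_Cartesian_Product.vec_eq_iff axis_def)
    then show ?thesis by (simp add: inner_axis')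
  qed
  have cosE: "complex_of_real (cos t) = (cis t + cis (- t)) / 2" for t
    by (simp add: complex_eq_iff)
  have "f x * of_real (peak y x) * cis (- (kvec k \<bullet> x)) =
      (\<Sum>i\<in>UNIV. (1/6) * (f x * cis (- (kvec k \<bullet> x))) + (cis (- y $ i) / 12) * (f x * cis (- (kvec (k - e i) \<bullet> x)))
        + (cis (y $ i) / 12) * (f x * cis (- (kvec (k + e i) \<bullet> x))))" for x
  proof -
    have a: "cis (- (kvec (k - e i) \<bullet> x)) = cis (- (kvec k \<bullet> x)) * cis (x $ i)"
      "cis (- (kvec (k + e i) \<bullet> x)) = cis (- (kvec k \<bullet> x)) * cis (- x $ i)" for i
      by (simp_all add: kvec_add kvec_diff inner_diff_left inner_add_left ke cis_mult)
    have b: "cis (x $ i - y $ i) = cis (x $ i) * cis (- y $ i)" "cis (- (x $ i - y $ i)) = cis (- x $ i) * cis (y $ i)" for i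
      by (simp_all add: cis_mult)
    show ?thesis
      unfolding peak_def of_real_sum of_real_divide of_real_add cosE a b
      by (simp add: sum_distrib_left sum_distrib_right) (intro sum.cong refl, simp add: field_simps)
  qed
  then have "(LINT x|cube_measure. f x * of_real (peak y x) * cis (- (kvec k \<bullet> x))) =
     (LINT x|cube_measure. (\<Sum>i\<in>UNIV. (1/6) * (f x * cis (- (kvec k \<bullet> x))) + (cis (- y $ i) / 12) * (f x * cis (- (kvec (k - e i) \<bullet> x)))
        + (cis (y $ i) / 12) * (f x * cis (- (kvec (k + e i) \<bullet> x)))))" by (simp only:)
  also have "\<dots> = (\<Sum>i\<in>UNIV. LINT x|cube_measure. (1/6) * (f x * cis (- (kvec k \<bullet> x))) + (cis (- y $ i) / 12) * (f x * cis (- (kvec (k - e i) \<bullet> x)))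
        + (cis (y $ i) / 12) * (f x * cis (- (kvec (k + e i) \<bullet> x))))"
    by (intro Bochner_Integration.integral_sum integrable_cube continuous_intros f)
  also have "\<dots> = (\<Sum>i\<in>(UNIV::3 set). 0)"
  proof (rule sum.cong[OF refl])
    fix i :: 3
    have int: "integrable cube_measure (\<lambda>x. c * (f x * cis (- (kvec l \<bullet> x))))" for l c
      by (intro integrable_cube continuous_intros f)
    show "(LINT x|cube_measure. (1/6) * (f x * cis (- (kvec k \<bullet> x))) + (cis (- y $ i) / 12) * (f x * cis (- (kvec (k - e i) \<bullet> x)))
        + (cis (y $ i) / 12) * (f x * cis (- (kvec (k + e i) \<bullet> x)))) = 0"
      by (simp only: Bochner_Integration.integral_add[OF Bochner_Integration.integrable_add[OF int int] int]
        Bochner_Integration.integral_add[OF int int] integral_mult_right_zero LINT_fcoef 0 mult_zero_right add_0_right)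
  qed
  finally show "(LINT x|cube_measure. f x * of_real (peak y x) * cis (- (kvec k \<bullet> x))) = of_real ((2 * pi) ^ 3) * 0"
    by simp
qed

lemma continuous_peak: "continuous_on A (peak y)"
  unfolding peak_def by (intro continuous_intros) auto

text \<open>For y in the interior, \<open>peak y\<close> reaches 1 nowhere else in the closed cube,
  because entries of two such points differ by less than 2 pi. All powers of \<open>peak y\<close>
  are orthogonal to f, and \<open>continuous_peak_eq_0\<close> applies to the real and imaginary
  part with both signs. Boundary points are reached by continuity; treated directly they would fail,
  since opposite faces are congruent.\<close>

lemma continuous_fcoef_0_eq_0:
  assumes f: "continuous_on cube f" and 0: "\<And>k. fcoef f k = 0" and y: "y \<in> cube"
  shows "f y = 0"
proof -
  have interior: "f y = 0" if y: "y \<in> interior cube" for y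
  proof -
    have iter: "continuous_on cube (\<lambda>x. f x * of_real (peak y x ^ n)) \<and> (\<forall>k. fcoef (\<lambda>x. f x * of_real (peak y x ^ n)) k = 0)" for n
    proof (induction n)
      case (Suc n)
      have "(\<lambda>x. f x * of_real (peak y x ^ Suc n)) = (\<lambda>x. (f x * of_real (peak y x ^ n)) * of_real (peak y x))"
        by (simp add: mult_ac)
      then show ?case
        using fcoef_mult_peak[OF conjunct1[OF Suc] conjunct2[OF Suc, rule_format]]
          continuous_on_mult[OF conjunct1[OF Suc] continuous_on_of_real[OF continuous_peak]]
        by (simp only:) simp
    qed (simp add: f 0)
    have int: "(LINT x|cube_measure. f x * of_real (peak y x ^ n)) = 0" for n
      using iter[of n] LINT_fcoef[of "\<lambda>x. f x * of_real (peak y x ^ n)" 0] by simp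
    have ible: "integrable cube_measure (\<lambda>x. f x * of_real (peak y x ^ n))" for n
      by (intro integrable_cube) (use iter in blast)
    have re: "(LINT x|cube_measure. Re (f x) * peak y x ^ n) = 0" for n
    proof -
      have "Re (f x * of_real (peak y x ^ n)) = Re (f x) * peak y x ^ n" for x by simp
      then show ?thesis using integral_Re[OF ible[of n]] int by simp
    qed
    have im: "(LINT x|cube_measure. Im (f x) * peak y x ^ n) = 0" for n
    proof -
      have "Im (f x * of_real (peak y x ^ n)) = Im (f x) * peak y x ^ n" for x by simp
      then show ?thesis using integral_Im[OF ible[of n]] int by simp
    qed
    have p0: "0 \<le> peak y x" for x
    proof -
      have "0 \<le> 1 + cos t" for t :: real using cos_ge_minus_one[of t] by linarith
      then show ?thesis unfolding peak_def by (intro sum_nonneg) simp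
    qed
    have p1: "peak y x < 1" if x: "x \<in> cube" "x \<noteq> y" for x
    proof -
      obtain j where j: "x $ j \<noteq> y $ j" using x by (auto simp: Finite_Cartesian_Product.vec_eq_iff)
      have "\<bar>x $ j - y $ j\<bar> < 2 * pi"
        using x(1) y unfolding mem_cube mem_interior_cube by (smt (verit))
      then have "cos (x $ j - y $ j) \<noteq> 1"
      proof -
        assume *: "\<bar>x $ j - y $ j\<bar> < 2 * pi"
        show ?thesis
        proof
          assume "cos (x $ j - y $ j) = 1"
          then obtain n :: int where n: "x $ j - y $ j = real_of_int n * 2 * pi" unfolding cos_one_2pi_int by blast
          then have "\<bar>real_of_int n\<bar> * (2 * pi) < 1 * (2 * pi)" using * by (simp add: abs_mult)
          then have "\<bar>real_of_int n\<bar> < 1" by (rule mult_right_less_imp_less) simp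
          then have "n = 0" by linarith
          then show False using n j by simp
        qed
      qed
      then have "cos (x $ j - y $ j) < 1" using cos_le_one[of "x $ j - y $ j"] by linarith
      then have "(\<Sum>i\<in>UNIV. (1 + cos (x $ i - y $ i)) / 6) < (\<Sum>i\<in>(UNIV::3 set). (1 + 1) / 6)"
        by (intro sum_strict_mono_ex1) (auto intro!: exI[of _ j])
      then show ?thesis by (simp add: peak_def)
    qed
    have py: "peak y y = 1" by (simp add: peak_def)
    have "Re (f y) \<le> 0" "Im (f y) \<le> 0" "- Re (f y) \<le> 0" "- Im (f y) \<le> 0"
      using re im by (intro continuous_peak_eq_0[OF _ continuous_peak p0 p1 y py];
        (intro continuous_intros f)?; simp)+
    then show ?thesis by (simp add: complex_eq_iff)
  qed
  have "y \<in> closure (interior cube)"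
    using y convex_closure_interior[of cube] by (auto simp: cube_alt interval_ne_empty_cart)
  moreover have "closure (interior cube) \<subseteq> cube"
    using interior_subset by (rule closure_minimal) (unfold cube_alt, rule closed_cbox)
  ultimately show ?thesis
    using continuous_constant_on_closure[OF continuous_on_subset[OF f] interior] by blast
qed

text \<open>Absolute summability makes the partial sums converge uniformly. Their limit S is
  therefore continuous and has the coefficients of u, and u - S vanishes by
  \<open>continuous_fcoef_0_eq_0\<close>.\<close>

lemma fourier_series_has_sum:
  assumes u: "continuous_on cube u" and summable: "(\<lambda>k. norm (fcoef u k)) summable_on UNIV" and y: "y \<in> cube"
  shows "((\<lambda>k. fcoef u k * cis (kvec k \<bullet> y)) has_sum u y) UNIV"
proof -
  define S where "S = (\<lambda>x. \<Sum>\<^sub>\<infinity>k. fcoef u k * cis (kvec k \<bullet> x))"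
  have "(\<lambda>k. norm (fcoef u k * cis (kvec k \<bullet> x))) summable_on UNIV" for x
    using summable by (simp add: norm_mult)
  then have hs: "((\<lambda>k. fcoef u k * cis (kvec k \<bullet> x)) has_sum S x) UNIV" for x
    unfolding S_def by (rule has_sum_infsum[OF abs_summable_summable])
  have UL: "uniform_limit UNIV (\<lambda>F x. \<Sum>k\<in>F. fcoef u k * cis (kvec k \<bullet> x)) S (finite_subsets_at_top UNIV)"
    unfolding S_def by (rule Weierstrass_m_test_general[OF _ summable]) (simp add: norm_mult)
  have cS: "continuous_on A S" for A
  proof (rule continuous_on_subset[OF uniform_limit_theorem[OF _ UL]])
    show "\<forall>\<^sub>F F in finite_subsets_at_top UNIV. continuous_on UNIV (\<lambda>x. \<Sum>k\<in>F. fcoef u k * cis (kvec k \<bullet> x))"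
      by (intro always_eventually allI continuous_intros)
  qed auto
  have fS: "fcoef S l = fcoef u l" for l
  proof (rule fcoef_eqI)
    let ?f = "\<lambda>F x. (\<Sum>k\<in>F. fcoef u k * cis (kvec k \<bullet> x)) * cis (- (kvec l \<bullet> x))"
    have ul: "uniform_limit (cbox 0 (\<chi> i. 2 * pi)) ?f (\<lambda>x. S x * cis (- (kvec l \<bullet> x))) (finite_subsets_at_top UNIV)"
    proof -
      have "uniform_limit UNIV (\<lambda>F x. \<Sum>k\<in>F. fcoef u k * cis (kvec k \<bullet> x) * cis (- (kvec l \<bullet> x)))
          (\<lambda>x. S x * cis (- (kvec l \<bullet> x))) (finite_subsets_at_top UNIV)"
        by (rule Weierstrass_m_test_general'[OF _ _ summable]) (auto simp: norm_mult intro: has_sum_cmult_left hs)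
      then show ?thesis
        by (simp only: sum_distrib_right) (erule uniform_limit_on_subset, simp)
    qed
    have cf: "continuous_on (cbox 0 (\<chi> i. 2 * pi)) (?f F)" for F
      by (intro continuous_intros)
    obtain I J where IJ: "\<And>F. (?f F has_integral I F) (cbox 0 (\<chi> i. 2 * pi))"
      "((\<lambda>x. S x * cis (- (kvec l \<bullet> x))) has_integral J) (cbox 0 (\<chi> i. 2 * pi))" "(I \<longlongrightarrow> J) (finite_subsets_at_top UNIV)"
      by (rule uniform_limit_integral_cbox[OF ul cf finite_subsets_at_top_neq_bot]) (rule that)
    note IJ = IJ[folded cube_alt]
    \<comment> \<open>The integrals are eventually constant along the net: by orthogonality every
      finite set that contains l gives the coefficient at l exactly.\<close>
    have "\<forall>\<^sub>F F in finite_subsets_at_top UNIV. I F = of_real ((2 * pi) ^ 3) * fcoef u l"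
      unfolding eventually_finite_subsets_at_top
    proof (intro exI[of _ "{l}"] conjI allI impI)
      fix F assume F: "finite F \<and> {l} \<subseteq> F \<and> F \<subseteq> UNIV"
      have "I F = integral cube (?f F)" using IJ(1)[of F] by (rule integral_unique[symmetric])
      also have "\<dots> = (LINT x|cube_measure. ?f F x)"
        by (intro LINT_cube[symmetric] continuous_intros)
      also have "\<dots> = of_real ((2 * pi) ^ 3) * fcoef u l"
        using F by (simp only: LINT_sum_cis) simp
      finally show "I F = of_real ((2 * pi) ^ 3) * fcoef u l" .
    qed auto
    then have "(I \<longlongrightarrow> of_real ((2 * pi) ^ 3) * fcoef u l) (finite_subsets_at_top UNIV)"
      by (rule tendsto_eventually)
    then have J: "J = of_real ((2 * pi) ^ 3) * fcoef u l"
      by (rule tendsto_unique[OF finite_subsets_at_top_neq_bot IJ(3)])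
    have "(LINT x|cube_measure. S x * cis (- (kvec l \<bullet> x))) = integral cube (\<lambda>x. S x * cis (- (kvec l \<bullet> x)))"
      by (intro LINT_cube continuous_intros cS)
    also have "\<dots> = J" using IJ(2) by (rule integral_unique)
    finally show "(LINT x|cube_measure. S x * cis (- (kvec l \<bullet> x))) = of_real ((2 * pi) ^ 3) * fcoef u l"
      using J by simp
  qed
  have "fcoef (\<lambda>x. u x - S x) k = 0" for k
  proof -
    have i: "integrable cube_measure (\<lambda>x. u x * cis (- (kvec k \<bullet> x)))" "integrable cube_measure (\<lambda>x. S x * cis (- (kvec k \<bullet> x)))"
      by (intro integrable_cube continuous_intros u cS)+
    show ?thesis
      by (rule fcoef_eqI) (simp only: left_diff_distrib Bochner_Integration.integral_diff[OF i] LINT_fcoef fS, simp)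
  qed
  then have "u y - S y = 0"
    by (intro continuous_fcoef_0_eq_0[of "\<lambda>x. u x - S x"] continuous_intros u cS y)
  then show ?thesis using hs[of y] by simp
qed

section \<open>Fourier coefficients of Sobolev functions\<close>

lemma sobolev_per_weak_deriv:
  assumes "u \<in> sobolev_per r" "n \<le> nat \<lfloor>r\<rfloor>"
  obtains v where "has_weak_deriv u (pure_index i n) v"
proof -
  have "\<forall>\<alpha>. mlen \<alpha> \<le> nat \<lfloor>r\<rfloor> \<longrightarrow> (\<exists>v. has_weak_deriv u \<alpha> v)"
    using assms(1) by (simp add: sobolev_per_def sobolev_def)
  then have "\<exists>v. has_weak_deriv u (pure_index i n) v"
    using assms(2) by simp
  then show thesis using that by (elim exE)
qed

lemma cancel_cube_volume:
  "complex_of_real ((2 * pi) ^ 3) * a = complex_of_real ((2 * pi) ^ 3) * b \<Longrightarrow> a = b"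
  by simp

lemma sobolev_per_L2:
  assumes "u \<in> sobolev_per r"
  shows "u \<in> L2"
proof -
  obtain v where "has_weak_deriv u (pure_index 1 0) v"
    using sobolev_per_weak_deriv[OF assms, of 0] by blast
  then show ?thesis by (rule has_weak_deriv_L2)
qed

lemma pairing_shift_pi: "pairing u k (\<theta> + pi) = - pairing u k \<theta>"
proof -
  have "cos (kvec k \<bullet> x + (\<theta> + pi)) = - cos (kvec k \<bullet> x + \<theta>)" for x
    by (simp only: add.assoc[symmetric] cos_periodic_pi)
  then show ?thesis by (simp add: pairing_def)
qed

text \<open>A shift of both phases by a quarter period sends the pair (a, b) to (b, -a), which is
  multiplication of a + ib by -i.\<close>

lemma Complex_pairing_shift:
  "Complex (pairing u k (real n * (pi / 2))) (pairing u k (pi / 2 + real n * (pi / 2))) =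
    (- \<i>) ^ n * Complex (pairing u k 0) (pairing u k (pi / 2))"
proof (induction n)
  case (Suc n)
  have 1: "real (Suc n) * (pi / 2) = pi / 2 + real n * (pi / 2)" by (simp add: distrib_right)
  have 2: "pi / 2 + (pi / 2 + real n * (pi / 2)) = real n * (pi / 2) + pi" by simp
  have "Complex (pairing u k (real (Suc n) * (pi / 2))) (pairing u k (pi / 2 + real (Suc n) * (pi / 2))) =
      - \<i> * Complex (pairing u k (real n * (pi / 2))) (pairing u k (pi / 2 + real n * (pi / 2)))"
    unfolding 1 2 pairing_shift_pi by (simp add: complex_eq_iff)
  then show ?case unfolding Suc by simp
qed simp

text \<open>The factor (- k_i)^n comes from integrating by parts, and (- i)^n from the n
  quarter-period shifts of the phase; their product is the usual symbol.\<close>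

lemma fcoef_weak_deriv:
  assumes u: "u \<in> sobolev_per r" and n: "n \<le> nat \<lfloor>r\<rfloor>" and v: "has_weak_deriv u (pure_index i n) v"
  shows "fcoef (\<lambda>x. of_real (v x)) k = (\<i> * of_int (k $ i)) ^ n * fcoef (\<lambda>x. of_real (u x)) k"
proof -
  have "of_real ((2 * pi) ^ 3) * fcoef (\<lambda>x. of_real (v x)) k = Complex (pairing v k 0) (pairing v k (pi / 2))"
    by (rule fcoef_pairing[OF has_weak_deriv_L2(2)[OF v]])
  also have "\<dots> = of_real ((- real_of_int (k $ i)) ^ n) *
      Complex (pairing u k (real n * (pi / 2))) (pairing u k (pi / 2 + real n * (pi / 2)))"
    unfolding pairing_weak_deriv[OF u n v] by (simp add: complex_eq_iff)
  also have "\<dots> = of_real ((- real_of_int (k $ i)) ^ n) * ((- \<i>) ^ n * (of_real ((2 * pi) ^ 3) * fcoef (\<lambda>x. of_real (u x)) k))"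
    unfolding Complex_pairing_shift fcoef_pairing[OF has_weak_deriv_L2(1)[OF v]] ..
  also have "\<dots> = of_real ((2 * pi) ^ 3) * ((of_real (- real_of_int (k $ i)) * (- \<i>)) ^ n * fcoef (\<lambda>x. of_real (u x)) k)"
    unfolding power_mult_distrib of_real_power by (simp only: mult_ac)
  also have "of_real (- real_of_int (k $ i)) * (- \<i>) = \<i> * of_int (k $ i)" by simp
  finally show ?thesis
    by (rule cancel_cube_volume)
qed

text \<open>Bessel's inequality for the weak derivative of highest integer order in direction i; the
  fractional part of the norm is not touched.\<close>

lemma sobolev_per_fcoef_bound:
  assumes "u \<in> sobolev_per r"
  obtains B where "\<And>F. finite F \<Longrightarrow>
    (\<Sum>k\<in>F. \<bar>real_of_int (k $ i)\<bar> ^ (2 * nat \<lfloor>r\<rfloor>) * (cmod (fcoef (\<lambda>x. of_real (u x)) k))\<^sup>2) \<le> B"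
proof -
  obtain v where v: "has_weak_deriv u (pure_index i (nat \<lfloor>r\<rfloor>)) v"
    using sobolev_per_weak_deriv[OF assms] by blast
  have eq: "(cmod (fcoef (\<lambda>x. of_real (v x)) k))\<^sup>2 =
      \<bar>real_of_int (k $ i)\<bar> ^ (2 * nat \<lfloor>r\<rfloor>) * (cmod (fcoef (\<lambda>x. of_real (u x)) k))\<^sup>2" for k
    unfolding fcoef_weak_deriv[OF assms order_refl v] norm_mult norm_power power_mult_distrib
    by (simp add: norm_mult power_mult[symmetric] mult.commute)
  show thesis
  proof (rule that)
    fix F :: "(int^3) set" assume F: "finite F"
    have "(2 * pi) ^ 3 * (\<Sum>k\<in>F. (cmod (fcoef (\<lambda>x. of_real (v x)) k))\<^sup>2) \<le> (LINT x|cube_measure. (v x)\<^sup>2)"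
      by (rule bessel[OF has_weak_deriv_L2(2)[OF v] F])
    then show "(\<Sum>k\<in>F. \<bar>real_of_int (k $ i)\<bar> ^ (2 * nat \<lfloor>r\<rfloor>) * (cmod (fcoef (\<lambda>x. of_real (u x)) k))\<^sup>2)
        \<le> (LINT x|cube_measure. (v x)\<^sup>2) / (2 * pi) ^ 3"
      unfolding eq[symmetric] by (simp add: pos_le_divide_eq mult.commute)
  qed
qed

lemma fcoef_weak_partial:
  assumes "u \<in> sobolev_per r" "r \<ge> 1"
  shows "fcoef (\<lambda>x. of_real (weak_partial i u x)) k = \<i> * of_int (k $ i) * fcoef (\<lambda>x. of_real (u x)) k"
    and "weak_partial i u \<in> L2"
proof -
  have n: "1 \<le> nat \<lfloor>r\<rfloor>" using assms(2) by (simp add: le_nat_iff le_floor_iff)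
  obtain v where "has_weak_deriv u (pure_index i 1) v"
    using sobolev_per_weak_deriv[OF assms(1) n] by blast
  then have w: "has_weak_deriv u (pure_index i 1) (weak_partial i u)"
    unfolding weak_partial_def unit_index_pure by (rule has_weak_deriv_weak_deriv)
  show "fcoef (\<lambda>x. of_real (weak_partial i u x)) k = \<i> * of_int (k $ i) * fcoef (\<lambda>x. of_real (u x)) k"
    using fcoef_weak_deriv[OF assms(1) n w] by simp
  show "weak_partial i u \<in> L2" using w by (rule has_weak_deriv_L2)
qed

text \<open>In the divergence equations the constant stands inside the weak derivative, and the
  representative chosen for c u need not be c times the one chosen for u. Only their coefficients
  are compared.\<close>

lemma fcoef_weak_partial_cmult:
  assumes "u \<in> sobolev_per r" "r \<ge> 1"
  shows "fcoef (\<lambda>x. of_real (weak_partial i (\<lambda>x. c * u x) x)) k = of_real c * (\<i> * of_int (k $ i) * fcoef (\<lambda>x. of_real (u x)) k)"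
    and "weak_partial i (\<lambda>x. c * u x) \<in> L2"
proof -
  have n: "1 \<le> nat \<lfloor>r\<rfloor>" using assms(2) by (simp add: le_nat_iff le_floor_iff)
  obtain v where v: "has_weak_deriv u (pure_index i 1) v"
    using sobolev_per_weak_deriv[OF assms(1) n] by blast
  have w1: "has_weak_deriv (\<lambda>x. c * u x) (pure_index i 1) (\<lambda>x. c * v x)"
    using has_weak_deriv_lincomb[OF v v, of c 0] by simp
  then have w: "has_weak_deriv (\<lambda>x. c * u x) (pure_index i 1) (weak_partial i (\<lambda>x. c * u x))"
    unfolding weak_partial_def unit_index_pure by (rule has_weak_deriv_weak_deriv)
  then show L: "weak_partial i (\<lambda>x. c * u x) \<in> L2" by (rule has_weak_deriv_L2)
  have Lv: "v \<in> L2" using v by (rule has_weak_deriv_L2)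
  have "pairing (weak_partial i (\<lambda>x. c * u x)) k \<theta> = c * pairing v k \<theta>" for \<theta>
  proof -
    have "pairing (weak_partial i (\<lambda>x. c * u x)) k \<theta> = pairing (\<lambda>x. c * v x) k \<theta>"
      unfolding pairing_def by (rule weak_deriv_pairing_unique[OF w w1]) (rule smooth_cos[OF smooth_phase])
    also have "\<dots> = c * pairing v k \<theta>" using pairing_lincomb[OF Lv Lv, of c 0] by simp
    finally show ?thesis .
  qed
  then have "of_real ((2 * pi) ^ 3) * fcoef (\<lambda>x. of_real (weak_partial i (\<lambda>x. c * u x) x)) k =
      of_real c * (of_real ((2 * pi) ^ 3) * fcoef (\<lambda>x. of_real (v x)) k)"
    unfolding fcoef_pairing[OF L] fcoef_pairing[OF Lv] by (simp add: complex_eq_iff)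
  also have "\<dots> = of_real ((2 * pi) ^ 3) * (of_real c * fcoef (\<lambda>x. of_real (v x)) k)"
    by (simp only: mult_ac)
  finally show "fcoef (\<lambda>x. of_real (weak_partial i (\<lambda>x. c * u x) x)) k = of_real c * (\<i> * of_int (k $ i) * fcoef (\<lambda>x. of_real (u x)) k)"
    unfolding fcoef_weak_deriv[OF assms(1) n v] power_one_right by (rule cancel_cube_volume)
qed

lemma fcoef_lincomb:
  assumes "u \<in> L2" "v \<in> L2"
  shows "fcoef (\<lambda>x. of_real (a * u x + b * v x)) k =
    of_real a * fcoef (\<lambda>x. of_real (u x)) k + of_real b * fcoef (\<lambda>x. of_real (v x)) k"
proof -
  have "of_real ((2 * pi) ^ 3) * fcoef (\<lambda>x. of_real (a * u x + b * v x)) k =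
      of_real ((2 * pi) ^ 3) * (of_real a * fcoef (\<lambda>x. of_real (u x)) k + of_real b * fcoef (\<lambda>x. of_real (v x)) k)"
    unfolding distrib_left mult.left_commute[of _ "of_real a"] mult.left_commute[of _ "of_real b"]
      fcoef_pairing[OF assms(1)] fcoef_pairing[OF assms(2)] fcoef_pairing[OF L2_lincomb[OF assms]]
    by (simp add: complex_eq_iff pairing_lincomb[OF assms])
  then show ?thesis by (rule cancel_cube_volume)
qed

lemma fcoef_diff:
  "u \<in> L2 \<Longrightarrow> v \<in> L2 \<Longrightarrow> fcoef (\<lambda>x. of_real (u x - v x)) k = fcoef (\<lambda>x. of_real (u x)) k - fcoef (\<lambda>x. of_real (v x)) k"
  using fcoef_lincomb[of u v 1 "-1"] by simp

lemma fcoef_cmult: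
  "u \<in> L2 \<Longrightarrow> fcoef (\<lambda>x. of_real (a * u x)) k = of_real a * fcoef (\<lambda>x. of_real (u x)) k"
  using fcoef_lincomb[of u u a 0] by simp

lemma fcoef_cong_AE:
  assumes "u \<in> L2" "v \<in> L2" "AE x in cube_measure. u x = v x"
  shows "fcoef (\<lambda>x. of_real (u x)) k = fcoef (\<lambda>x. of_real (v x)) k"
proof -
  have eq: "pairing u k \<theta> = pairing v k \<theta>" for \<theta>
    unfolding pairing_def
  proof (rule integral_cong_AE)
    show "AE x in cube_measure. u x * cos (kvec k \<bullet> x + \<theta>) = v x * cos (kvec k \<bullet> x + \<theta>)"
      using assms(3) by eventually_elim simp
  qed (intro borel_measurable_integrable L2_integrable_mult_continuous assms continuous_intros)+
  show ?thesis
    by (rule cancel_cube_volume) (simp only: fcoef_pairing[OF assms(1)] fcoef_pairing[OF assms(2)] eq)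
qed

text \<open>The factor 2 counts the real and the imaginary part, 1 + (2 pi)^3 is the constant in the
  bound for pairings, and the denominator is the normalization in \<open>fcoef\<close>.\<close>

definition sobolev_const :: real where
  "sobolev_const = 2 * (1 + (2 * pi) ^ 3) / (2 * pi) ^ 3"

lemma norm_fcoef_le_sobolev_norm:
  assumes "u \<in> L2"
  shows "cmod (fcoef (\<lambda>x. of_real (u x)) k) \<le> sobolev_const * sobolev_norm r u"
proof (rule field_le_epsilon)
  fix e :: real assume e: "e > 0"
  have c: "sobolev_const > 0" unfolding sobolev_const_def by (intro divide_pos_pos mult_pos_pos add_pos_pos) auto
  \<comment> \<open>The bound for pairings needs a number strictly above the norm; the slack amounts
    to e in the end.\<close>
  define d where "d = sobolev_norm r u + e / sobolev_const"
  have lt: "sobolev_norm r u < d" using e c by (simp add: d_def)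
  have "(2 * pi) ^ 3 * cmod (fcoef (\<lambda>x. of_real (u x)) k) = cmod (of_real ((2 * pi) ^ 3) * fcoef (\<lambda>x. of_real (u x)) k)"
    unfolding norm_mult norm_of_real by simp
  also have "\<dots> \<le> \<bar>pairing u k 0\<bar> + \<bar>pairing u k (pi / 2)\<bar>"
    unfolding fcoef_pairing[OF assms] using cmod_le[of "Complex (pairing u k 0) (pairing u k (pi / 2))"] by simp
  also have "\<dots> \<le> d * (1 + (2 * pi) ^ 3) + d * (1 + (2 * pi) ^ 3)"
    by (intro add_mono abs_pairing_le_sobolev_norm[OF assms lt])
  also have "\<dots> = (2 * pi) ^ 3 * (sobolev_const * d)"
    unfolding sobolev_const_def by simp
  finally have "cmod (fcoef (\<lambda>x. of_real (u x)) k) \<le> sobolev_const * d"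
    by (rule mult_left_le_imp_le) simp
  then show "cmod (fcoef (\<lambda>x. of_real (u x)) k) \<le> sobolev_const * sobolev_norm r u + e"
    using c by (simp add: d_def algebra_simps)
qed

section \<open>Coefficients of vector fields and of fields depending on time\<close>

definition vcoef :: "(real^3 \<Rightarrow> real^3) \<Rightarrow> int^3 \<Rightarrow> 3 \<Rightarrow> complex" where
  "vcoef U k i = fcoef (\<lambda>x. of_real (U x $ i)) k"

lemma sobolev_norm_nonneg: "0 \<le> sobolev_norm r u"
  unfolding sobolev_norm_def by (intro real_sqrt_ge_zero add_nonneg_nonneg sum_nonneg) (auto intro: sum_nonneg)

lemma norm_vcoef_le:
  assumes "\<And>i. (\<lambda>x. U x $ i) \<in> L2"
  shows "cmod (vcoef U k i) \<le> sobolev_const * vsobolev_norm r U"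
proof -
  have "cmod (vcoef U k i) \<le> sobolev_const * sobolev_norm r (\<lambda>x. U x $ i)"
    unfolding vcoef_def by (rule norm_fcoef_le_sobolev_norm[OF assms])
  also have "\<dots> \<le> sobolev_const * vsobolev_norm r U"
  proof (rule mult_left_mono)
    have "sobolev_norm r (\<lambda>x. U x $ i) = sqrt ((sobolev_norm r (\<lambda>x. U x $ i))\<^sup>2)"
      by (simp add: sobolev_norm_nonneg)
    also have "\<dots> \<le> vsobolev_norm r U"
      unfolding vsobolev_norm_def by (intro real_sqrt_le_mono member_le_sum) auto
    finally show "sobolev_norm r (\<lambda>x. U x $ i) \<le> vsobolev_norm r U" .
    show "0 \<le> sobolev_const" unfolding sobolev_const_def by simp
  qed
  finally show ?thesis .
qed

lemma vsobolev_per_L2: "U \<in> vsobolev_per r \<Longrightarrow> (\<lambda>x. U x $ i) \<in> L2"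
  unfolding vsobolev_per_def using sobolev_per_L2 by blast

lemma vcoef_diff:
  assumes "\<And>i. (\<lambda>x. U x $ i) \<in> L2" "\<And>i. (\<lambda>x. V x $ i) \<in> L2"
  shows "vcoef (\<lambda>x. U x - V x) k i = vcoef U k i - vcoef V k i"
  unfolding vcoef_def vector_minus_component by (rule fcoef_diff[OF assms])

lemma vcoef_cmult:
  assumes "\<And>i. (\<lambda>x. U x $ i) \<in> L2"
  shows "vcoef (\<lambda>x. c *\<^sub>R U x) k i = of_real c * vcoef U k i"
  unfolding vcoef_def vector_scaleR_component real_scaleR_def by (rule fcoef_cmult[OF assms])

text \<open>By \<open>norm_vcoef_le\<close> a coefficient is controlled by the Sobolev norm, and it
  is linear on L2 fields, so limits in the norm carry over to it. The derivative in time is treated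
  in the same way.\<close>

lemma C1_vcoef_continuous:
  assumes U: "C1_sobolev_per r T U U'"
  shows "continuous_on {0..T} (\<lambda>t. vcoef (U t) k i)"
  unfolding continuous_on
proof
  fix t assume t: "t \<in> {0..T}"
  have L: "(\<lambda>x. U s x $ j) \<in> L2" if "s \<in> {0..T}" for s j
    using U that unfolding C1_sobolev_per_def by (blast intro: vsobolev_per_L2)
  have lim: "((\<lambda>s. vsobolev_norm r (\<lambda>x. U s x - U t x)) \<longlongrightarrow> 0) (at t within {0..T})"
    using U t unfolding C1_sobolev_per_def by blast
  have "((\<lambda>s. vcoef (U s) k i - vcoef (U t) k i) \<longlongrightarrow> 0) (at t within {0..T})"
  proof (rule Lim_null_comparison)
    show "((\<lambda>s. sobolev_const * vsobolev_norm r (\<lambda>x. U s x - U t x)) \<longlongrightarrow> 0) (at t within {0..T})"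
      using tendsto_mult_left[OF lim, of sobolev_const] by simp
    show "\<forall>\<^sub>F s in at t within {0..T}. norm (vcoef (U s) k i - vcoef (U t) k i) \<le> sobolev_const * vsobolev_norm r (\<lambda>x. U s x - U t x)"
      unfolding eventually_at_filter
    proof (intro always_eventually allI impI)
      fix s assume "s \<in> {0..T}"
      then show "norm (vcoef (U s) k i - vcoef (U t) k i) \<le> sobolev_const * vsobolev_norm r (\<lambda>x. U s x - U t x)"
        using norm_vcoef_le[of "\<lambda>x. U s x - U t x" k i r] L L2_diff[OF L L] t by (simp add: vcoef_diff)
    qed
  qed
  then show "((\<lambda>s. vcoef (U s) k i) \<longlongrightarrow> vcoef (U t) k i) (at t within {0..T})"
    by (simp add: Lim_null[symmetric])
qed

lemma C1_vcoef_derivative: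
  assumes U: "C1_sobolev_per r T U U'" and t: "0 < t" "t < T"
  shows "((\<lambda>t. vcoef (U t) k i) has_vector_derivative vcoef (U' t) k i) (at t)"
proof -
  have L: "(\<lambda>x. U s x $ j) \<in> L2" if "s \<in> {0..T}" for s j
    using U that unfolding C1_sobolev_per_def by (blast intro: vsobolev_per_L2)
  have L': "(\<lambda>x. U' t x $ j) \<in> L2" for j
    using U t unfolding C1_sobolev_per_def by (auto intro: vsobolev_per_L2)
  have lim: "((\<lambda>s. vsobolev_norm r (\<lambda>x. (U s x - U t x) /\<^sub>R (s - t) - U' t x)) \<longlongrightarrow> 0) (at t)"
    using U t unfolding C1_sobolev_per_def by auto
  have "((\<lambda>s. (vcoef (U s) k i - vcoef (U t) k i) /\<^sub>R (s - t) - vcoef (U' t) k i) \<longlongrightarrow> 0) (at t)"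
  proof (rule Lim_null_comparison)
    show "((\<lambda>s. sobolev_const * vsobolev_norm r (\<lambda>x. (U s x - U t x) /\<^sub>R (s - t) - U' t x)) \<longlongrightarrow> 0) (at t)"
      using tendsto_mult_left[OF lim, of sobolev_const] by simp
    \<comment> \<open>Outside [0,T] nothing is known about U s, while linearity of the coefficients
      needs square integrable components.\<close>
    have "\<forall>\<^sub>F s in at t. s \<in> {0<..<T}"
      using t by (intro eventually_at_in_open') auto
    then show "\<forall>\<^sub>F s in at t. norm ((vcoef (U s) k i - vcoef (U t) k i) /\<^sub>R (s - t) - vcoef (U' t) k i) \<le>
        sobolev_const * vsobolev_norm r (\<lambda>x. (U s x - U t x) /\<^sub>R (s - t) - U' t x)"
    proof eventually_elim
      case (elim s)
      have Ls: "(\<lambda>x. U s x $ j) \<in> L2" "(\<lambda>x. U t x $ j) \<in> L2" for j using elim t L by auto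
      have Ld: "(\<lambda>x. (U s x - U t x) $ j) \<in> L2" for j using L2_diff[OF Ls] by simp
      have Lq: "(\<lambda>x. ((U s x - U t x) /\<^sub>R (s - t)) $ j) \<in> L2" for j
        using L2_cmult[OF Ld, of "inverse (s - t)"] by simp
      have "(\<lambda>x. ((U s x - U t x) /\<^sub>R (s - t) - U' t x) $ j) \<in> L2" for j
        using L2_diff[OF Lq L'] by simp
      note le = norm_vcoef_le[OF this, of k i r]
      have "vcoef (\<lambda>x. (U s x - U t x) /\<^sub>R (s - t) - U' t x) k i =
          (vcoef (U s) k i - vcoef (U t) k i) /\<^sub>R (s - t) - vcoef (U' t) k i"
        unfolding vcoef_diff[OF Lq L'] vcoef_cmult[OF Ld] vcoef_diff[OF Ls] by (simp add: scaleR_conv_of_real)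
      with le show ?case by simp
    qed
  qed
  then have "((\<lambda>s. norm ((vcoef (U s) k i - vcoef (U t) k i) /\<^sub>R (s - t) - vcoef (U' t) k i)) \<longlongrightarrow> 0) (at t)"
    by (rule tendsto_norm_zero)
  moreover have "\<forall>\<^sub>F s in at t. norm ((vcoef (U s) k i - vcoef (U t) k i) /\<^sub>R (s - t) - vcoef (U' t) k i) =
      norm (vcoef (U s) k i - vcoef (U t) k i - (s - t) *\<^sub>R vcoef (U' t) k i) / norm (s - t)"
    unfolding eventually_at_filter
  proof (intro always_eventually allI impI)
    fix s assume "s \<noteq> t"
    then have "(vcoef (U s) k i - vcoef (U t) k i) /\<^sub>R (s - t) - vcoef (U' t) k i =
        (vcoef (U s) k i - vcoef (U t) k i - (s - t) *\<^sub>R vcoef (U' t) k i) /\<^sub>R (s - t)"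
      by (simp add: scaleR_diff_right)
    then show "norm ((vcoef (U s) k i - vcoef (U t) k i) /\<^sub>R (s - t) - vcoef (U' t) k i) =
      norm (vcoef (U s) k i - vcoef (U t) k i - (s - t) *\<^sub>R vcoef (U' t) k i) / norm (s - t)"
      by (simp add: divide_inverse_commute)
  qed
  ultimately have "((\<lambda>s. norm (vcoef (U s) k i - vcoef (U t) k i - (s - t) *\<^sub>R vcoef (U' t) k i) / norm (s - t)) \<longlongrightarrow> 0) (at t)"
    by (rule Lim_transform_eventually)
  then show ?thesis
    unfolding has_vector_derivative_def has_derivative_iff_norm
    by (auto intro: bounded_linear_scaleR_left)
qed

section \<open>Propagation of the Fourier coefficients\<close>

text \<open>The cross product of a real frequency with a complex vector; i times it is the symbol of
  the curl.\<close>

definition cross :: "real^3 \<Rightarrow> (3 \<Rightarrow> complex) \<Rightarrow> 3 \<Rightarrow> complex" where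
  "cross \<kappa> v i = (if i = 1 then of_real (\<kappa> $ 2) * v 3 - of_real (\<kappa> $ 3) * v 2
     else if i = 2 then of_real (\<kappa> $ 3) * v 1 - of_real (\<kappa> $ 1) * v 3
     else of_real (\<kappa> $ 1) * v 2 - of_real (\<kappa> $ 2) * v 1)"

lemma cross_simps [simp]:
  "cross \<kappa> v 1 = of_real (\<kappa> $ 2) * v 3 - of_real (\<kappa> $ 3) * v 2"
  "cross \<kappa> v 2 = of_real (\<kappa> $ 3) * v 1 - of_real (\<kappa> $ 1) * v 3"
  "cross \<kappa> v 3 = of_real (\<kappa> $ 1) * v 2 - of_real (\<kappa> $ 2) * v 1"
  by (simp_all add: cross_def)

definition cdot :: "real^3 \<Rightarrow> (3 \<Rightarrow> complex) \<Rightarrow> complex" where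
  "cdot \<kappa> v = (\<Sum>i\<in>UNIV. of_real (\<kappa> $ i) * v i)"

lemma cross_cmult: "cross \<kappa> (\<lambda>i. c * v i) i = c * cross \<kappa> v i"
  by (simp add: cross_def algebra_simps)

lemma cdot_cmult: "cdot \<kappa> (\<lambda>i. c * v i) = c * cdot \<kappa> v"
  by (simp add: cdot_def sum_distrib_left algebra_simps)

lemma norm_power2_vec3: "(norm (\<kappa> :: real^3))\<^sup>2 = (\<kappa> $ 1)\<^sup>2 + (\<kappa> $ 2)\<^sup>2 + (\<kappa> $ 3)\<^sup>2"
  unfolding power2_norm_eq_inner by (simp add: inner_vec_def sum_3 power2_eq_square)

lemma cross_cross:
  "cross \<kappa> (cross \<kappa> v) i = of_real (\<kappa> $ i) * cdot \<kappa> v - of_real ((norm \<kappa>)\<^sup>2) * v i"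
  using exhaust_3[of i] unfolding norm_power2_vec3
  by (elim disjE) (simp_all add: cdot_def sum_3 power2_eq_square algebra_simps)

lemma norm_cross_le: "cmod (cross \<kappa> v i) \<le> norm \<kappa> * (\<Sum>j\<in>UNIV. cmod (v j))"
proof -
  have t: "cmod (of_real (\<kappa> $ a) * v b - of_real (\<kappa> $ c) * v d) \<le> norm \<kappa> * cmod (v b) + norm \<kappa> * cmod (v d)" for a b c d
  proof -
    have "cmod (of_real (\<kappa> $ a) * v b - of_real (\<kappa> $ c) * v d) \<le> \<bar>\<kappa> $ a\<bar> * cmod (v b) + \<bar>\<kappa> $ c\<bar> * cmod (v d)"
      using norm_triangle_ineq4[of "of_real (\<kappa> $ a) * v b" "of_real (\<kappa> $ c) * v d"] by (simp add: norm_mult)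
    also have "\<dots> \<le> norm \<kappa> * cmod (v b) + norm \<kappa> * cmod (v d)"
      using component_le_norm_cart by (intro add_mono mult_right_mono) auto
    finally show ?thesis .
  qed
  have nn: "0 \<le> norm \<kappa> * cmod (v j)" for j by simp
  show ?thesis
    using exhaust_3[of i] t[of 2 3 3 2] t[of 3 1 1 3] t[of 1 2 2 1] nn[of 1] nn[of 2] nn[of 3]
    by (elim disjE) (simp only: cross_simps sum_3 distrib_left; linarith)+
qed

text \<open>For v orthogonal to \<kappa> this shows that the curl determines |\<kappa>| |v|, the
  source of the extra derivative.\<close>

lemma lagrange_identity_complex:
  "(\<Sum>i\<in>UNIV. (cmod (cross \<kappa> v i))\<^sup>2) = (norm \<kappa>)\<^sup>2 * (\<Sum>i\<in>UNIV. (cmod (v i))\<^sup>2) - (cmod (cdot \<kappa> v))\<^sup>2"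
  unfolding cmod_power2 norm_power2_vec3 cdot_def
  by (simp add: sum_3 power2_eq_square algebra_simps)

text \<open>At frequency 0 the quotients below are 0 instead of their limits; they multiply terms that vanish there.\<close>

definition propC :: "real^3 \<Rightarrow> real \<Rightarrow> (3 \<Rightarrow> complex) \<Rightarrow> 3 \<Rightarrow> complex" where
  "propC \<kappa> s v i = v i + of_real ((cos (s * norm \<kappa>) - 1) / (norm \<kappa>)\<^sup>2) *
     (of_real ((norm \<kappa>)\<^sup>2) * v i - of_real (\<kappa> $ i) * cdot \<kappa> v)"

definition propS :: "real^3 \<Rightarrow> real \<Rightarrow> (3 \<Rightarrow> complex) \<Rightarrow> 3 \<Rightarrow> complex" where
  "propS \<kappa> s v i = \<i> * of_real (sin (s * norm \<kappa>) / norm \<kappa>) * cross \<kappa> v i"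

lemma propC_cdot_0:
  assumes "cdot \<kappa> v = 0"
  shows "propC \<kappa> s v i = of_real (cos (s * norm \<kappa>)) * v i"
proof (cases "norm \<kappa> = 0")
  case False
  have eq: "complex_of_real (c / (norm \<kappa>)\<^sup>2) * (of_real ((norm \<kappa>)\<^sup>2) * v i) = of_real c * v i" for c
    using False by simp
  show ?thesis
    unfolding propC_def assms mult_zero_right diff_0_right eq by (simp add: left_diff_distrib)
qed (use assms in \<open>simp add: propC_def\<close>)

text \<open>The bound is also used at aliased frequencies, where \<open>cdot\<close> need not
  vanish. The constant is 1 + 2 * 2: the first 1 for v itself, |cos - 1| <= 2, and a double cross
  product whose entries are at most 2 |\<kappa>|^2 times the sum of the moduli.\<close>

lemma norm_propC_le: "cmod (propC \<kappa> s v i) \<le> 5 * (\<Sum>j\<in>UNIV. cmod (v j))"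
proof -
  define S where "S = (\<Sum>j\<in>UNIV. cmod (v j))"
  have vi: "cmod (v j) \<le> S" for j unfolding S_def by (rule member_le_sum) auto
  have S0: "0 \<le> S" unfolding S_def by (rule sum_nonneg) auto
  have "cmod (cdot \<kappa> v) \<le> (\<Sum>j\<in>UNIV. norm \<kappa> * cmod (v j))"
    unfolding cdot_def using component_le_norm_cart[of \<kappa>]
    by (intro sum_norm_le) (simp add: norm_mult mult_right_mono)
  then have cd: "cmod (cdot \<kappa> v) \<le> norm \<kappa> * S" by (simp add: S_def sum_distrib_left)
  have "cmod (of_real (\<kappa> $ i) * cdot \<kappa> v) \<le> norm \<kappa> * (norm \<kappa> * S)"
    unfolding norm_mult norm_of_real using component_le_norm_cart[of \<kappa>] cd by (intro mult_mono) auto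
  moreover have "cmod (of_real ((norm \<kappa>)\<^sup>2) * v i) \<le> (norm \<kappa>)\<^sup>2 * S"
    unfolding norm_mult norm_of_real using vi by (simp add: mult_left_mono)
  ultimately have 1: "cmod (of_real ((norm \<kappa>)\<^sup>2) * v i - of_real (\<kappa> $ i) * cdot \<kappa> v) \<le> (norm \<kappa>)\<^sup>2 * (2 * S)"
    using norm_triangle_ineq4[of "of_real ((norm \<kappa>)\<^sup>2) * v i" "of_real (\<kappa> $ i) * cdot \<kappa> v"]
    by (simp add: power2_eq_square algebra_simps)
  have c2: "\<bar>cos (s * norm \<kappa>) - 1\<bar> \<le> 2" using cos_ge_minus_one[of "s * norm \<kappa>"] cos_le_one[of "s * norm \<kappa>"] by linarith
  have "cmod (of_real ((cos (s * norm \<kappa>) - 1) / (norm \<kappa>)\<^sup>2) *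
     (of_real ((norm \<kappa>)\<^sup>2) * v i - of_real (\<kappa> $ i) * cdot \<kappa> v)) \<le> \<bar>cos (s * norm \<kappa>) - 1\<bar> / (norm \<kappa>)\<^sup>2 * ((norm \<kappa>)\<^sup>2 * (2 * S))"
  proof -
    have "\<bar>(norm \<kappa>)\<^sup>2\<bar> = (norm \<kappa>)\<^sup>2" by simp
    then show ?thesis
      unfolding norm_mult norm_of_real abs_divide by (simp only:) (intro mult_left_mono 1, simp)
  qed
  also have "\<dots> \<le> 2 * (2 * S)"
  proof (cases "norm \<kappa> = 0")
    case False
    then have "\<bar>cos (s * norm \<kappa>) - 1\<bar> / (norm \<kappa>)\<^sup>2 * ((norm \<kappa>)\<^sup>2 * (2 * S)) = \<bar>cos (s * norm \<kappa>) - 1\<bar> * (2 * S)" by simp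
    then show ?thesis using c2 S0 by (simp only:) (intro mult_right_mono, auto)
  qed (use S0 in simp)
  finally show ?thesis
    using norm_triangle_ineq[of "v i" "of_real ((cos (s * norm \<kappa>) - 1) / (norm \<kappa>)\<^sup>2) *
     (of_real ((norm \<kappa>)\<^sup>2) * v i - of_real (\<kappa> $ i) * cdot \<kappa> v)"] vi[of i]
    unfolding propC_def S_def[symmetric] by linarith
qed

lemma norm_propS_le: "cmod (propS \<kappa> s v i) \<le> (\<Sum>j\<in>UNIV. cmod (v j))"
proof -
  define S where "S = (\<Sum>j\<in>UNIV. cmod (v j))"
  have S0: "0 \<le> S" unfolding S_def by (rule sum_nonneg) auto
  have "cmod (propS \<kappa> s v i) \<le> \<bar>sin (s * norm \<kappa>)\<bar> / norm \<kappa> * (norm \<kappa> * S)"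
    unfolding propS_def norm_mult norm_of_real abs_divide S_def norm_ii mult_1 abs_norm_cancel
    by (intro mult_left_mono norm_cross_le) simp
  also have "\<dots> \<le> 1 * S"
  proof (cases "norm \<kappa> = 0")
    case False
    then have "\<bar>sin (s * norm \<kappa>)\<bar> / norm \<kappa> * (norm \<kappa> * S) = \<bar>sin (s * norm \<kappa>)\<bar> * S" by simp
    then show ?thesis using S0 abs_sin_le_one by (simp only:) (intro mult_right_mono, auto)
  qed (use S0 in simp)
  finally show ?thesis by (simp add: S_def)
qed

text \<open>A constant of motion is exhibited instead of a matrix exponential. Both a < b and b < a
  are allowed, so a state at an interior time can be carried back to time 0.\<close>

lemma maxwell_mode_solution:
  fixes h e :: "real \<Rightarrow> 3 \<Rightarrow> complex"
  assumes pos: "\<mu> > 0" "\<epsilon> > 0"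
    and ch: "\<And>i. continuous_on {0..T} (\<lambda>t. h t i)" and ce: "\<And>i. continuous_on {0..T} (\<lambda>t. e t i)"
    and dh: "\<And>t i. 0 < t \<Longrightarrow> t < T \<Longrightarrow> ((\<lambda>t. h t i) has_vector_derivative - (of_real (1 / \<mu>) * (\<i> * cross \<kappa> (e t) i))) (at t)"
    and de: "\<And>t i. 0 < t \<Longrightarrow> t < T \<Longrightarrow> ((\<lambda>t. e t i) has_vector_derivative of_real (1 / \<epsilon>) * (\<i> * cross \<kappa> (h t) i)) (at t)"
    and div: "\<And>t. t \<in> {0..T} \<Longrightarrow> cdot \<kappa> (h t) = 0"
    and ab: "a \<in> {0..T}" "b \<in> {0..T}"
  shows "h b i = propC \<kappa> ((b - a) / sqrt (\<mu> * \<epsilon>)) (h a) i - of_real (sqrt \<epsilon> / sqrt \<mu>) * propS \<kappa> ((b - a) / sqrt (\<mu> * \<epsilon>)) (e a) i"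
proof -
  define n where "n = norm \<kappa>"
  define w where "w = 1 / sqrt (\<mu> * \<epsilon>)"
  define \<rho> where "\<rho> = sqrt \<epsilon> / sqrt \<mu>"
  have wr: "w * \<rho> = 1 / \<mu>" "\<rho> / \<epsilon> = w"
    using pos by (simp_all add: w_def \<rho>_def real_sqrt_mult field_simps)
  define X where "X = (\<lambda>t. cross \<kappa> (e t) i)"
  \<comment> \<open>propagating from t to b gives a quantity that does not depend on t\<close>
  define y where "y = (\<lambda>t. of_real (cos (w * n * (b - t))) * h t i - of_real \<rho> * (\<i> * of_real (sin (w * n * (b - t)) / n) * X t))"
  have cX: "continuous_on {0..T} X"
    unfolding X_def cross_def using ce by (intro continuous_intros | cases "i = 1"; cases "i = 2"; simp add: continuous_intros)+
  have cy: "continuous_on {0..T} y"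
    unfolding y_def using ch cX by (cases "n = 0") (auto intro!: continuous_intros)
  \<comment> \<open>Since h is orthogonal to \<kappa>, the double cross product reduces to - n^2 h,
    and h and X together form a harmonic oscillator.\<close>
  have dX: "(X has_vector_derivative of_real (1 / \<epsilon>) * (\<i> * (- (of_real (n\<^sup>2) * h t i)))) (at t)" if t: "0 < t" "t < T" for t
  proof -
    have "(X has_vector_derivative cross \<kappa> (\<lambda>j. of_real (1 / \<epsilon>) * (\<i> * cross \<kappa> (h t) j)) i) (at t)"
      unfolding X_def cross_def[of \<kappa> _ i]
      using exhaust_3[of i]
      by (elim disjE) (simp_all only: if_True if_False refl, (auto intro!: derivative_eq_intros de t)+)
    also have "cross \<kappa> (\<lambda>j. of_real (1 / \<epsilon>) * (\<i> * cross \<kappa> (h t) j)) i = of_real (1 / \<epsilon>) * (\<i> * cross \<kappa> (cross \<kappa> (h t)) i)"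
      by (simp only: cross_cmult)
    also have "cross \<kappa> (cross \<kappa> (h t)) i = - (of_real (n\<^sup>2) * h t i)"
      using div[of t] t by (simp add: cross_cross n_def)
    finally show ?thesis .
  qed
  have dy: "(y has_vector_derivative 0) (at t)" if t: "0 < t" "t < T" for t
  proof -
    let ?\<theta> = "w * n * (b - t)"
    have dc: "((\<lambda>t. complex_of_real (cos (w * n * (b - t)))) has_vector_derivative of_real (w * n * sin ?\<theta>)) (at t)"
      by (auto intro!: derivative_eq_intros has_vector_derivative_of_real simp flip: has_real_derivative_iff_has_vector_derivative)
    \<comment> \<open>For n = 0 the quotient is constantly 0 and so is its derivative; this does no
      harm, because X vanishes in that case.\<close>
    have ds: "((\<lambda>t. complex_of_real (sin (w * n * (b - t)) / n)) has_vector_derivative of_real (- (w * cos ?\<theta>) * (if n = 0 then 0 else 1))) (at t)"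
      by (cases "n = 0") (auto intro!: derivative_eq_intros has_vector_derivative_of_real simp flip: has_real_derivative_iff_has_vector_derivative)
    have dh': "((\<lambda>t. h t i) has_vector_derivative - (of_real (1 / \<mu>) * (\<i> * X t))) (at t)"
      using dh[OF t, of i] by (simp only: X_def)
    have X0: "X t = 0" if "n = 0" using that by (simp add: X_def n_def cross_def)
    have "(y has_vector_derivative
        (of_real (cos ?\<theta>) * (- (of_real (1 / \<mu>) * (\<i> * X t))) + of_real (w * n * sin ?\<theta>) * h t i) -
        of_real \<rho> * (\<i> * of_real (sin ?\<theta> / n) * (of_real (1 / \<epsilon>) * (\<i> * (- (of_real (n\<^sup>2) * h t i))))
          + (\<i> * of_real (- (w * cos ?\<theta>) * (if n = 0 then 0 else 1))) * X t)) (at t)"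
      unfolding y_def
      by (intro has_vector_derivative_diff has_vector_derivative_mult dc dX t has_vector_derivative_mult_right ds
        dh')
    also have "(of_real (cos ?\<theta>) * (- (of_real (1 / \<mu>) * (\<i> * X t))) + of_real (w * n * sin ?\<theta>) * h t i) -
        of_real \<rho> * (\<i> * of_real (sin ?\<theta> / n) * (of_real (1 / \<epsilon>) * (\<i> * (- (of_real (n\<^sup>2) * h t i))))
          + (\<i> * of_real (- (w * cos ?\<theta>) * (if n = 0 then 0 else 1))) * X t) = 0"
    proof (cases "n = 0")
      case True
      then show ?thesis using X0 by simp
    next
      case False
      have "sin ?\<theta> / n * n\<^sup>2 = n * sin ?\<theta>" using False by (simp add: power2_eq_square)
      then have s: "of_real \<rho> * (\<i> * of_real (sin ?\<theta> / n) * (of_real (1 / \<epsilon>) * (\<i> * (- (of_real (n\<^sup>2) * h t i))))) =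
          of_real (\<rho> / \<epsilon> * (n * sin ?\<theta>)) * h t i"
        by (simp add: complex_eq_iff) (simp add: mult_ac power2_eq_square False)
      have c: "of_real \<rho> * ((\<i> * of_real (- (w * cos ?\<theta>) * (if n = 0 then 0 else 1))) * X t) =
         - (of_real (cos ?\<theta> * (w * \<rho>)) * (\<i> * X t))"
        using False by (simp add: mult_ac)
      show ?thesis
        unfolding distrib_left[of "complex_of_real \<rho>"] s c wr by (simp add: mult_ac)
    qed
    finally show ?thesis .
  qed
  \<comment> \<open>The derivative is known at interior times only; continuity on the closed
    interval allows the two end points as exceptional set.\<close>
  have "y t = y 0" if "t \<in> {0..T}" for t
    by (rule has_derivative_zero_unique_strong_interval[of "{0, T}" 0 T y])
       (use cy that dy in \<open>auto simp: has_vector_derivative_def intro: has_derivative_at_withinI\<close>)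
  then have "y b = y a" using ab by metis
  moreover have "y b = h b i" by (simp add: y_def)
  moreover have "y a = propC \<kappa> ((b - a) / sqrt (\<mu> * \<epsilon>)) (h a) i - of_real (sqrt \<epsilon> / sqrt \<mu>) * propS \<kappa> ((b - a) / sqrt (\<mu> * \<epsilon>)) (e a) i"
  proof -
    have "w * n * (b - a) = (b - a) / sqrt (\<mu> * \<epsilon>) * norm \<kappa>" by (simp add: w_def n_def)
    then show ?thesis
      unfolding y_def propC_cdot_0[OF div[OF ab(1)]] propS_def X_def \<rho>_def[symmetric] n_def[symmetric] by (simp only:)
  qed
  ultimately show ?thesis by simp
qed

section \<open>Curl, divergence and the gain of one derivative\<close>

lemma vcoef_curl:
  assumes F: "F \<in> vsobolev_per r" and r: "r \<ge> 1"
  shows "vcoef (curl F) k i = \<i> * cross (kvec k) (vcoef F k) i" and "(\<lambda>x. curl F x $ i) \<in> L2"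
proof -
  have S: "(\<lambda>x. F x $ j) \<in> sobolev_per r" for j using F by (simp add: vsobolev_per_def)
  note W = fcoef_weak_partial[OF S r]
  have c: "(\<lambda>x. curl F x $ 1) = (\<lambda>x. weak_partial 2 (\<lambda>y. F y $ 3) x - weak_partial 3 (\<lambda>y. F y $ 2) x)"
    "(\<lambda>x. curl F x $ 2) = (\<lambda>x. weak_partial 3 (\<lambda>y. F y $ 1) x - weak_partial 1 (\<lambda>y. F y $ 3) x)"
    "(\<lambda>x. curl F x $ 3) = (\<lambda>x. weak_partial 1 (\<lambda>y. F y $ 2) x - weak_partial 2 (\<lambda>y. F y $ 1) x)"
    by (simp_all add: curl_def fun_eq_iff)
  show "(\<lambda>x. curl F x $ i) \<in> L2"
    using exhaust_3[of i] by (elim disjE) (simp_all only: c L2_diff W(2))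
  have "fcoef (\<lambda>x. of_real (weak_partial a (\<lambda>y. F y $ b) x - weak_partial c (\<lambda>y. F y $ d) x)) k =
      \<i> * (of_real (kvec k $ a) * vcoef F k b - of_real (kvec k $ c) * vcoef F k d)" for a b c d
    unfolding fcoef_diff[OF W(2) W(2)] W(1) by (simp add: vcoef_def algebra_simps)
  then show "vcoef (curl F) k i = \<i> * cross (kvec k) (vcoef F k) i"
    using exhaust_3[of i] c unfolding vcoef_def[of "curl F"] fun_eq_iff
    by (elim disjE) (simp_all only: cross_simps)
qed

lemma cdot_vcoef_divergence:
  assumes F: "F \<in> vsobolev_per r" and r: "r \<ge> 1" and c: "c \<noteq> 0"
    and div: "AE x in cube_measure. divergence (\<lambda>y. c *\<^sub>R F y) x = 0"
  shows "cdot (kvec k) (vcoef F k) = 0"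
proof -
  have S: "(\<lambda>x. F x $ j) \<in> sobolev_per r" for j using F by (simp add: vsobolev_per_def)
  note W = fcoef_weak_partial_cmult[OF S r]
  define d where "d = (\<lambda>i x. weak_partial i (\<lambda>y. c * F y $ i) x)"
  have dL: "d i \<in> L2" for i unfolding d_def by (rule W(2))
  have dF: "fcoef (\<lambda>x. of_real (d i x)) k = of_real c * (\<i> * of_int (k $ i) * vcoef F k i)" for i
    unfolding d_def vcoef_def by (rule W(1))
  have sum: "divergence (\<lambda>y. c *\<^sub>R F y) = (\<lambda>x. (1 * d 1 x + 1 * d 2 x) + 1 * d 3 x)"
    by (simp add: divergence_def d_def sum_3 fun_eq_iff)
  have L12: "(\<lambda>x. 1 * d 1 x + 1 * d 2 x) \<in> L2" by (intro L2_lincomb dL)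
  have "fcoef (\<lambda>x. of_real ((1 * d 1 x + 1 * d 2 x) + 1 * d 3 x)) k = fcoef (\<lambda>x. of_real 0) k"
  proof (rule fcoef_cong_AE)
    show "(\<lambda>x. 1 * d 1 x + 1 * d 2 x + 1 * d 3 x) \<in> L2"
      using L2_lincomb[OF L12 dL, of 1 1 3] by simp
    show "(\<lambda>x. 0) \<in> L2" by (intro continuous_L2 continuous_intros)
    show "AE x in cube_measure. 1 * d 1 x + 1 * d 2 x + 1 * d 3 x = 0"
      using div unfolding sum .
  qed
  also have "fcoef (\<lambda>x. of_real 0) k = 0" by (simp add: fcoef_def)
  also have "fcoef (\<lambda>x. of_real ((1 * d 1 x + 1 * d 2 x) + 1 * d 3 x)) k = of_real c * \<i> * cdot (kvec k) (vcoef F k)"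
    using fcoef_lincomb[OF L12 dL, of 1 1 3 k] fcoef_lincomb[OF dL dL, of 1 1 1 2 k]
    by (simp add: dF cdot_def sum_3 algebra_simps)
  finally show ?thesis using c by simp
qed

definition l1 :: "int^3 \<Rightarrow> real" where
  "l1 k = (\<Sum>i\<in>UNIV. \<bar>real_of_int (k $ i)\<bar>)"

lemma l1_ge: "\<bar>real_of_int (k $ i)\<bar> \<le> l1 k" and l1_nonneg: "0 \<le> l1 k"
  unfolding l1_def by (auto intro: member_le_sum sum_nonneg)

text \<open>Let k_j be an entry of largest modulus. Then l1 k <= 3 |k_j|, which yields the powers of
  9, and one factor |k_j|^2 <= |k|^2 is absorbed by the Lagrange identity, which for e orthogonal to
  k says that |k|^2 |e|^2 is the squared length of the cross product.\<close>

lemma l1_power_le_cross: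
  assumes "cdot (kvec k) e = 0"
  shows "l1 k ^ (2 * Suc m) * (cmod (e i))\<^sup>2 \<le>
    9 ^ Suc m * (\<Sum>j\<in>UNIV. \<Sum>l\<in>UNIV. \<bar>real_of_int (k $ j)\<bar> ^ (2 * m) * (cmod (cross (kvec k) e l))\<^sup>2)"
proof -
  obtain j where j: "\<And>i. \<bar>real_of_int (k $ i)\<bar> \<le> \<bar>real_of_int (k $ j)\<bar>"
  proof -
    have "\<exists>j. \<forall>i. \<bar>real_of_int (k $ i)\<bar> \<le> \<bar>real_of_int (k $ j)\<bar>"
    proof -
      let ?A = "range (\<lambda>i. \<bar>real_of_int (k $ i)\<bar>)"
      have "Max ?A \<in> ?A" by (rule Max_in) auto
      then obtain j where j: "Max ?A = \<bar>real_of_int (k $ j)\<bar>" by (elim imageE)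
      have "\<bar>real_of_int (k $ i)\<bar> \<le> Max ?A" for i by (rule Max_ge) auto
      then show ?thesis unfolding j by (intro exI[of _ j] allI)
    qed
    then show thesis using that by blast
  qed
  let ?a = "\<bar>real_of_int (k $ j)\<bar>"
  have "l1 k \<le> (\<Sum>i\<in>(UNIV::3 set). ?a)" unfolding l1_def by (intro sum_mono j)
  then have "l1 k ^ (2 * Suc m) \<le> (3 * ?a) ^ (2 * Suc m)" by (intro power_mono l1_nonneg) simp
  also have "\<dots> = 9 ^ Suc m * (?a ^ (2 * m) * ?a\<^sup>2)"
    by (simp add: power_mult_distrib power_mult power2_eq_square)
  finally have "l1 k ^ (2 * Suc m) * (cmod (e i))\<^sup>2 \<le> 9 ^ Suc m * (?a ^ (2 * m) * ?a\<^sup>2) * (cmod (e i))\<^sup>2"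
    by (rule mult_right_mono) simp
  also have "\<dots> = 9 ^ Suc m * (?a ^ (2 * m) * (?a\<^sup>2 * (cmod (e i))\<^sup>2))" by (simp only: mult.assoc)
  also have "\<dots> \<le> 9 ^ Suc m * (?a ^ (2 * m) * (\<Sum>l\<in>UNIV. (cmod (cross (kvec k) e l))\<^sup>2))"
  proof (intro mult_left_mono)
    have "?a\<^sup>2 \<le> (norm (kvec k))\<^sup>2"
      using component_le_norm_cart[of "kvec k" j] by (intro power_mono) auto
    moreover have "(cmod (e i))\<^sup>2 \<le> (\<Sum>i\<in>UNIV. (cmod (e i))\<^sup>2)" by (rule member_le_sum) auto
    ultimately have "?a\<^sup>2 * (cmod (e i))\<^sup>2 \<le> (norm (kvec k))\<^sup>2 * (\<Sum>i\<in>UNIV. (cmod (e i))\<^sup>2)"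
      by (rule mult_mono) auto
    then show "?a\<^sup>2 * (cmod (e i))\<^sup>2 \<le> (\<Sum>l\<in>UNIV. (cmod (cross (kvec k) e l))\<^sup>2)"
      by (simp add: lagrange_identity_complex assms)
  qed auto
  also have "\<dots> \<le> 9 ^ Suc m * (\<Sum>j\<in>UNIV. \<bar>real_of_int (k $ j)\<bar> ^ (2 * m) * (\<Sum>l\<in>UNIV. (cmod (cross (kvec k) e l))\<^sup>2))"
    by (intro mult_left_mono member_le_sum[of j UNIV "\<lambda>j. \<bar>real_of_int (k $ j)\<bar> ^ (2 * m) * _"]) (auto intro!: mult_nonneg_nonneg sum_nonneg)
  finally show ?thesis by (simp only: sum_distrib_left)
qed

text \<open>Sobolev regularity of integer order M, read off the coefficients. For M > 0 the
  coefficient at frequency 0 has weight 0 and is not controlled; the error has no component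
  there.\<close>

definition weighted_bounded :: "nat \<Rightarrow> (int^3 \<Rightarrow> complex) \<Rightarrow> bool" where
  "weighted_bounded M c \<longleftrightarrow> (\<exists>B. \<forall>F. finite F \<longrightarrow> (\<Sum>k\<in>F. l1 k ^ (2 * M) * (cmod (c k))\<^sup>2) \<le> B)"

text \<open>V stands for a time derivative, which by Maxwell's equations is a multiple of the curl
  of the other field. Its pure derivatives of order floor r are square integrable, and
  \<open>l1_power_le_cross\<close> turns this into order floor r + 1 for e.\<close>

lemma weighted_bounded_curl:
  assumes V: "V \<in> vsobolev_per r" and c: "c > 0"
    and eq: "\<And>k i. cmod (vcoef V k i) = c * cmod (cross (kvec k) (e k) i)"
    and div: "\<And>k. cdot (kvec k) (e k) = 0"
  shows "weighted_bounded (Suc (nat \<lfloor>r\<rfloor>)) (\<lambda>k. e k i)"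
proof -
  let ?m = "nat \<lfloor>r\<rfloor>"
  have "\<exists>B. \<forall>F. finite F \<longrightarrow> (\<Sum>k\<in>F. \<bar>real_of_int (k $ j)\<bar> ^ (2 * ?m) * (cmod (vcoef V k l))\<^sup>2) \<le> B" for j l
  proof -
    have "(\<lambda>x. V x $ l) \<in> sobolev_per r" using V by (simp add: vsobolev_per_def)
    from sobolev_per_fcoef_bound[OF this, of j] show ?thesis unfolding vcoef_def by blast
  qed
  then have "\<forall>p. \<exists>B. \<forall>F. finite F \<longrightarrow> (\<Sum>k\<in>F. \<bar>real_of_int (k $ fst p)\<bar> ^ (2 * ?m) * (cmod (vcoef V k (snd p)))\<^sup>2) \<le> B"
    by (intro allI)
  from choice[OF this] obtain B where "\<forall>p F. finite F \<longrightarrow>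
      (\<Sum>k\<in>F. \<bar>real_of_int (k $ fst p)\<bar> ^ (2 * ?m) * (cmod (vcoef V k (snd p)))\<^sup>2) \<le> B p"
    by (elim exE)
  from this[rule_format, of _ "(j, l)" for j l, unfolded fst_conv snd_conv]
  have B: "\<And>j l F. finite F \<Longrightarrow> (\<Sum>k\<in>F. \<bar>real_of_int (k $ j)\<bar> ^ (2 * ?m) * (cmod (vcoef V k l))\<^sup>2) \<le> B (j, l)" .
  show ?thesis unfolding weighted_bounded_def
  proof (intro exI allI impI)
    fix F :: "(int^3) set" assume F: "finite F"
    have "(\<Sum>k\<in>F. l1 k ^ (2 * Suc ?m) * (cmod (e k i))\<^sup>2) \<le>
        (\<Sum>k\<in>F. 9 ^ Suc ?m * (\<Sum>j\<in>UNIV. \<Sum>l\<in>UNIV. \<bar>real_of_int (k $ j)\<bar> ^ (2 * ?m) * ((cmod (vcoef V k l))\<^sup>2 / c\<^sup>2)))"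
    proof (rule sum_mono)
      fix k
      have "(cmod (vcoef V k l))\<^sup>2 / c\<^sup>2 = (cmod (cross (kvec k) (e k) l))\<^sup>2" for l
        using c by (simp add: eq power_mult_distrib)
      then show "l1 k ^ (2 * Suc ?m) * (cmod (e k i))\<^sup>2 \<le>
          9 ^ Suc ?m * (\<Sum>j\<in>UNIV. \<Sum>l\<in>UNIV. \<bar>real_of_int (k $ j)\<bar> ^ (2 * ?m) * ((cmod (vcoef V k l))\<^sup>2 / c\<^sup>2))"
        using l1_power_le_cross[OF div, of k ?m i] by (simp only:)
    qed
    also have "\<dots> = 9 ^ Suc ?m / c\<^sup>2 * (\<Sum>j\<in>UNIV. \<Sum>l\<in>UNIV. \<Sum>k\<in>F. \<bar>real_of_int (k $ j)\<bar> ^ (2 * ?m) * (cmod (vcoef V k l))\<^sup>2)"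
    proof -
      have "(\<Sum>k\<in>F. 9 ^ Suc ?m * (\<Sum>j\<in>UNIV. \<Sum>l\<in>UNIV. \<bar>real_of_int (k $ j)\<bar> ^ (2 * ?m) * ((cmod (vcoef V k l))\<^sup>2 / c\<^sup>2))) =
          (\<Sum>k\<in>F. 9 ^ Suc ?m / c\<^sup>2 * (\<Sum>j\<in>UNIV. \<Sum>l\<in>UNIV. \<bar>real_of_int (k $ j)\<bar> ^ (2 * ?m) * (cmod (vcoef V k l))\<^sup>2))"
        by (simp only: times_divide_eq_right times_divide_eq_left sum_divide_distrib[symmetric])
      also have "\<dots> = 9 ^ Suc ?m / c\<^sup>2 * (\<Sum>k\<in>F. \<Sum>j\<in>UNIV. \<Sum>l\<in>UNIV. \<bar>real_of_int (k $ j)\<bar> ^ (2 * ?m) * (cmod (vcoef V k l))\<^sup>2)"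
        by (simp only: sum_distrib_left)
      also have "(\<Sum>k\<in>F. \<Sum>j\<in>UNIV. \<Sum>l\<in>UNIV. \<bar>real_of_int (k $ j)\<bar> ^ (2 * ?m) * (cmod (vcoef V k l))\<^sup>2) =
          (\<Sum>j\<in>UNIV. \<Sum>l\<in>UNIV. \<Sum>k\<in>F. \<bar>real_of_int (k $ j)\<bar> ^ (2 * ?m) * (cmod (vcoef V k l))\<^sup>2)"
        by (subst sum.swap, intro sum.cong refl, rule sum.swap)
      finally show ?thesis .
    qed
    also have "\<dots> \<le> 9 ^ Suc ?m / c\<^sup>2 * (\<Sum>j\<in>UNIV. \<Sum>l\<in>UNIV. B (j, l))"
      by (intro mult_left_mono sum_mono B F) auto
    finally show "(\<Sum>k\<in>F. l1 k ^ (2 * Suc ?m) * (cmod (e k i))\<^sup>2) \<le> 9 ^ Suc ?m / c\<^sup>2 * (\<Sum>j\<in>UNIV. \<Sum>l\<in>UNIV. B (j, l))" .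
  qed
qed

lemma power2_sum3_le: "(\<Sum>j\<in>UNIV. a j)\<^sup>2 \<le> 3 * (\<Sum>j\<in>(UNIV::3 set). (a j)\<^sup>2)" for a :: "3 \<Rightarrow> real"
proof -
  have "0 \<le> (a 1 - a 2)\<^sup>2 + (a 1 - a 3)\<^sup>2 + (a 2 - a 3)\<^sup>2" by simp
  then show ?thesis by (simp add: sum_3 power2_eq_square algebra_simps)
qed

text \<open>150 = 2 * 25 * 3 and 6 = 2 * 3: the 2 comes from squaring a sum of two terms, 25 and 1
  are the squared bounds of \<open>propC\<close> and \<open>propS\<close>, and 3 is the number of
  components.\<close>

lemma norm_prop_power2_le:
  "(cmod (propC \<kappa> s h i - of_real \<rho> * propS \<kappa> s e i))\<^sup>2 \<le>
    150 * (\<Sum>j\<in>UNIV. (cmod (h j))\<^sup>2) + 6 * \<rho>\<^sup>2 * (\<Sum>j\<in>UNIV. (cmod (e j))\<^sup>2)"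
proof -
  let ?a = "\<Sum>j\<in>UNIV. cmod (h j)" and ?b = "\<Sum>j\<in>UNIV. cmod (e j)"
  have "cmod (propC \<kappa> s h i - of_real \<rho> * propS \<kappa> s e i) \<le> cmod (propC \<kappa> s h i) + \<bar>\<rho>\<bar> * cmod (propS \<kappa> s e i)"
    using norm_triangle_ineq4[of "propC \<kappa> s h i" "of_real \<rho> * propS \<kappa> s e i"] by (simp add: norm_mult)
  also have "\<dots> \<le> 5 * ?a + \<bar>\<rho>\<bar> * ?b"
    by (intro add_mono norm_propC_le mult_left_mono norm_propS_le abs_ge_zero)
  finally have "(cmod (propC \<kappa> s h i - of_real \<rho> * propS \<kappa> s e i))\<^sup>2 \<le> (5 * ?a + \<bar>\<rho>\<bar> * ?b)\<^sup>2"
    by (intro power_mono) auto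
  also have "\<dots> \<le> 2 * (5 * ?a)\<^sup>2 + 2 * (\<bar>\<rho>\<bar> * ?b)\<^sup>2"
    using sum_squares_bound[of "5 * ?a" "\<bar>\<rho>\<bar> * ?b"] by (simp add: power2_sum)
  also have "\<dots> = 50 * ?a\<^sup>2 + 2 * \<rho>\<^sup>2 * ?b\<^sup>2" by (simp add: power_mult_distrib)
  also have "\<dots> \<le> 50 * (3 * (\<Sum>j\<in>UNIV. (cmod (h j))\<^sup>2)) + 2 * \<rho>\<^sup>2 * (3 * (\<Sum>j\<in>UNIV. (cmod (e j))\<^sup>2))"
    by (intro add_mono mult_left_mono power2_sum3_le) auto
  finally show ?thesis by simp
qed

text \<open>The bound in \<open>norm_prop_power2_le\<close> contains neither the frequency nor s, so
  it can be multiplied by the weight and summed.\<close>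

lemma weighted_bounded_prop:
  assumes h: "\<And>i. weighted_bounded M (\<lambda>k. h k i)" and e: "\<And>i. weighted_bounded M (\<lambda>k. e k i)"
  shows "weighted_bounded M (\<lambda>k. propC (\<kappa> k) s (h k) i - of_real \<rho> * propS (\<kappa> k) s (e k) i)"
proof -
  obtain B where B': "\<forall>j F. finite F \<longrightarrow> (\<Sum>k\<in>F. l1 k ^ (2 * M) * (cmod (h k j))\<^sup>2) \<le> B j"
  proof -
    have "\<forall>j. \<exists>B. \<forall>F. finite F \<longrightarrow> (\<Sum>k\<in>F. l1 k ^ (2 * M) * (cmod (h k j))\<^sup>2) \<le> B"
      using h unfolding weighted_bounded_def by (intro allI)
    from choice[OF this] show thesis using that by (elim exE)
  qed
  note B = B'[rule_format]
  obtain C where C': "\<forall>j F. finite F \<longrightarrow> (\<Sum>k\<in>F. l1 k ^ (2 * M) * (cmod (e k j))\<^sup>2) \<le> C j"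
  proof -
    have "\<forall>j. \<exists>B. \<forall>F. finite F \<longrightarrow> (\<Sum>k\<in>F. l1 k ^ (2 * M) * (cmod (e k j))\<^sup>2) \<le> B"
      using e unfolding weighted_bounded_def by (intro allI)
    from choice[OF this] show thesis using that by (elim exE)
  qed
  note C = C'[rule_format]
  show ?thesis unfolding weighted_bounded_def
  proof (intro exI allI impI)
    fix F :: "(int^3) set" assume F: "finite F"
    have "(\<Sum>k\<in>F. l1 k ^ (2 * M) * (cmod (propC (\<kappa> k) s (h k) i - of_real \<rho> * propS (\<kappa> k) s (e k) i))\<^sup>2) \<le>
        (\<Sum>k\<in>F. l1 k ^ (2 * M) * (150 * (\<Sum>j\<in>UNIV. (cmod (h k j))\<^sup>2) + 6 * \<rho>\<^sup>2 * (\<Sum>j\<in>UNIV. (cmod (e k j))\<^sup>2)))"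
      by (intro sum_mono mult_left_mono norm_prop_power2_le) (simp add: l1_nonneg)
    also have "\<dots> = (\<Sum>k\<in>F. 150 * (\<Sum>j\<in>UNIV. l1 k ^ (2 * M) * (cmod (h k j))\<^sup>2) + 6 * \<rho>\<^sup>2 * (\<Sum>j\<in>UNIV. l1 k ^ (2 * M) * (cmod (e k j))\<^sup>2))"
      unfolding distrib_left mult.left_commute[of "l1 _ ^ _"] sum_distrib_left[of "l1 _ ^ _"] ..
    also have "\<dots> = 150 * (\<Sum>k\<in>F. \<Sum>j\<in>UNIV. l1 k ^ (2 * M) * (cmod (h k j))\<^sup>2) + 6 * \<rho>\<^sup>2 * (\<Sum>k\<in>F. \<Sum>j\<in>UNIV. l1 k ^ (2 * M) * (cmod (e k j))\<^sup>2)"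
      unfolding sum.distrib sum_distrib_left[of 150, of _ F] sum_distrib_left[of "6 * \<rho>\<^sup>2", of _ F] ..
    also have "\<dots> = 150 * (\<Sum>j\<in>UNIV. \<Sum>k\<in>F. l1 k ^ (2 * M) * (cmod (h k j))\<^sup>2) + 6 * \<rho>\<^sup>2 * (\<Sum>j\<in>UNIV. \<Sum>k\<in>F. l1 k ^ (2 * M) * (cmod (e k j))\<^sup>2)"
      unfolding sum.swap[of _ UNIV F] ..
    also have "\<dots> \<le> 150 * (\<Sum>j\<in>UNIV. B j) + 6 * \<rho>\<^sup>2 * (\<Sum>j\<in>UNIV. C j)"
      by (intro add_mono mult_left_mono sum_mono B C F) auto
    finally show "(\<Sum>k\<in>F. l1 k ^ (2 * M) * (cmod (propC (\<kappa> k) s (h k) i - of_real \<rho> * propS (\<kappa> k) s (e k) i))\<^sup>2) \<le>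
        150 * (\<Sum>j\<in>UNIV. B j) + 6 * \<rho>\<^sup>2 * (\<Sum>j\<in>UNIV. C j)" .
  qed
qed

lemma vcoef_cong: "(\<And>x. x \<in> cube \<Longrightarrow> F x = G x) \<Longrightarrow> vcoef F k i = vcoef G k i"
  unfolding vcoef_def by (intro fcoef_cong) simp

lemma vcoef_cmult_AE:
  assumes V: "V \<in> vsobolev_per r" and W: "\<And>j. (\<lambda>x. W x $ j) \<in> L2"
    and AE: "AE x in cube_measure. V x = c *\<^sub>R W x"
  shows "vcoef V k i = of_real c * vcoef W k i"
proof -
  have "vcoef V k i = fcoef (\<lambda>x. of_real (c * W x $ i)) k"
    unfolding vcoef_def
  proof (rule fcoef_cong_AE)
    show "AE x in cube_measure. V x $ i = c * W x $ i"
      using AE by eventually_elim simp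
  qed (intro vsobolev_per_L2[OF V] L2_cmult W)+
  then show ?thesis by (simp only: fcoef_cmult[OF W] vcoef_def)
qed

section \<open>The coefficients of a solution of Maxwell's equations\<close>

context
  fixes r \<mu> \<epsilon> T :: real and H0 E0 :: "real^3 \<Rightarrow> real^3" and H E
  assumes r: "r > 3 / 2" and pos: "\<mu> > 0" "\<epsilon> > 0" "T > 0"
    and sol: "maxwell_solution r \<mu> \<epsilon> T H0 E0 H E"
begin

text \<open>The last two items are the gain of one derivative. They are restricted to interior
  times, because a time derivative in the periodic space is given only there.\<close>

lemma maxwell_coefficients:
  shows "continuous_on {0..T} (\<lambda>t. vcoef (H t) k i)" "continuous_on {0..T} (\<lambda>t. vcoef (E t) k i)"
    and "\<And>t. 0 < t \<Longrightarrow> t < T \<Longrightarrow> ((\<lambda>t. vcoef (H t) k i) has_vector_derivative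
      - (of_real (1 / \<mu>) * (\<i> * cross (kvec k) (vcoef (E t) k) i))) (at t)"
    and "\<And>t. 0 < t \<Longrightarrow> t < T \<Longrightarrow> ((\<lambda>t. vcoef (E t) k i) has_vector_derivative
      of_real (1 / \<epsilon>) * (\<i> * cross (kvec k) (vcoef (H t) k) i)) (at t)"
    and "\<And>t. t \<in> {0..T} \<Longrightarrow> cdot (kvec k) (vcoef (H t) k) = 0"
    and "\<And>t. t \<in> {0..T} \<Longrightarrow> cdot (kvec k) (vcoef (E t) k) = 0"
    and "\<And>t. 0 < t \<Longrightarrow> t < T \<Longrightarrow> weighted_bounded (Suc (nat \<lfloor>r\<rfloor>)) (\<lambda>k. vcoef (H t) k i)"
    and "\<And>t. 0 < t \<Longrightarrow> t < T \<Longrightarrow> weighted_bounded (Suc (nat \<lfloor>r\<rfloor>)) (\<lambda>k. vcoef (E t) k i)"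
proof -
  have r1: "r \<ge> 1" using r by simp
  obtain H' E' where H': "C1_sobolev_per r T H H'" and E': "C1_sobolev_per r T E E'"
    and eqH: "\<And>t. t \<in> {0<..<T} \<Longrightarrow> AE x in cube_measure. H' t x = - ((1 / \<mu>) *\<^sub>R curl (E t) x)"
    and eqE: "\<And>t. t \<in> {0<..<T} \<Longrightarrow> AE x in cube_measure. E' t x = (1 / \<epsilon>) *\<^sub>R curl (H t) x"
    using sol unfolding maxwell_solution_def by blast
  have SH: "H t \<in> vsobolev_per r" and SE: "E t \<in> vsobolev_per r" if "t \<in> {0..T}" for t
    using H' E' that unfolding C1_sobolev_per_def by blast+
  have SH': "H' t \<in> vsobolev_per r" and SE': "E' t \<in> vsobolev_per r" if "t \<in> {0<..<T}" for t
    using H' E' that unfolding C1_sobolev_per_def by blast+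
  show "continuous_on {0..T} (\<lambda>t. vcoef (H t) k i)" "continuous_on {0..T} (\<lambda>t. vcoef (E t) k i)"
    using C1_vcoef_continuous[OF H'] C1_vcoef_continuous[OF E'] by auto
  have cH: "vcoef (H' t) k i = - (of_real (1 / \<mu>) * (\<i> * cross (kvec k) (vcoef (E t) k) i))" if t: "0 < t" "t < T" for t k i
  proof -
    have "vcoef (H' t) k i = of_real (- 1 / \<mu>) * vcoef (curl (E t)) k i"
      by (rule vcoef_cmult_AE[OF SH' vcoef_curl(2)[OF SE r1]]) (use t eqH[of t] in auto)
    also have "vcoef (curl (E t)) k i = \<i> * cross (kvec k) (vcoef (E t) k) i"
      by (rule vcoef_curl(1)[OF SE r1]) (use t in auto)
    finally show ?thesis by simp
  qed
  have cE: "vcoef (E' t) k i = of_real (1 / \<epsilon>) * (\<i> * cross (kvec k) (vcoef (H t) k) i)" if t: "0 < t" "t < T" for t k i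
  proof -
    have "vcoef (E' t) k i = of_real (1 / \<epsilon>) * vcoef (curl (H t)) k i"
      by (rule vcoef_cmult_AE[OF SE' vcoef_curl(2)[OF SH r1]]) (use t eqE[of t] in auto)
    also have "vcoef (curl (H t)) k i = \<i> * cross (kvec k) (vcoef (H t) k) i"
      by (rule vcoef_curl(1)[OF SH r1]) (use t in auto)
    finally show ?thesis .
  qed
  show "((\<lambda>t. vcoef (H t) k i) has_vector_derivative
      - (of_real (1 / \<mu>) * (\<i> * cross (kvec k) (vcoef (E t) k) i))) (at t)" if t: "0 < t" "t < T" for t
    using C1_vcoef_derivative[OF H' t, of k i] unfolding cH[OF t] .
  show "((\<lambda>t. vcoef (E t) k i) has_vector_derivative
      of_real (1 / \<epsilon>) * (\<i> * cross (kvec k) (vcoef (H t) k) i)) (at t)" if t: "0 < t" "t < T" for t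
    using C1_vcoef_derivative[OF E' t, of k i] unfolding cE[OF t] .
  have dH: "cdot (kvec k) (vcoef (H t) k) = 0" and dE: "cdot (kvec k) (vcoef (E t) k) = 0" if t: "t \<in> {0..T}" for t k
    using cdot_vcoef_divergence[OF SH[OF t] r1, of \<epsilon> k] cdot_vcoef_divergence[OF SE[OF t] r1, of \<epsilon> k] sol t pos
    unfolding maxwell_solution_def by auto
  then show "cdot (kvec k) (vcoef (H t) k) = 0" "cdot (kvec k) (vcoef (E t) k) = 0" if "t \<in> {0..T}" for t
    using that by auto
  \<comment> \<open>The roles cross over: the magnetic field gains regularity from the time
    derivative of the electric field, and conversely below.\<close>
  show "weighted_bounded (Suc (nat \<lfloor>r\<rfloor>)) (\<lambda>k. vcoef (H t) k i)" if t: "0 < t" "t < T" for t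
    by (rule weighted_bounded_curl[OF SE'[of t], of "1 / \<epsilon>"]) (use t pos cE dH in \<open>auto simp: norm_mult norm_divide\<close>)
  show "weighted_bounded (Suc (nat \<lfloor>r\<rfloor>)) (\<lambda>k. vcoef (E t) k i)" if t: "0 < t" "t < T" for t
    by (rule weighted_bounded_curl[OF SH'[of t], of "1 / \<mu>"]) (use t pos cH dE in \<open>auto simp: norm_mult norm_divide\<close>)
qed

lemma maxwell_propagation:
  assumes ab: "a \<in> {0..T}" "b \<in> {0..T}"
  defines "s \<equiv> (b - a) / sqrt (\<mu> * \<epsilon>)"
  shows "vcoef (H b) k i = propC (kvec k) s (vcoef (H a) k) i
      - of_real (sqrt \<epsilon> / sqrt \<mu>) * propS (kvec k) s (vcoef (E a) k) i"
    and "vcoef (E b) k i = propC (kvec k) s (vcoef (E a) k) i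
      - of_real (sqrt \<mu> / sqrt \<epsilon>) * propS (kvec k) s (\<lambda>j. - vcoef (H a) k j) i"
proof -
  show "vcoef (H b) k i = propC (kvec k) s (vcoef (H a) k) i
      - of_real (sqrt \<epsilon> / sqrt \<mu>) * propS (kvec k) s (vcoef (E a) k) i"
    unfolding s_def
    by (rule maxwell_mode_solution[where h = "\<lambda>t. vcoef (H t) k" and e = "\<lambda>t. vcoef (E t) k" and T = T])
       (intro pos maxwell_coefficients ab; assumption)+
  have neg: "cross \<kappa> (\<lambda>j. - v j) i = - cross \<kappa> v i" for \<kappa> v i
    using cross_cmult[of \<kappa> "-1" v i] by simp
  \<comment> \<open>Duality: Maxwell's equations keep their form when (H, E) becomes (E, -H) and
    \<mu> and \<epsilon> are exchanged.\<close>
  have "vcoef (E b) k i = propC (kvec k) ((b - a) / sqrt (\<epsilon> * \<mu>)) (vcoef (E a) k) i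
      - of_real (sqrt \<mu> / sqrt \<epsilon>) * propS (kvec k) ((b - a) / sqrt (\<epsilon> * \<mu>)) (\<lambda>j. - vcoef (H a) k j) i"
  proof (rule maxwell_mode_solution[where h = "\<lambda>t. vcoef (E t) k" and e = "\<lambda>t j. - vcoef (H t) k j" and T = T])
    show "continuous_on {0..T} (\<lambda>t. - vcoef (H t) k i)" for i
      by (intro continuous_intros maxwell_coefficients)
    fix t i assume t: "0 < t" "t < T"
    show "((\<lambda>t. vcoef (E t) k i) has_vector_derivative - (of_real (1 / \<epsilon>) * (\<i> * cross (kvec k) (\<lambda>j. - vcoef (H t) k j) i))) (at t)"
      using maxwell_coefficients(4)[OF t, of k i] by (simp only: neg mult_minus_right minus_minus)
    show "((\<lambda>t. - vcoef (H t) k i) has_vector_derivative of_real (1 / \<mu>) * (\<i> * cross (kvec k) (vcoef (E t) k) i)) (at t)"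
      using has_vector_derivative_minus[OF maxwell_coefficients(3)[OF t, of k i]] by (simp only: minus_minus)
  qed (intro pos maxwell_coefficients ab; assumption)+
  then show "vcoef (E b) k i = propC (kvec k) s (vcoef (E a) k) i
      - of_real (sqrt \<mu> / sqrt \<epsilon>) * propS (kvec k) s (\<lambda>j. - vcoef (H a) k j) i"
    by (simp only: s_def mult.commute[of \<mu> \<epsilon>])
qed

text \<open>T/2 is just some interior time. The regularity gained there is transported to every
  time, in particular back to the initial data.\<close>

lemma weighted_bounded_maxwell:
  assumes b: "b \<in> {0..T}"
  shows "weighted_bounded (Suc (nat \<lfloor>r\<rfloor>)) (\<lambda>k. vcoef (H b) k i)"
    and "weighted_bounded (Suc (nat \<lfloor>r\<rfloor>)) (\<lambda>k. vcoef (E b) k i)"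
proof -
  have t: "0 < T / 2" "T / 2 < T" "T / 2 \<in> {0..T}" using pos by auto
  show "weighted_bounded (Suc (nat \<lfloor>r\<rfloor>)) (\<lambda>k. vcoef (H b) k i)"
    unfolding maxwell_propagation(1)[OF t(3) b]
    by (intro weighted_bounded_prop maxwell_coefficients t)
  have "weighted_bounded (Suc (nat \<lfloor>r\<rfloor>)) (\<lambda>k. - vcoef (H (T / 2)) k i)" for i
    using maxwell_coefficients(7)[OF t(1,2), of i] by (simp add: weighted_bounded_def)
  then show "weighted_bounded (Suc (nat \<lfloor>r\<rfloor>)) (\<lambda>k. vcoef (E b) k i)"
    unfolding maxwell_propagation(2)[OF t(3) b]
    by (intro weighted_bounded_prop maxwell_coefficients t)
qed

end

section \<open>Lattice sums\<close>

text \<open>The exponent 4/3 exceeds 1, so the weights are summable over the integers, and 3 * 4/3 =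
  4, so a product over three coordinates decays like a fourth power.\<close>

definition lat_weight :: "int \<Rightarrow> real" where
  "lat_weight l = (1 + \<bar>real_of_int l\<bar>) powr (- (4 / 3))"

lemma lat_weight_nonneg: "0 \<le> lat_weight l"
  by (simp add: lat_weight_def)

definition lat_const :: real where
  "lat_const = (\<Sum>n. (1 + real n) powr (- (4 / 3)))"

lemma summable_lat: "summable (\<lambda>n. (1 + real n) powr (- (4 / 3)))"
proof -
  have "summable (\<lambda>n. real (Suc n) powr (- (4 / 3)))"
    by (subst summable_Suc_iff) (simp add: summable_real_powr_iff)
  then show ?thesis by (simp add: add.commute)
qed

lemma lat_const_pos: "lat_const > 0"
  unfolding lat_const_def by (rule suminf_pos[OF summable_lat]) simp

lemma sum_lat_weight_le:
  assumes "finite S"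
  shows "(\<Sum>l\<in>S. lat_weight l) \<le> 2 * lat_const"
proof -
  have half: "(\<Sum>l\<in>A. lat_weight l) \<le> lat_const" if A: "finite A" "inj_on (\<lambda>l. nat \<bar>l\<bar>) A" for A
  proof -
    have "(\<Sum>l\<in>A. lat_weight l) = (\<Sum>l\<in>A. (1 + real (nat \<bar>l\<bar>)) powr (- (4 / 3)))"
      by (simp add: lat_weight_def)
    also have "\<dots> = (\<Sum>n\<in>(\<lambda>l. nat \<bar>l\<bar>) ` A. (1 + real n) powr (- (4 / 3)))"
      using A(2) by (simp add: sum.reindex)
    also have "\<dots> \<le> lat_const"
      unfolding lat_const_def by (rule sum_le_suminf[OF summable_lat]) (use A in auto)
    finally show ?thesis .
  qed
  have "(\<Sum>l\<in>S. lat_weight l) = (\<Sum>l\<in>{l\<in>S. 0 \<le> l}. lat_weight l) + (\<Sum>l\<in>{l\<in>S. \<not> 0 \<le> l}. lat_weight l)"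
    using assms by (subst sum.union_disjoint[symmetric]) (auto intro!: sum.cong)
  also have "\<dots> \<le> lat_const + lat_const"
    using assms by (intro add_mono half) (auto simp: inj_on_def)
  finally show ?thesis by simp
qed

text \<open>By injectivity the sum is at most the sum over a full box of triples, which factors into
  three one-dimensional sums.\<close>

lemma sum_prod_lat_weight_le:
  fixes \<phi> :: "'a \<Rightarrow> 3 \<Rightarrow> int"
  assumes F: "finite F" and inj: "inj_on \<phi> F"
  shows "(\<Sum>k\<in>F. \<Prod>i\<in>UNIV. lat_weight (\<phi> k i)) \<le> (2 * lat_const) ^ 3"
proof -
  define R where "R = (\<Union>k\<in>F. range (\<phi> k))"
  have R: "finite R" unfolding R_def using F by auto
  have "(\<Sum>k\<in>F. \<Prod>i\<in>UNIV. lat_weight (\<phi> k i)) = (\<Sum>f\<in>\<phi> ` F. \<Prod>i\<in>UNIV. lat_weight (f i))"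
    using inj by (simp add: sum.reindex)
  also have "\<dots> \<le> (\<Sum>f\<in>PiE (UNIV::3 set) (\<lambda>_. R). \<Prod>i\<in>UNIV. lat_weight (f i))"
  proof (rule sum_mono2)
    show "finite (PiE (UNIV::3 set) (\<lambda>_. R))" by (rule finite_PiE) (use R in auto)
    show "\<phi> ` F \<subseteq> PiE UNIV (\<lambda>_. R)" by (auto simp: R_def)
  qed (intro prod_nonneg lat_weight_nonneg)
  also have "\<dots> = (\<Prod>i\<in>(UNIV::3 set). \<Sum>l\<in>R. lat_weight l)"
    using R by (subst prod_sum_PiE) auto
  also have "\<dots> \<le> (\<Prod>i\<in>(UNIV::3 set). 2 * lat_const)"
    by (intro prod_mono conjI sum_nonneg lat_weight_nonneg sum_lat_weight_le R)
  finally show ?thesis by simp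
qed

text \<open>If the quotient l has |l| <= 1, the bound N/2 <= x suffices. Otherwise |m| >= N (|l| -
  1) does; the factor 1/6 leaves room in both cases.\<close>

lemma div_lower_bound:
  fixes m :: int and N :: nat
  assumes N: "N > 0" and x: "\<bar>real_of_int m\<bar> \<le> x" "real N / 2 \<le> x"
  shows "real N / 6 * (1 + \<bar>real_of_int (m div int N)\<bar>) \<le> x"
proof -
  define l where "l = m div int N"
  have m: "m = int N * l + m mod int N" by (simp add: l_def)
  have md: "0 \<le> m mod int N" "m mod int N < int N" using N by auto
  have ub: "real N * \<bar>real_of_int l\<bar> - real N \<le> \<bar>real_of_int m\<bar>"
  proof (cases "l \<ge> 0")
    case True
    have "int N * l \<le> m" using m md by linarith
    then have "real_of_int (int N * l) \<le> real_of_int m" by (simp only: of_int_le_iff)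
    then show ?thesis using True by simp
  next
    case False
    have "m \<le> int N * l + int N" using m md by linarith
    then have "real_of_int m \<le> real_of_int (int N * l + int N)" by (simp only: of_int_le_iff)
    then show ?thesis using False by (simp add: abs_if)
  qed
  have N0: "real N > 0" using N by simp
  consider "\<bar>l\<bar> \<le> 1" | "\<bar>l\<bar> \<ge> 2" by linarith
  then show ?thesis
  proof cases
    case 1
    then have "1 + \<bar>real_of_int l\<bar> \<le> 2" by linarith
    then have "real N / 6 * (1 + \<bar>real_of_int l\<bar>) \<le> real N / 6 * 2" using N0 by (intro mult_left_mono) auto
    then show ?thesis using x N0 unfolding l_def by linarith
  next
    case 2
    then have "2 \<le> \<bar>real_of_int l\<bar>" by linarith
    then have "real N * 2 \<le> real N * \<bar>real_of_int l\<bar>" using N0 by (intro mult_left_mono) auto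
    then have "real N / 6 * (1 + \<bar>real_of_int l\<bar>) \<le> real N * \<bar>real_of_int l\<bar> - real N"
    proof -
      have "real N / 6 * (1 + \<bar>real_of_int l\<bar>) = real N / 6 + real N * \<bar>real_of_int l\<bar> / 6"
        by (simp add: distrib_left)
      then show ?thesis using \<open>real N * 2 \<le> _\<close> N0 by linarith
    qed
    then show ?thesis using ub x unfolding l_def by linarith
  qed
qed

definition lat_bound :: real where "lat_bound = 6 ^ 4 * (2 * lat_const) ^ 3"

text \<open>Within one residue class a frequency is determined by its quotients by N. Each
  coordinate satisfies (N/6)(1 + |quotient|) <= l1 k; the powers -4/3 of these three inequalities
  multiply to the bound of l1^(-4) by (6/N)^4 times a product of lattice weights.\<close>

lemma sum_inverse_l1_power4_le:
  assumes N: "N > 0" and F: "finite F" and hi: "\<And>k. k \<in> F \<Longrightarrow> real N / 2 \<le> l1 k"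
    and cls: "\<And>k l i. k \<in> F \<Longrightarrow> l \<in> F \<Longrightarrow> k $ i mod int N = l $ i mod int N"
  shows "(\<Sum>k\<in>F. 1 / l1 k ^ 4) \<le> lat_bound / real N ^ 4"
proof -
  define \<phi> where "\<phi> = (\<lambda>(k::int^3) i. k $ i div int N)"
  have inj: "inj_on \<phi> F"
  proof (rule inj_onI)
    fix k l assume kl: "k \<in> F" "l \<in> F" "\<phi> k = \<phi> l"
    have "k $ i = l $ i" for i
    proof -
      have "k $ i div int N = l $ i div int N" using fun_cong[OF kl(3), of i] by (simp add: \<phi>_def)
      then show ?thesis using cls[OF kl(1,2), of i] by (metis div_mult_mod_eq)
    qed
    then show "k = l" by (simp add: Finite_Cartesian_Product.vec_eq_iff)
  qed
  have pt: "1 / l1 k ^ 4 \<le> (6 / real N) ^ 4 * (\<Prod>i\<in>UNIV. lat_weight (\<phi> k i))" if k: "k \<in> F" for k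
  proof -
    have N0: "real N > 0" using N by simp
    have l1: "l1 k > 0" using hi[OF k] N0 by linarith
    have "lat_weight (\<phi> k i) \<ge> (l1 k / (real N / 6)) powr (- (4 / 3))" for i
    proof -
      have "real N / 6 * (1 + \<bar>real_of_int (\<phi> k i)\<bar>) \<le> l1 k"
        unfolding \<phi>_def by (rule div_lower_bound[OF N l1_ge hi[OF k]])
      then have "1 + \<bar>real_of_int (\<phi> k i)\<bar> \<le> l1 k / (real N / 6)"
        using N0 by (simp add: field_simps)
      then show ?thesis unfolding lat_weight_def by (intro powr_mono2') auto
    qed
    then have "(\<Prod>i\<in>(UNIV::3 set). (l1 k / (real N / 6)) powr (- (4 / 3))) \<le> (\<Prod>i\<in>UNIV. lat_weight (\<phi> k i))"
      by (intro prod_mono) auto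
    moreover have "(\<Prod>i\<in>(UNIV::3 set). (l1 k / (real N / 6)) powr (- (4 / 3))) = 1 / (l1 k / (real N / 6)) ^ 4"
    proof -
      define z where "z = l1 k / (real N / 6)"
      have z: "z > 0" using l1 N0 by (simp add: z_def)
      have "(\<Prod>i\<in>(UNIV::3 set). z powr (- (4 / 3))) = (z powr (- (4 / 3))) ^ 3" by simp
      also have "\<dots> = z powr (- 4)" using z by (simp add: powr_power)
      also have "\<dots> = 1 / z ^ 4" using z by (simp add: powr_minus_divide powr_realpow[of z 4, simplified])
      finally show ?thesis by (simp add: z_def)
    qed
    ultimately have "1 / (l1 k / (real N / 6)) ^ 4 \<le> (\<Prod>i\<in>UNIV. lat_weight (\<phi> k i))" by simp
    then have "(6 / real N) ^ 4 * (1 / (l1 k / (real N / 6)) ^ 4) \<le> (6 / real N) ^ 4 * (\<Prod>i\<in>UNIV. lat_weight (\<phi> k i))"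
      by (rule mult_left_mono) simp
    moreover have "(6 / real N) ^ 4 * (1 / (l1 k / (real N / 6)) ^ 4) = 1 / l1 k ^ 4"
      using N0 l1 by (simp add: power_divide power_mult_distrib)
    ultimately show ?thesis by simp
  qed
  have "(\<Sum>k\<in>F. 1 / l1 k ^ 4) \<le> (\<Sum>k\<in>F. (6 / real N) ^ 4 * (\<Prod>i\<in>UNIV. lat_weight (\<phi> k i)))"
    by (intro sum_mono pt)
  also have "\<dots> = (6 / real N) ^ 4 * (\<Sum>k\<in>F. \<Prod>i\<in>UNIV. lat_weight (\<phi> k i))" by (simp only: sum_distrib_left)
  also have "\<dots> \<le> (6 / real N) ^ 4 * (2 * lat_const) ^ 3"
    by (intro mult_left_mono sum_prod_lat_weight_le F inj) auto
  finally show ?thesis by (simp add: lat_bound_def power_divide)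
qed

lemma l1_ge_1: "k \<noteq> 0 \<Longrightarrow> l1 k \<ge> 1"
proof -
  assume "k \<noteq> 0"
  then obtain i where "k $ i \<noteq> 0" by (auto simp: Finite_Cartesian_Product.vec_eq_iff)
  then have "1 \<le> \<bar>real_of_int (k $ i)\<bar>" by linarith
  then show ?thesis using l1_ge[of k i] by linarith
qed

text \<open>By 2 |c| <= l1^(-4) + l1^4 |c|^2, and l1^4 <= l1^(2M) for k other than 0 because M >= 2.
  The frequency 0 is split off, as l1 vanishes there.\<close>

lemma weighted_bounded_summable:
  assumes c: "weighted_bounded M c" and M: "M \<ge> 2"
  shows "(\<lambda>k. norm (c k)) summable_on UNIV"
proof -
  obtain B where B: "\<And>F. finite F \<Longrightarrow> (\<Sum>k\<in>F. l1 k ^ (2 * M) * (cmod (c k))\<^sup>2) \<le> B"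
    using c unfolding weighted_bounded_def by blast
  have "sum (\<lambda>k. norm (c k)) F \<le> cmod (c 0) + (lat_bound + B)" if F: "finite F" for F
  proof -
    let ?G = "F - {0}"
    have pt: "cmod (c k) \<le> 1 / l1 k ^ 4 + l1 k ^ (2 * M) * (cmod (c k))\<^sup>2" if "k \<in> ?G" for k
    proof -
      have l: "l1 k \<ge> 1" using that by (intro l1_ge_1) auto
      have "l1 k ^ 4 \<le> l1 k ^ (2 * M)" using l M by (intro power_increasing) auto
      then have 1: "l1 k ^ 4 * (cmod (c k))\<^sup>2 \<le> l1 k ^ (2 * M) * (cmod (c k))\<^sup>2" by (rule mult_right_mono) simp
      have "0 \<le> (1 / l1 k ^ 2 - l1 k ^ 2 * cmod (c k))\<^sup>2" by simp
      also have "\<dots> = 1 / l1 k ^ 4 + l1 k ^ 4 * (cmod (c k))\<^sup>2 - 2 * cmod (c k)"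
        using l by (simp add: power2_diff power_mult_distrib power_divide flip: power_mult)
      finally have "2 * cmod (c k) \<le> 1 / l1 k ^ 4 + l1 k ^ 4 * (cmod (c k))\<^sup>2" by simp
      then show ?thesis using 1 norm_ge_zero[of "c k"] by linarith
    qed
    have "sum (\<lambda>k. norm (c k)) F \<le> sum (\<lambda>k. norm (c k)) (insert 0 ?G)"
      using F by (intro sum_mono2) auto
    also have "\<dots> = cmod (c 0) + sum (\<lambda>k. norm (c k)) ?G" by (rule sum.insert) (use F in auto)
    also have "sum (\<lambda>k. norm (c k)) ?G \<le> (\<Sum>k\<in>?G. 1 / l1 k ^ 4 + l1 k ^ (2 * M) * (cmod (c k))\<^sup>2)"
      by (intro sum_mono pt)
    also have "\<dots> = (\<Sum>k\<in>?G. 1 / l1 k ^ 4) + (\<Sum>k\<in>?G. l1 k ^ (2 * M) * (cmod (c k))\<^sup>2)"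
      by (rule sum.distrib)
    also have "\<dots> \<le> lat_bound + B"
    proof (rule add_mono)
      \<comment> \<open>For N = 1 all frequencies form a single residue class, so the bound covers
        the whole sum.\<close>
      have "(\<Sum>k\<in>?G. 1 / l1 k ^ 4) \<le> lat_bound / real 1 ^ 4"
      proof (rule sum_inverse_l1_power4_le)
        show "real 1 / 2 \<le> l1 k" if "k \<in> ?G" for k using l1_ge_1[of k] that by simp
      qed (use F in auto)
      then show "(\<Sum>k\<in>?G. 1 / l1 k ^ 4) \<le> lat_bound" by simp
      show "(\<Sum>k\<in>?G. l1 k ^ (2 * M) * (cmod (c k))\<^sup>2) \<le> B" using F by (intro B) auto
    qed
    finally show ?thesis by simp
  qed
  then show ?thesis
    by (intro nonneg_bdd_above_summable_on bdd_aboveI[of _ "cmod (c 0) + (lat_bound + B)"]) auto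
qed

section \<open>The discrete norm of a Fourier series\<close>

abbreviation gp :: "nat \<Rightarrow> nat \<Rightarrow> nat \<Rightarrow> nat \<Rightarrow> real^3" where
  "gp N a b c \<equiv> grid_point N (Suc a) (Suc b) (Suc c)"

lemma gp_nth: "gp N a b c $ 1 = 2 * pi * real a / real N" "gp N a b c $ 2 = 2 * pi * real b / real N"
  "gp N a b c $ 3 = 2 * pi * real c / real N"
  by (simp_all add: grid_point_def hstep_def wL_def wR_def)

lemma gp_cube:
  assumes "a < N" "b < N" "c < N"
  shows "gp N a b c \<in> cube"
proof -
  have "0 \<le> 2 * pi * real a / real N \<and> 2 * pi * real a / real N \<le> 2 * pi" if "a < N" for a
  proof -
    have "2 * pi * real a \<le> 2 * pi * real N" using that by (intro mult_left_mono) auto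
    then show ?thesis using that by (simp add: divide_le_eq)
  qed
  then show ?thesis using assms unfolding mem_cube forall_3 gp_nth by blast
qed

lemma cis_gp: "cis (kvec k \<bullet> gp N a b c) =
    cis (2 * pi * real_of_int (k $ 1) / real N) ^ a * cis (2 * pi * real_of_int (k $ 2) / real N) ^ b
      * cis (2 * pi * real_of_int (k $ 3) / real N) ^ c"
proof -
  have "kvec k \<bullet> gp N a b c = real a * (2 * pi * real_of_int (k $ 1) / real N) + real b * (2 * pi * real_of_int (k $ 2) / real N)
      + real c * (2 * pi * real_of_int (k $ 3) / real N)"
    by (simp add: inner_vec_def sum_3 gp_nth mult_ac)
  then show ?thesis by (simp only: cis_mult Complex.DeMoivre)
qed

lemma cis_eq_1_iff_dvd:
  assumes "N > 0"
  shows "cis (2 * pi * real_of_int m / real N) = 1 \<longleftrightarrow> int N dvd m"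
proof
  assume "cis (2 * pi * real_of_int m / real N) = 1"
  then have "cos (2 * pi * real_of_int m / real N) = 1" by (simp add: complex_eq_iff)
  then obtain n :: int where "2 * pi * real_of_int m / real N = real_of_int n * 2 * pi" using cos_one_2pi_int by auto
  then have "real_of_int m = real_of_int (n * int N)" using assms by (simp add: field_simps)
  then have "m = n * int N" by (simp only: of_int_eq_iff)
  then show "int N dvd m" by simp
next
  assume "int N dvd m"
  then obtain n where "m = int N * n" by (elim dvdE)
  then have "2 * pi * real_of_int m / real N = 2 * pi * real_of_int n" using assms by simp
  then show "cis (2 * pi * real_of_int m / real N) = 1" by (simp add: complex_eq_iff cos_int_2pin sin_int_2pin)
qed

lemma sum_cis_power:
  assumes "N > 0"
  shows "(\<Sum>a<N. cis (2 * pi * real_of_int m / real N) ^ a) = (if int N dvd m then of_nat N else 0)"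
proof (cases "int N dvd m")
  case True
  then have "cis (2 * pi * real_of_int m / real N) = 1" by (simp only: cis_eq_1_iff_dvd[OF assms])
  then show ?thesis using True by (simp only: power_one) simp
next
  case False
  define z where "z = cis (2 * pi * real_of_int m / real N)"
  have z1: "z \<noteq> 1" using cis_eq_1_iff_dvd[OF assms] False by (simp add: z_def)
  have "z ^ N = cis (real N * (2 * pi * real_of_int m / real N))" unfolding z_def by (rule Complex.DeMoivre)
  also have "real N * (2 * pi * real_of_int m / real N) = 2 * pi * real_of_int m" using assms by simp
  also have "cis (2 * pi * real_of_int m) = 1" by (simp add: complex_eq_iff cos_int_2pin sin_int_2pin)
  finally have "z ^ N = 1" .
  then show ?thesis using geometric_sum[OF z1, of N] False by (simp add: z_def)
qed

lemma sum_cis_gp: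
  assumes "N > 0"
  shows "(\<Sum>a<N. \<Sum>b<N. \<Sum>c<N. cis (kvec k \<bullet> gp N a b c)) =
    (if \<forall>i. int N dvd k $ i then of_nat N ^ 3 else 0)"
proof -
  have "(\<Sum>a<N. \<Sum>b<N. \<Sum>c<N. cis (kvec k \<bullet> gp N a b c)) =
      (\<Sum>a<N. cis (2 * pi * real_of_int (k $ 1) / real N) ^ a) * ((\<Sum>b<N. cis (2 * pi * real_of_int (k $ 2) / real N) ^ b)
        * (\<Sum>c<N. cis (2 * pi * real_of_int (k $ 3) / real N) ^ c))"
    unfolding cis_gp by (simp only: mult.assoc sum_distrib_left[symmetric] sum_distrib_right[symmetric])
  then show ?thesis
    unfolding sum_cis_power[OF assms] forall_3 by (auto simp: power3_eq_cube)
qed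

definition grid_mean_square :: "nat \<Rightarrow> (real^3 \<Rightarrow> complex) \<Rightarrow> real" where
  "grid_mean_square N f = (\<Sum>a<N. \<Sum>b<N. \<Sum>c<N. (cmod (f (gp N a b c)))\<^sup>2) / real N ^ 3"

text \<open>Discrete orthogonality: an exponential sums to N^3 over the grid if N divides every
  entry of its frequency, and to 0 otherwise. Only products of coefficients of congruent frequencies
  survive.\<close>

lemma grid_mean_square_trig:
  assumes N: "N > 0" and F: "finite F"
  shows "complex_of_real (grid_mean_square N (\<lambda>x. \<Sum>k\<in>F. d k * cis (kvec k \<bullet> x))) =
    (\<Sum>k\<in>F. \<Sum>l\<in>F. if \<forall>i. k $ i mod int N = l $ i mod int N then d k * cnj (d l) else 0)"
proof -
  have sq: "complex_of_real ((cmod (\<Sum>k\<in>F. d k * cis (kvec k \<bullet> x)))\<^sup>2) =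
      (\<Sum>k\<in>F. \<Sum>l\<in>F. d k * cnj (d l) * cis (kvec (k - l) \<bullet> x))" for x
  proof -
    have "complex_of_real ((cmod (\<Sum>k\<in>F. d k * cis (kvec k \<bullet> x)))\<^sup>2) =
        (\<Sum>k\<in>F. d k * cis (kvec k \<bullet> x)) * (\<Sum>l\<in>F. cnj (d l) * cis (- (kvec l \<bullet> x)))"
      unfolding complex_norm_square by (simp add: cis_cnj)
    also have "\<dots> = (\<Sum>k\<in>F. \<Sum>l\<in>F. (d k * cis (kvec k \<bullet> x)) * (cnj (d l) * cis (- (kvec l \<bullet> x))))"
      by (rule sum_product)
    also have "\<dots> = (\<Sum>k\<in>F. \<Sum>l\<in>F. d k * cnj (d l) * cis (kvec (k - l) \<bullet> x))"
    proof (intro sum.cong refl)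
      fix k l
      have "cis (kvec (k - l) \<bullet> x) = cis (kvec k \<bullet> x) * cis (- (kvec l \<bullet> x))"
        by (simp add: cis_mult kvec_diff inner_diff_left)
      then show "(d k * cis (kvec k \<bullet> x)) * (cnj (d l) * cis (- (kvec l \<bullet> x))) = d k * cnj (d l) * cis (kvec (k - l) \<bullet> x)"
        by (simp only: mult_ac)
    qed
    finally show ?thesis .
  qed
  have "complex_of_real (\<Sum>a<N. \<Sum>b<N. \<Sum>c<N. (cmod (\<Sum>k\<in>F. d k * cis (kvec k \<bullet> gp N a b c)))\<^sup>2) =
      (\<Sum>a<N. \<Sum>b<N. \<Sum>c<N. \<Sum>k\<in>F. \<Sum>l\<in>F. d k * cnj (d l) * cis (kvec (k - l) \<bullet> gp N a b c))"
    unfolding of_real_sum sq ..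
  also have "\<dots> = (\<Sum>k\<in>F. \<Sum>l\<in>F. d k * cnj (d l) * (\<Sum>a<N. \<Sum>b<N. \<Sum>c<N. cis (kvec (k - l) \<bullet> gp N a b c)))"
    unfolding sum_distrib_left sum.swap[of _ F "{..<N}"] ..
  also have "\<dots> = (\<Sum>k\<in>F. \<Sum>l\<in>F. of_nat N ^ 3 * (if \<forall>i. k $ i mod int N = l $ i mod int N then d k * cnj (d l) else 0))"
    unfolding sum_cis_gp[OF N] by (intro sum.cong refl) (auto simp: mod_eq_dvd_iff)
  also have "\<dots> = of_nat N ^ 3 * (\<Sum>k\<in>F. \<Sum>l\<in>F. if \<forall>i. k $ i mod int N = l $ i mod int N then d k * cnj (d l) else 0)"
    by (simp only: sum_distrib_left)
  finally show ?thesis using N by (simp add: grid_mean_square_def)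
qed

text \<open>Congruent frequencies coincide on the grid, so cross terms appear. With w = l1^(2M) they
  are controlled by the sum of 1/w over a residue class, which is of order N^(-2M) because all
  frequencies are high.\<close>

lemma grid_mean_square_finite_le:
  assumes N: "N > 0" and M: "M \<ge> 2" and F: "finite F" and hi: "\<And>k. k \<in> F \<Longrightarrow> real N / 2 \<le> l1 k"
  shows "grid_mean_square N (\<lambda>x. \<Sum>k\<in>F. d k * cis (kvec k \<bullet> x)) \<le>
    (2 ^ (2 * M - 4) * lat_bound / real N ^ (2 * M)) * (\<Sum>k\<in>F. l1 k ^ (2 * M) * (cmod (d k))\<^sup>2)"
proof -
  define r where "r = (\<lambda>k l :: int^3. \<forall>i. k $ i mod int N = l $ i mod int N)"
  have r_sym: "r k l = r l k" for k l unfolding r_def by (metis)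
  define w where "w = (\<lambda>k. l1 k ^ (2 * M))"
  have N0: "real N > 0" using N by simp
  have l0: "l1 k > 0" if "k \<in> F" for k using hi[OF that] N0 by linarith
  have w0: "w k > 0" if "k \<in> F" for k unfolding w_def using l0[OF that] by simp
  \<comment> \<open>a weighted AM-GM bound for each product of coefficients, so that the classes modulo N need not be separated\<close>
  define Q where "Q = (\<lambda>k l. if r k l then w k * (cmod (d k))\<^sup>2 * (1 / w l) else 0)"
  \<comment> \<open>Of the 2M powers, 2M - 4 are estimated by l1 >= N/2, which gives 2^(2M - 4); the
    remaining four are summed over the class by the lattice bound.\<close>
  have inner: "(\<Sum>l\<in>F. if r k l then 1 / w l else 0) \<le> 2 ^ (2 * M - 4) * lat_bound / real N ^ (2 * M)" for k
  proof -
    let ?G = "{l\<in>F. r k l}"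
    have "(\<Sum>l\<in>F. if r k l then 1 / w l else 0) = (\<Sum>l\<in>?G. 1 / w l)"
      using F by (simp add: sum.inter_filter)
    also have "\<dots> \<le> (\<Sum>l\<in>?G. (2 / real N) ^ (2 * M - 4) * (1 / l1 l ^ 4))"
    proof (rule sum_mono)
      fix l assume l: "l \<in> ?G"
      have "1 / l1 l \<le> 2 / real N" using hi[of l] l l0[of l] N0 by (simp add: field_simps)
      then have "(1 / l1 l) ^ (2 * M - 4) \<le> (2 / real N) ^ (2 * M - 4)"
        using l0[of l] l by (intro power_mono) auto
      then have "(1 / l1 l) ^ (2 * M - 4) * (1 / l1 l ^ 4) \<le> (2 / real N) ^ (2 * M - 4) * (1 / l1 l ^ 4)"
        using l0[of l] l by (intro mult_right_mono) auto
      moreover have "(1 / l1 l) ^ (2 * M - 4) * (1 / l1 l ^ 4) = 1 / w l"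
      proof -
        have "(1 / l1 l) ^ (2 * M - 4) * (1 / l1 l ^ 4) = (1 / l1 l) ^ (2 * M - 4 + 4)"
          by (simp only: power_add power_one_over)
        also have "2 * M - 4 + 4 = 2 * M" using M by simp
        finally show ?thesis by (simp add: w_def power_one_over)
      qed
      ultimately show "1 / w l \<le> (2 / real N) ^ (2 * M - 4) * (1 / l1 l ^ 4)" by simp
    qed
    also have "\<dots> = (2 / real N) ^ (2 * M - 4) * (\<Sum>l\<in>?G. 1 / l1 l ^ 4)" by (simp only: sum_distrib_left)
    also have "\<dots> \<le> (2 / real N) ^ (2 * M - 4) * (lat_bound / real N ^ 4)"
    proof (intro mult_left_mono sum_inverse_l1_power4_le[OF N])
      show "l $ i mod int N = m $ i mod int N" if "l \<in> ?G" "m \<in> ?G" for l m i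
        using that by (simp add: r_def)
    qed (use F hi in auto)
    also have "\<dots> = 2 ^ (2 * M - 4) * lat_bound / real N ^ (2 * M)"
    proof -
      have "real N ^ (2 * M - 4) * real N ^ 4 = real N ^ (2 * M)"
        using M by (simp flip: power_add)
      then show ?thesis by (simp add: power_divide)
    qed
    finally show ?thesis .
  qed
  have "grid_mean_square N (\<lambda>x. \<Sum>k\<in>F. d k * cis (kvec k \<bullet> x)) =
      cmod (\<Sum>k\<in>F. \<Sum>l\<in>F. if r k l then d k * cnj (d l) else 0)"
  proof -
    have "0 \<le> grid_mean_square N f" for f
      unfolding grid_mean_square_def by (intro divide_nonneg_nonneg sum_nonneg) auto
    then have "grid_mean_square N (\<lambda>x. \<Sum>k\<in>F. d k * cis (kvec k \<bullet> x)) =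
        cmod (complex_of_real (grid_mean_square N (\<lambda>x. \<Sum>k\<in>F. d k * cis (kvec k \<bullet> x))))"
      by simp
    then show ?thesis unfolding grid_mean_square_trig[OF N F] r_def .
  qed
  also have "\<dots> \<le> (\<Sum>k\<in>F. \<Sum>l\<in>F. (Q k l + Q l k) / 2)"
  proof (intro sum_norm_le)
    fix k l assume kl: "k \<in> F" "l \<in> F"
    show "cmod (if r k l then d k * cnj (d l) else 0) \<le> (Q k l + Q l k) / 2"
    proof (cases "r k l")
      case True
      let ?x = "cmod (d k)" and ?y = "cmod (d l)"
      have "0 \<le> (w k * ?x - w l * ?y)\<^sup>2 / (w k * w l)" using w0[OF kl(1)] w0[OF kl(2)] by simp
      also have "\<dots> = w k * ?x\<^sup>2 * (1 / w l) + w l * ?y\<^sup>2 * (1 / w k) - 2 * (?x * ?y)"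
        using w0[OF kl(1)] w0[OF kl(2)] by (simp add: power2_eq_square field_simps)
      finally show ?thesis using True r_sym[of k l] by (simp add: Q_def norm_mult)
    qed (use r_sym[of k l] in \<open>simp add: Q_def\<close>)
  qed
  also have "\<dots> = (\<Sum>k\<in>F. \<Sum>l\<in>F. Q k l)"
  proof -
    have "(\<Sum>k\<in>F. \<Sum>l\<in>F. Q l k) = (\<Sum>k\<in>F. \<Sum>l\<in>F. Q k l)" by (rule sum.swap)
    then show ?thesis by (simp add: add_divide_distrib sum.distrib sum_divide_distrib[symmetric])
  qed
  also have "\<dots> = (\<Sum>k\<in>F. w k * (cmod (d k))\<^sup>2 * (\<Sum>l\<in>F. if r k l then 1 / w l else 0))"
    unfolding Q_def by (simp add: sum_distrib_left if_distrib cong: if_cong)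
  also have "\<dots> \<le> (\<Sum>k\<in>F. w k * (cmod (d k))\<^sup>2 * (2 ^ (2 * M - 4) * lat_bound / real N ^ (2 * M)))"
    using w0 by (intro sum_mono mult_left_mono inner) (simp add: less_imp_le)
  also have "\<dots> = (2 ^ (2 * M - 4) * lat_bound / real N ^ (2 * M)) * (\<Sum>k\<in>F. l1 k ^ (2 * M) * (cmod (d k))\<^sup>2)"
    by (simp only: w_def sum_distrib_right mult.commute)
  finally show ?thesis .
qed

text \<open>Only finitely many grid points matter, so pointwise convergence there suffices to pass
  to the limit over finite sets of frequencies. The low frequencies drop out of every partial
  sum.\<close>

lemma grid_mean_square_series_le:
  assumes N: "N > 0" and M: "M \<ge> 2"
    and low: "\<And>k. l1 k < real N / 2 \<Longrightarrow> d k = 0"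
    and B: "\<And>F. finite F \<Longrightarrow> (\<Sum>k\<in>F. l1 k ^ (2 * M) * (cmod (d k))\<^sup>2) \<le> B"
    and sum: "\<And>a b c. a < N \<Longrightarrow> b < N \<Longrightarrow> c < N \<Longrightarrow>
      ((\<lambda>k. d k * cis (kvec k \<bullet> gp N a b c)) has_sum f (gp N a b c)) UNIV"
  shows "grid_mean_square N f \<le> (2 ^ (2 * M - 4) * lat_bound / real N ^ (2 * M)) * B"
proof (rule tendsto_upperbound)
  show "((\<lambda>F. grid_mean_square N (\<lambda>x. \<Sum>k\<in>F. d k * cis (kvec k \<bullet> x))) \<longlongrightarrow> grid_mean_square N f) (finite_subsets_at_top UNIV)"
    unfolding grid_mean_square_def
    by (intro tendsto_intros sum[unfolded has_sum_def]) (use N in auto)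
  have pos: "0 \<le> 2 ^ (2 * M - 4) * lat_bound / real N ^ (2 * M)"
    unfolding lat_bound_def using lat_const_pos by simp
  show "\<forall>\<^sub>F F in finite_subsets_at_top UNIV. grid_mean_square N (\<lambda>x. \<Sum>k\<in>F. d k * cis (kvec k \<bullet> x)) \<le>
      (2 ^ (2 * M - 4) * lat_bound / real N ^ (2 * M)) * B"
  proof (rule eventually_finite_subsets_at_top_weakI)
    fix F :: "(int^3) set" assume F: "finite F"
    let ?G = "{k\<in>F. real N / 2 \<le> l1 k}"
    have "(\<Sum>k\<in>F. d k * cis (kvec k \<bullet> x)) = (\<Sum>k\<in>?G. d k * cis (kvec k \<bullet> x))" for x
    proof (intro sum.mono_neutral_right F ballI)
      fix k assume "k \<in> F - ?G"
      then have "l1 k < real N / 2" by auto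
      then show "d k * cis (kvec k \<bullet> x) = 0" by (simp add: low)
    qed auto
    then have "grid_mean_square N (\<lambda>x. \<Sum>k\<in>F. d k * cis (kvec k \<bullet> x)) =
        grid_mean_square N (\<lambda>x. \<Sum>k\<in>?G. d k * cis (kvec k \<bullet> x))" by simp
    also have "\<dots> \<le> (2 ^ (2 * M - 4) * lat_bound / real N ^ (2 * M)) * (\<Sum>k\<in>?G. l1 k ^ (2 * M) * (cmod (d k))\<^sup>2)"
      using F by (intro grid_mean_square_finite_le N M) auto
    also have "\<dots> \<le> (2 ^ (2 * M - 4) * lat_bound / real N ^ (2 * M)) * B"
      using F by (intro mult_left_mono B pos) auto
    finally show "grid_mean_square N (\<lambda>x. \<Sum>k\<in>F. d k * cis (kvec k \<bullet> x)) \<le>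
      (2 ^ (2 * M - 4) * lat_bound / real N ^ (2 * M)) * B" .
  qed
qed simp

section \<open>The scheme in frequency space\<close>

definition idx :: "nat \<Rightarrow> nat \<Rightarrow> nat \<Rightarrow> nat \<Rightarrow> nat" where
  "idx N a b c = N * N * c + N * b + a"

lemma idx_props:
  assumes "a < N" "b < N" "c < N"
  shows "idx N a b c < N ^ 3" "idx N a b c mod N = a" "idx N a b c div N mod N = b" "idx N a b c div (N * N) = c"
proof -
  have e: "idx N a b c = N * (N * c + b) + a" by (simp add: idx_def algebra_simps)
  show m: "idx N a b c mod N = a" unfolding e using assms by simp
  have d: "idx N a b c div N = N * c + b" unfolding e using assms by simp
  then show "idx N a b c div N mod N = b" using assms by simp
  show dd: "idx N a b c div (N * N) = c" unfolding div_mult2_eq d using assms by simp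
  show "idx N a b c < N ^ 3"
  proof -
    have "idx N a b c div (N * N) < N" using dd assms by simp
    then have "idx N a b c < N * (N * N)" using assms by (simp add: div_less_iff_less_mult)
    then show ?thesis by (simp add: power3_eq_cube mult.assoc)
  qed
qed

lemma idx_decomp:
  assumes "p < N ^ 3"
  shows "p = idx N (p mod N) (p div N mod N) (p div (N * N))" "p mod N < N" "p div N mod N < N" "p div (N * N) < N"
proof -
  have N: "N > 0" using assms by (cases N) auto
  show "p mod N < N" "p div N mod N < N" using N by auto
  have "p < N * (N * N)" using assms by (simp add: power3_eq_cube mult.assoc)
  then show "p div (N * N) < N" using N by (simp add: div_less_iff_less_mult)
  have "idx N (p mod N) (p div N mod N) (p div (N * N)) = N * (N * (p div N div N) + p div N mod N) + p mod N"
    unfolding idx_def div_mult2_eq by (simp only: distrib_left mult.assoc)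
  also have "N * (p div N div N) + p div N mod N = p div N" by (rule mult_div_mod_eq)
  also have "N * (p div N) + p mod N = p" by (rule mult_div_mod_eq)
  finally show "p = idx N (p mod N) (p div N mod N) (p div (N * N))" ..
qed

lemma grid_index_idx: "grid_index N (Suc a) (Suc b) (Suc c) = idx N a b c"
  by (simp add: grid_index_def idx_def)

lemma sum_idx: "(\<Sum>p<N ^ 3. f p) = (\<Sum>a<N. \<Sum>b<N. \<Sum>c<N. f (idx N a b c))"
proof -
  have "(\<Sum>a<N. \<Sum>b<N. \<Sum>c<N. f (idx N a b c)) = (\<Sum>(a, b, c)\<in>{..<N} \<times> {..<N} \<times> {..<N}. f (idx N a b c))"
    by (simp add: sum.cartesian_product case_prod_unfold)
  also have "\<dots> = (\<Sum>p<N ^ 3. f p)"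
    by (rule sum.reindex_bij_witness[where i = "\<lambda>p. (p mod N, p div N mod N, p div (N * N))" and j = "\<lambda>(a, b, c). idx N a b c"])
       (auto simp: idx_props idx_decomp(2-4) idx_decomp(1)[symmetric])
  finally show ?thesis ..
qed

section \<open>The diagonal form of the matrices\<close>

lemma kron_diag: "mat_diag m f \<otimes>\<^sub>K mat_diag n g = mat_diag (m * n) (\<lambda>p. f (p div n) * g (p mod n))"
proof (rule eq_matI)
  fix i j assume "i < dim_row (mat_diag (m * n) (\<lambda>p. f (p div n) * g (p mod n)))"
    "j < dim_col (mat_diag (m * n) (\<lambda>p. f (p div n) * g (p mod n)))"
  then have ij: "i < m * n" "j < m * n" by (simp_all add: mat_diag_def)
  then have n: "n > 0" by (cases n) auto
  have d: "i div n < m" "j div n < m" "i mod n < n" "j mod n < n"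
    using ij n by (simp_all add: div_less_iff_less_mult)
  have "i = j \<longleftrightarrow> i div n = j div n \<and> i mod n = j mod n" by (metis div_mult_mod_eq)
  then show "(mat_diag m f \<otimes>\<^sub>K mat_diag n g) $$ (i, j) = mat_diag (m * n) (\<lambda>p. f (p div n) * g (p mod n)) $$ (i, j)"
    using ij d by (auto simp: kron_def mat_diag_def)
qed (simp_all add: kron_def mat_diag_def)

lemma mat_diag_add: "mat_diag n f + mat_diag n g = mat_diag n (\<lambda>p. f p + g p)" for f :: "nat \<Rightarrow> complex"
  by (rule eq_matI) (auto simp: mat_diag_def)

lemma mat_diag_smult: "c \<cdot>\<^sub>m mat_diag n f = mat_diag n (\<lambda>p. c * f p)" for f :: "nat \<Rightarrow> complex"
  by (rule eq_matI) (auto simp: mat_diag_def)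

lemma mat_diag_uminus: "- mat_diag n f = mat_diag n (\<lambda>p. - f p)" for f :: "nat \<Rightarrow> complex"
  by (rule eq_matI) (auto simp: mat_diag_def)

lemma mat_diag_zero: "0\<^sub>m n n = mat_diag n (\<lambda>p. 0 :: complex)"
  by (rule eq_matI) (auto simp: mat_diag_def)

lemma one_mat_diag: "1\<^sub>m n = mat_diag n (\<lambda>p. 1 :: complex)"
  by simp

text \<open>The signed frequency vector of position p; its components are the diagonal entries of
  \<open>Omega1\<close>, \<open>Omega2\<close> and \<open>Omega3\<close>. An index N/2 has become 0
  through \<open>freq\<close>.\<close>

definition xi :: "nat \<Rightarrow> nat \<Rightarrow> real^3" where
  "xi N p = vector [of_int (freq N (p mod N)), of_int (freq N (p div N mod N)), of_int (freq N (p div (N * N)))]"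

lemma Omega_diag: "Omega N = mat_diag N (\<lambda>j. of_int (freq N j))"
  unfolding Omega_def mat_diag_smult by (simp add: nu_def wL_def wR_def)

lemma mod_square_div: "p mod (N * N) div N = p div N mod N" for p N :: nat
proof (cases "N = 0")
  case False
  have "p mod (N * N) = N * (p div N mod N) + p mod N" by (rule mod_mult2_eq)
  then show ?thesis using False by simp
qed simp

lemma Omega_diags:
  "Omega1 N = mat_diag (N ^ 3) (\<lambda>p. of_real (xi N p $ 1))"
  "Omega2 N = mat_diag (N ^ 3) (\<lambda>p. of_real (xi N p $ 2))"
  "Omega3 N = mat_diag (N ^ 3) (\<lambda>p. of_real (xi N p $ 3))"
  unfolding Omega1_def Omega2_def Omega3_def Omega_diag one_mat_diag kron_diag
  by (simp_all add: xi_def mod_square_div mod_mod_cancel power3_eq_cube mult.assoc)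

lemma Psi_diag: "Psi N (of_real s) = mat_diag (N ^ 3) (\<lambda>p. of_real (s\<^sup>2 * (norm (xi N p))\<^sup>2))"
  unfolding Psi_def Omega_diags mat_diag_diag mat_diag_add mat_diag_smult norm_power2_vec3
  by (simp add: power2_eq_square)

lemma mat_diag_index: "p < n \<Longrightarrow> mat_diag n f $$ (p, p) = f p"
  by (simp add: mat_diag_def)

lemma mat_diag_cong: "(\<And>p. p < n \<Longrightarrow> f p = g p) \<Longrightarrow> mat_diag n f = mat_diag n g"
  by (rule eq_matI) (auto simp: mat_diag_def)

text \<open>On the negative axis the principal root has positive imaginary part. The arguments in
  \<open>matA\<close> and \<open>matB\<close> are thus i times a real number, and hyperbolic
  functions become trigonometric ones.\<close>

lemma csqrt_minus_of_real_power2: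
  assumes "0 \<le> x"
  shows "csqrt (- of_real (x\<^sup>2)) = \<i> * of_real x"
proof -
  have "csqrt (- of_real (x\<^sup>2)) = csqrt ((\<i> * of_real x)\<^sup>2)" by (simp add: power_mult_distrib)
  also have "\<dots> = \<i> * of_real x"
    by (rule csqrt_square) (use assms in auto)
  finally show ?thesis .
qed

lemma cosh_i_times: "cosh (\<i> * complex_of_real x) = of_real (cos x)"
  by (simp add: cosh_field_def exp_Euler cos_of_real sin_of_real exp_minus_Euler complex_eq_iff)

lemma sinh_i_times: "sinh (\<i> * complex_of_real x) = \<i> * of_real (sin x)"
  by (simp add: sinh_field_def exp_Euler cos_of_real sin_of_real exp_minus_Euler complex_eq_iff)

definition Aval :: "nat \<Rightarrow> real \<Rightarrow> nat \<Rightarrow> real" where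
  "Aval N s p = (if xi N p = 0 then - 1 / 2 else (cos (s * norm (xi N p)) - 1) / (s * norm (xi N p))\<^sup>2)"

definition Bval :: "nat \<Rightarrow> real \<Rightarrow> nat \<Rightarrow> real" where
  "Bval N s p = (if xi N p = 0 then 1 else sin (s * norm (xi N p)) / (s * norm (xi N p)))"

lemma matA_diag: "s > 0 \<Longrightarrow> matA N (of_real s) = mat_diag (N ^ 3) (\<lambda>p. of_real (Aval N s p))"
  unfolding matA_def Psi_diag
proof (rule mat_diag_cong)
  fix p assume s: "s > 0" and p: "p < N ^ 3"
  have "csqrt (- of_real ((s * norm (xi N p))\<^sup>2)) = \<i> * of_real (s * norm (xi N p))"
    by (rule csqrt_minus_of_real_power2) (use s in simp)
  moreover have "complex_of_real ((s * norm (xi N p))\<^sup>2) = 0 \<longleftrightarrow> xi N p = 0"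
    using s by simp
  ultimately show "(let \<psi> = mat_diag (N ^ 3) (\<lambda>p. complex_of_real (s\<^sup>2 * (norm (xi N p))\<^sup>2)) $$ (p, p)
      in if \<psi> = 0 then - 1 / 2 else (cosh (csqrt (- \<psi>)) - 1) / \<psi>) = of_real (Aval N s p)"
    unfolding mat_diag_index[OF p] power_mult_distrib[symmetric] Let_def Aval_def
    by (simp only: cosh_i_times) simp
qed

lemma matB_diag: "s > 0 \<Longrightarrow> matB N (of_real s) = mat_diag (N ^ 3) (\<lambda>p. of_real (Bval N s p))"
  unfolding matB_def Psi_diag
proof (rule mat_diag_cong)
  fix p assume s: "s > 0" and p: "p < N ^ 3"
  have "csqrt (- of_real ((s * norm (xi N p))\<^sup>2)) = \<i> * of_real (s * norm (xi N p))"
    by (rule csqrt_minus_of_real_power2) (use s in simp)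
  moreover have "complex_of_real ((s * norm (xi N p))\<^sup>2) = 0 \<longleftrightarrow> xi N p = 0"
    using s by simp
  ultimately show "(let \<psi> = mat_diag (N ^ 3) (\<lambda>p. complex_of_real (s\<^sup>2 * (norm (xi N p))\<^sup>2)) $$ (p, p)
      in if \<psi> = 0 then 1 else sinh (csqrt (- \<psi>)) / csqrt (- \<psi>)) = of_real (Bval N s p)"
    unfolding mat_diag_index[OF p] power_mult_distrib[symmetric] Let_def Bval_def
    by (simp only: sinh_i_times) simp
qed

lemma sum_lessThan_3_mult: "(\<Sum>q<3 * n. f q) = (\<Sum>q<n. f q) + (\<Sum>q<n. f (n + q)) + (\<Sum>q<n. f (2 * n + q))"
  for f :: "nat \<Rightarrow> complex"
proof -
  have "(\<Sum>q<3 * n. f q) = (\<Sum>q\<in>{0..<2 * n + n}. f q)" by (simp add: atLeast0LessThan)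
  also have "\<dots> = (\<Sum>q\<in>{0..<2 * n}. f q) + (\<Sum>q\<in>{2 * n..<2 * n + n}. f q)"
    by (rule sum.atLeastLessThan_concat[symmetric]) auto
  also have "(\<Sum>q\<in>{0..<2 * n}. f q) = (\<Sum>q\<in>{0..<n}. f q) + (\<Sum>q\<in>{n..<n + n}. f q)"
    by (subst sum.atLeastLessThan_concat) (auto simp: mult_2)
  also have "(\<Sum>q\<in>{n..<n + n}. f q) = (\<Sum>q<n. f (n + q))"
    using sum.shift_bounds_nat_ivl[of f 0 n n] by (simp add: atLeast0LessThan add.commute)
  also have "(\<Sum>q\<in>{2 * n..<2 * n + n}. f q) = (\<Sum>q<n. f (2 * n + q))"
    using sum.shift_bounds_nat_ivl[of f 0 "2 * n" n] by (simp add: atLeast0LessThan add.commute)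
  finally show ?thesis by (simp add: atLeast0LessThan)
qed

lemma dim_stack: "(\<And>i. dim_vec (F i) = n) \<Longrightarrow> dim_vec (stack F) = 3 * n"
  by (simp add: stack_def)

lemma stack_index:
  assumes "\<And>i. dim_vec (F i) = n" "q < n"
  shows "vec_index (stack F) q = vec_index (F 1) q" "vec_index (stack F) (n + q) = vec_index (F 2) q"
    "vec_index (stack F) (2 * n + q) = vec_index (F 3) q"
  using assms by (simp_all add: stack_def append_vec_def Let_def)

text \<open>Diagonal blocks act at each position separately, so the large product splits into one 3
  by 3 product for each p.\<close>

lemma block3_mult_index:
  fixes d :: "nat \<Rightarrow> nat \<Rightarrow> nat \<Rightarrow> complex"
  assumes dim: "\<And>i. dim_vec (F i) = n" and p: "p < n" and a: "a < 3"
    and M: "\<And>a b. a < 3 \<Longrightarrow> b < 3 \<Longrightarrow> M ! a ! b = mat_diag n (d a b)"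
  shows "vec_index (block3 n M *\<^sub>v stack F) (a * n + p) =
    d a 0 p * vec_index (F 1) p + d a 1 p * vec_index (F 2) p + d a 2 p * vec_index (F 3) p"
proof -
  have ap: "a * n + p < 3 * n"
  proof -
    have "a * n \<le> 2 * n" using a by (intro mult_right_mono) auto
    then show ?thesis using p by linarith
  qed
  have dm: "(a * n + p) div n = a" "(a * n + p) mod n = p" using p by simp_all
  have ent: "block3 n M $$ (a * n + p, b * n + q) = (if p = q then d a b p else 0)" if "b < 3" "q < n" for b q
  proof -
    have "b * n \<le> 2 * n" using that by (intro mult_right_mono) auto
    then have bq: "b * n + q < 3 * n" using that by linarith
    have dm': "(b * n + q) div n = b" "(b * n + q) mod n = q" using that by simp_all
    have "block3 n M $$ (a * n + p, b * n + q) = (M ! a ! b) $$ (p, q)"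
      unfolding block3_def using ap bq by (simp only: index_mat dim_row_mat dim_col_mat case_prod_conv dm dm')
    also have "\<dots> = (if p = q then d a b p else 0)"
      unfolding M[OF a that(1)] using p that(2) by (simp add: mat_diag_def)
    finally show ?thesis .
  qed
  have e0: "block3 n M $$ (a * n + p, q) = (if p = q then d a 0 p else 0)" if "q < n" for q
    using ent[of 0 q] that by simp
  have e1: "block3 n M $$ (a * n + p, n + q) = (if p = q then d a 1 p else 0)" if "q < n" for q
    using ent[of 1 q] that by simp
  have e2: "block3 n M $$ (a * n + p, 2 * n + q) = (if p = q then d a 2 p else 0)" if "q < n" for q
    using ent[of 2 q] that by simp
  have dimb: "dim_row (block3 n M) = 3 * n" "dim_col (block3 n M) = 3 * n" by (simp_all add: block3_def)
  have "vec_index (block3 n M *\<^sub>v stack F) (a * n + p) = (\<Sum>q<3 * n. block3 n M $$ (a * n + p, q) * vec_index (stack F) q)"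
    using ap by (simp add: scalar_prod_def dim_stack[OF dim] dimb row_def atLeast0LessThan)
  also have "\<dots> = (\<Sum>q<n. (if p = q then d a 0 p else 0) * vec_index (F 1) q) +
      (\<Sum>q<n. (if p = q then d a 1 p else 0) * vec_index (F 2) q) +
      (\<Sum>q<n. (if p = q then d a 2 p else 0) * vec_index (F 3) q)"
    unfolding sum_lessThan_3_mult
    by (intro arg_cong2[where f = "(+)"] sum.cong refl) (simp_all add: e0 e1 e2 stack_index[OF dim])
  also have "\<dots> = d a 0 p * vec_index (F 1) p + d a 1 p * vec_index (F 2) p + d a 2 p * vec_index (F 3) p"
    using p by (simp add: if_distrib[of "\<lambda>x. x * _"] cong: if_cong)
  finally show ?thesis .
qed

definition comp_index :: "3 \<Rightarrow> nat" where
  "comp_index i = (if i = 1 then 0 else if i = 2 then 1 else 2)"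

lemma unstack_index:
  "p < n \<Longrightarrow> vec_index (unstack n V i) p = vec_index V (comp_index i * n + p)"
  by (simp add: unstack_def comp_index_def)

lemma comp_index_less: "comp_index i < 3" by (simp add: comp_index_def)

text \<open>At each position the matrix is I + \<alpha> (|\<xi>|^2 I - \<xi> \<xi>^T) with \<alpha>
  = s^2 A: the sum of two squares in each diagonal block is |\<xi>|^2 minus the third
  square.\<close>

lemma cmat_index:
  assumes dim: "\<And>i. dim_vec (F i) = N ^ 3" and p: "p < N ^ 3" and s: "s > 0"
  shows "vec_index (cmat N (of_real s) *\<^sub>v stack F) (comp_index i * N ^ 3 + p) =
    propC (xi N p) s (\<lambda>j. vec_index (F j) p) i"
proof -
  define x where "x = (\<lambda>p i. complex_of_real (xi N p $ i))"
  define \<alpha> where "\<alpha> = (\<lambda>p. (complex_of_real s)\<^sup>2 * of_real (Aval N s p))"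
  define d where "d = (\<lambda>a b p. [[1 + \<alpha> p * (x p 3 * x p 3 + x p 2 * x p 2), - \<alpha> p * (x p 2 * x p 1), - \<alpha> p * (x p 3 * x p 1)],
     [- \<alpha> p * (x p 2 * x p 1), 1 + \<alpha> p * (x p 3 * x p 3 + x p 1 * x p 1), - \<alpha> p * (x p 3 * x p 2)],
     [- \<alpha> p * (x p 3 * x p 1), - \<alpha> p * (x p 3 * x p 2), 1 + \<alpha> p * (x p 2 * x p 2 + x p 1 * x p 1)]] ! a ! b)"
  have M: "[[c11 N (of_real s), c12 N (of_real s), c13 N (of_real s)],
      [c12 N (of_real s), c22 N (of_real s), c23 N (of_real s)],
      [c13 N (of_real s), c23 N (of_real s), c33 N (of_real s)]] ! a ! b = mat_diag (N ^ 3) (d a b)" if "a < 3" "b < 3" for a b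
  proof -
    have ab: "a = 0 \<or> a = 1 \<or> a = 2" "b = 0 \<or> b = 1 \<or> b = 2" using that by auto
    show ?thesis
      using ab
      by (elim disjE; simp only: c11_def c22_def c33_def c12_def c13_def c23_def Omega_diags matA_diag[OF s]
        one_mat_diag mat_diag_diag mat_diag_add mat_diag_smult)
         (simp_all add: d_def x_def \<alpha>_def mult_ac)
  qed
  \<comment> \<open>At frequency 0 the value -1/2 in \<open>matA\<close> gives \<alpha> = - s^2/2,
    while the quotient in \<open>propC\<close> is 0; both multiply terms that vanish.\<close>
  have \<alpha>: "\<alpha> p = of_real ((cos (s * norm (xi N p)) - 1) / (norm (xi N p))\<^sup>2) \<or> (\<forall>i. x p i = 0)"
    using s by (auto simp: \<alpha>_def x_def Aval_def power_mult_distrib)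
  have "vec_index (cmat N (of_real s) *\<^sub>v stack F) (comp_index i * N ^ 3 + p) =
      d (comp_index i) 0 p * vec_index (F 1) p + d (comp_index i) 1 p * vec_index (F 2) p + d (comp_index i) 2 p * vec_index (F 3) p"
    unfolding cmat_def by (rule block3_mult_index[OF dim p comp_index_less M])
  also have "\<dots> = vec_index (F i) p + \<alpha> p * (of_real ((norm (xi N p))\<^sup>2) * vec_index (F i) p - x p i * cdot (xi N p) (\<lambda>j. vec_index (F j) p))"
    using exhaust_3[of i] unfolding norm_power2_vec3
    by (elim disjE) (simp_all add: d_def comp_index_def cdot_def sum_3 x_def power2_eq_square algebra_simps)
  also have "\<dots> = propC (xi N p) s (\<lambda>j. vec_index (F j) p) i"
  proof (cases "\<forall>i. x p i = 0")
    case True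
    then have "xi N p = 0" by (simp add: x_def Finite_Cartesian_Product.vec_eq_iff)
    then show ?thesis using True by (simp add: propC_def)
  next
    case False
    then have "\<alpha> p = of_real ((cos (s * norm (xi N p)) - 1) / (norm (xi N p))\<^sup>2)" using \<alpha> by blast
    then show ?thesis by (simp only: propC_def x_def)
  qed
  finally show ?thesis .
qed

text \<open>The antisymmetric block pattern is the matrix of the cross product with \<xi>, and
  \<beta> = i s B is the factor i sin(s |\<xi>|)/|\<xi>| away from frequency 0.\<close>

lemma smat_index:
  assumes dim: "\<And>i. dim_vec (F i) = N ^ 3" and p: "p < N ^ 3" and s: "s > 0"
  shows "vec_index (smat N (of_real s) *\<^sub>v stack F) (comp_index i * N ^ 3 + p) =
    propS (xi N p) s (\<lambda>j. vec_index (F j) p) i"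
proof -
  define x where "x = (\<lambda>p i. complex_of_real (xi N p $ i))"
  define \<beta> where "\<beta> = (\<lambda>p. \<i> * complex_of_real s * of_real (Bval N s p))"
  define d where "d = (\<lambda>a b p. [[0, - (\<beta> p * x p 3), \<beta> p * x p 2],
     [\<beta> p * x p 3, 0, - (\<beta> p * x p 1)],
     [- (\<beta> p * x p 2), \<beta> p * x p 1, 0]] ! a ! b)"
  have M: "[[0\<^sub>m (N ^ 3) (N ^ 3), - s12 N (of_real s), s13 N (of_real s)],
      [s12 N (of_real s), 0\<^sub>m (N ^ 3) (N ^ 3), - s23 N (of_real s)],
      [- s13 N (of_real s), s23 N (of_real s), 0\<^sub>m (N ^ 3) (N ^ 3)]] ! a ! b = mat_diag (N ^ 3) (d a b)" if "a < 3" "b < 3" for a b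
  proof -
    have ab: "a = 0 \<or> a = 1 \<or> a = 2" "b = 0 \<or> b = 1 \<or> b = 2" using that by auto
    show ?thesis
      using ab
      by (elim disjE; simp only: s12_def s13_def s23_def Omega_diags matB_diag[OF s]
        mat_diag_zero mat_diag_diag mat_diag_uminus mat_diag_smult)
         (simp_all add: d_def x_def \<beta>_def mult_ac)
  qed
  have \<beta>: "\<beta> p = \<i> * of_real (sin (s * norm (xi N p)) / norm (xi N p)) \<or> (\<forall>i. x p i = 0)"
    using s by (auto simp: \<beta>_def x_def Bval_def)
  have "vec_index (smat N (of_real s) *\<^sub>v stack F) (comp_index i * N ^ 3 + p) =
      d (comp_index i) 0 p * vec_index (F 1) p + d (comp_index i) 1 p * vec_index (F 2) p + d (comp_index i) 2 p * vec_index (F 3) p"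
    unfolding smat_def by (rule block3_mult_index[OF dim p comp_index_less M])
  also have "\<dots> = \<beta> p * cross (xi N p) (\<lambda>j. vec_index (F j) p) i"
    using exhaust_3[of i]
    by (elim disjE) (simp_all add: d_def comp_index_def x_def algebra_simps)
  also have "\<dots> = propS (xi N p) s (\<lambda>j. vec_index (F j) p) i"
  proof (cases "\<forall>i. x p i = 0")
    case True
    then have "xi N p = 0" by (simp add: x_def Finite_Cartesian_Product.vec_eq_iff)
    then show ?thesis by (simp add: propS_def cross_def)
  next
    case False
    then have "\<beta> p = \<i> * of_real (sin (s * norm (xi N p)) / norm (xi N p))" using \<beta> by blast
    then show ?thesis by (simp only: propS_def)
  qed
  finally show ?thesis .
qed

section \<open>The discrete Fourier transform and aliasing\<close>

definition pvec :: "nat \<Rightarrow> nat \<Rightarrow> int^3" where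
  "pvec N p = vector [int (p mod N), int (p div N mod N), int (p div (N * N))]"

lemma pvec_nth: "pvec N p $ 1 = int (p mod N)" "pvec N p $ 2 = int (p div N mod N)" "pvec N p $ 3 = int (p div (N * N))"
  by (simp_all add: pvec_def)

lemma root_of_unity_cis: "exp (2 * complex_of_real pi * \<i> / of_nat N) = cis (2 * pi / real N)"
  by (simp add: cis_conv_exp mult_ac)

lemma DFT_index:
  assumes "j < N" "k < N"
  shows "DFT N $$ (j, k) = cis (- (real j * (2 * pi * real k / real N)))"
proof -
  have "DFT N $$ (j, k) = exp (2 * complex_of_real pi * \<i> / of_nat N) powi (- int (j * k))"
    using assms by (simp add: DFT_def)
  then show ?thesis unfolding root_of_unity_cis cis_power_int by (simp add: mult_ac)
qed

lemma IDFT_index: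
  assumes "j < N" "k < N"
  shows "IDFT N $$ (j, k) = 1 / of_nat N * cis (real k * (2 * pi * real j / real N))"
proof -
  have "IDFT N $$ (j, k) = 1 / of_nat N * exp (2 * complex_of_real pi * \<i> / of_nat N) powi (int (j * k))"
    using assms by (simp add: IDFT_def)
  then show ?thesis unfolding root_of_unity_cis cis_power_int by (simp add: mult_ac)
qed

lemma kron3_index:
  assumes p: "p < N ^ 3" and q: "q < N ^ 3" and A: "A \<in> carrier_mat N N"
  shows "(A \<otimes>\<^sub>K A \<otimes>\<^sub>K A) $$ (p, q) =
    A $$ (p div (N * N), q div (N * N)) * (A $$ (p div N mod N, q div N mod N) * A $$ (p mod N, q mod N))"
proof -
  have N: "N > 0" using p by (cases N) auto
  have d: "dim_row A = N" "dim_col A = N" using A by auto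
  have "p < N * (N * N)" "q < N * (N * N)" using p q by (simp_all add: power3_eq_cube mult.assoc)
  moreover have "p mod (N * N) < N * N" "q mod (N * N) < N * N" using N by simp_all
  ultimately show ?thesis
    by (simp add: kron_def d mod_square_div mod_mod_cancel)
qed

lemma kvec_pvec_gp:
  "kvec (pvec N p) \<bullet> gp N a b c = real (p div (N * N)) * (2 * pi * real c / real N) +
    (real (p div N mod N) * (2 * pi * real b / real N) + real (p mod N) * (2 * pi * real a / real N))"
proof -
  have "real_of_int (int m) = real m" for m by simp
  then show ?thesis
    unfolding inner_vec_def sum_3 gp_nth kvec_nth pvec_nth inner_real_def by (simp only: add_ac)
qed

text \<open>The transform is numbered by the unsigned frequencies \<open>pvec\<close>, with entries
  from 0 to N - 1, whereas the matrices use the signed \<open>xi\<close>. The two are kept apart: at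
  an index N/2 they are not even congruent modulo N, as \<open>freq\<close> is 0 there.\<close>

lemma DFT3_index:
  assumes "p < N ^ 3" "a < N" "b < N" "c < N"
  shows "DFT3 N $$ (p, idx N a b c) = cis (- (kvec (pvec N p) \<bullet> gp N a b c))"
proof -
  have "DFT N \<in> carrier_mat N N" by (simp add: DFT_def)
  from kron3_index[OF assms(1) idx_props(1)[OF assms(2-4)] this]
  show ?thesis
    using assms idx_decomp[OF assms(1)]
    by (simp add: DFT3_def idx_props DFT_index cis_mult kvec_pvec_gp)
qed

lemma IDFT3_index:
  assumes "p < N ^ 3" "a < N" "b < N" "c < N"
  shows "IDFT3 N $$ (idx N a b c, p) = 1 / of_nat N ^ 3 * cis (kvec (pvec N p) \<bullet> gp N a b c)"
proof -
  have "IDFT N \<in> carrier_mat N N" by (simp add: IDFT_def)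
  from kron3_index[OF idx_props(1)[OF assms(2-4)] assms(1) this]
  show ?thesis
    using assms idx_decomp[OF assms(1)]
    by (simp add: IDFT3_def idx_props IDFT_index cis_mult[symmetric] kvec_pvec_gp power3_eq_cube mult_ac)
qed

lemma dims3: "dim_row (DFT3 N) = N ^ 3" "dim_col (DFT3 N) = N ^ 3" "dim_row (IDFT3 N) = N ^ 3" "dim_col (IDFT3 N) = N ^ 3"
  by (simp_all add: DFT3_def IDFT3_def kron_def DFT_def IDFT_def power3_eq_cube)

lemma grid_vec_index:
  assumes "a < N" "b < N" "c < N"
  shows "vec_index (grid_vec N f) (idx N a b c) = of_real (f (gp N a b c))"
  using idx_props[OF assms] by (simp add: grid_vec_def)

lemma mult_mat_vec_index:
  assumes "p < dim_row A" "dim_col A = n" "dim_vec v = n"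
  shows "vec_index (A *\<^sub>v v) p = (\<Sum>q<n. A $$ (p, q) * vec_index v q)"
  using assms by (simp add: scalar_prod_def row_def atLeast0LessThan)

lemma has_sum_finite_sum:
  fixes f :: "'a \<Rightarrow> 'b \<Rightarrow> complex"
  assumes "finite A" "\<And>a. a \<in> A \<Longrightarrow> (f a has_sum S a) X"
  shows "((\<lambda>x. \<Sum>a\<in>A. f a x) has_sum (\<Sum>a\<in>A. S a)) X"
  using assms by (induction A rule: finite_induct) (auto intro: has_sum_add)

lemma has_sum_minus:
  fixes f g :: "'b \<Rightarrow> complex"
  assumes "(f has_sum a) X" "(g has_sum b) X"
  shows "((\<lambda>x. f x - g x) has_sum (a - b)) X"
  using has_sum_add[OF assms(1) has_sum_uminusI[OF assms(2)]] by simp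

text \<open>Aliasing: the finite sum over the grid is exchanged with the series, and for each k the
  exponential sum \<open>sum_cis_gp\<close> decides whether the coefficient is collected at
  p.\<close>

lemma DFT3_has_sum:
  assumes p: "p < N ^ 3"
    and f: "\<And>a b c. a < N \<Longrightarrow> b < N \<Longrightarrow> c < N \<Longrightarrow>
      ((\<lambda>k. u k * cis (kvec k \<bullet> gp N a b c)) has_sum of_real (f (gp N a b c))) UNIV"
  shows "((\<lambda>k. (if \<forall>i. int N dvd (k - pvec N p) $ i then of_nat N ^ 3 else 0) * u k) has_sum
    vec_index (DFT3 N *\<^sub>v grid_vec N f) p) UNIV"
proof -
  have N: "N > 0" using p by (cases N) auto
  have "vec_index (DFT3 N *\<^sub>v grid_vec N f) p = (\<Sum>q<N ^ 3. DFT3 N $$ (p, q) * vec_index (grid_vec N f) q)"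
    using p by (intro mult_mat_vec_index) (simp_all add: dims3 grid_vec_def)
  also have "\<dots> = (\<Sum>a<N. \<Sum>b<N. \<Sum>c<N. cis (- (kvec (pvec N p) \<bullet> gp N a b c)) * of_real (f (gp N a b c)))"
    unfolding sum_idx by (intro sum.cong refl) (simp add: DFT3_index[OF p] grid_vec_index)
  finally have eq: "vec_index (DFT3 N *\<^sub>v grid_vec N f) p =
      (\<Sum>a<N. \<Sum>b<N. \<Sum>c<N. cis (- (kvec (pvec N p) \<bullet> gp N a b c)) * of_real (f (gp N a b c)))" .
  have "((\<lambda>k. \<Sum>a<N. \<Sum>b<N. \<Sum>c<N. cis (- (kvec (pvec N p) \<bullet> gp N a b c)) * (u k * cis (kvec k \<bullet> gp N a b c))) has_sum
      vec_index (DFT3 N *\<^sub>v grid_vec N f) p) UNIV"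
    unfolding eq by (intro has_sum_finite_sum has_sum_cmult_right f) auto
  moreover have "(\<Sum>a<N. \<Sum>b<N. \<Sum>c<N. cis (- (kvec (pvec N p) \<bullet> gp N a b c)) * (u k * cis (kvec k \<bullet> gp N a b c))) =
      (if \<forall>i. int N dvd (k - pvec N p) $ i then of_nat N ^ 3 else 0) * u k" for k
  proof -
    have "cis (- (kvec (pvec N p) \<bullet> x)) * (u k * cis (kvec k \<bullet> x)) = cis (kvec (k - pvec N p) \<bullet> x) * u k" for x
    proof -
      have "cis (kvec (k - pvec N p) \<bullet> x) = cis (- (kvec (pvec N p) \<bullet> x)) * cis (kvec k \<bullet> x)"
        by (simp add: cis_mult kvec_diff inner_diff_left)
      then show ?thesis by (simp only: mult_ac)
    qed
    then have "(\<Sum>a<N. \<Sum>b<N. \<Sum>c<N. cis (- (kvec (pvec N p) \<bullet> gp N a b c)) * (u k * cis (kvec k \<bullet> gp N a b c))) =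
        (\<Sum>a<N. \<Sum>b<N. \<Sum>c<N. cis (kvec (k - pvec N p) \<bullet> gp N a b c)) * u k"
      by (simp only: sum_distrib_right)
    then show ?thesis unfolding sum_cis_gp[OF N] .
  qed
  ultimately show ?thesis by (simp only:)
qed

text \<open>The only position at which the transform collects the frequency k, found by reducing its
  entries to unsigned residues.\<close>

definition alias_index :: "nat \<Rightarrow> int^3 \<Rightarrow> nat" where
  "alias_index N k = idx N (nat (k $ 1 mod int N)) (nat (k $ 2 mod int N)) (nat (k $ 3 mod int N))"

lemma alias_index_props:
  assumes "N > 0"
  shows "alias_index N k < N ^ 3" "pvec N (alias_index N k) $ i = k $ i mod int N"
proof -
  have l: "nat (k $ i mod int N) < N" for i using assms by (simp add: nat_less_iff)
  show "alias_index N k < N ^ 3" unfolding alias_index_def by (rule idx_props[OF l l l])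
  show "pvec N (alias_index N k) $ i = k $ i mod int N"
    using exhaust_3[of i] assms unfolding alias_index_def
    by (elim disjE) (simp_all add: pvec_nth idx_props[OF l l l])
qed

lemma dvd_diff_pvec_iff:
  assumes p: "p < N ^ 3"
  shows "(\<forall>i. int N dvd (k - pvec N p) $ i) \<longleftrightarrow> p = alias_index N k"
proof
  have N: "N > 0" using p by (cases N) auto
  assume *: "\<forall>i. int N dvd (k - pvec N p) $ i"
  have "k $ i mod int N = pvec N p $ i" for i
  proof -
    have "k $ i mod int N = pvec N p $ i mod int N"
      using *[rule_format, of i] by (simp add: mod_eq_dvd_iff)
    also have "\<dots> = pvec N p $ i"
      using exhaust_3[of i] idx_decomp(2-4)[OF p] by (elim disjE) (simp_all add: pvec_nth)
    finally show ?thesis .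
  qed
  then have "alias_index N k = idx N (p mod N) (p div N mod N) (p div (N * N))"
    by (simp add: alias_index_def pvec_nth)
  then show "p = alias_index N k" using idx_decomp(1)[OF p] by simp
next
  have N: "N > 0" using p by (cases N) auto
  assume "p = alias_index N k"
  then show "\<forall>i. int N dvd (k - pvec N p) $ i"
    by (simp add: alias_index_props[OF N] dvd_minus_mod)
qed

lemma cis_alias_gp:
  assumes "N > 0"
  shows "cis (kvec (pvec N (alias_index N k)) \<bullet> gp N a b c) = cis (kvec k \<bullet> gp N a b c)"
proof -
  have "cis (2 * pi * real_of_int (m mod int N) / real N) = cis (2 * pi * real_of_int m / real N)" for m
  proof -
    have "cis (2 * pi * real_of_int (m - m mod int N) / real N) = 1"
      by (simp only: cis_eq_1_iff_dvd[OF assms] dvd_minus_mod)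
    moreover have "2 * pi * real_of_int m / real N = 2 * pi * real_of_int (m mod int N) / real N + 2 * pi * real_of_int (m - m mod int N) / real N"
      by (simp only: of_int_diff right_diff_distrib diff_divide_distrib)
    ultimately show ?thesis by (simp only: cis_mult[symmetric] mult_1_right)
  qed
  then show ?thesis unfolding cis_gp alias_index_props(2)[OF assms] by (simp only:)
qed

text \<open>The frequency at which the scheme evaluates its formulas when it is fed the mode k; for
  even N, entries congruent to N/2 modulo N turn into 0.\<close>

definition afreq :: "nat \<Rightarrow> int^3 \<Rightarrow> real^3" where
  "afreq N k = xi N (alias_index N k)"

text \<open>The strict bound keeps all entries away from N/2, the exceptional index of
  \<open>freq\<close>. A negative entry has residue k_i + N > N/2, and the last branch of
  \<open>freq\<close> subtracts N again.\<close>

lemma afreq_low: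
  assumes N: "N > 0" "even N" and k: "l1 k < real N / 2"
  shows "afreq N k = kvec k"
proof -
  have l: "nat (k $ i mod int N) < N" for i using N by (simp add: nat_less_iff)
  obtain n where n: "N = 2 * n" using N by (elim evenE)
  have f: "freq N (nat (k $ i mod int N)) = k $ i" for i
  proof -
    have "\<bar>real_of_int (k $ i)\<bar> < real n" using l1_ge[of k i] k n by simp
    then have b: "\<bar>k $ i\<bar> < int n" by linarith
    show ?thesis
    proof (cases "k $ i \<ge> 0")
      case True
      then have "k $ i mod int N = k $ i" using b n by (intro mod_pos_pos_trivial) auto
      then show ?thesis using True b n by (simp add: freq_def nat_less_iff)
    next
      case False
      have "k $ i mod int N = (k $ i + int N) mod int N" by simp
      also have "\<dots> = k $ i + int N" using False b n by (intro mod_pos_pos_trivial) auto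
      finally show ?thesis using False b n by (simp add: freq_def nat_less_iff nat_eq_iff2)
    qed
  qed
  have "xi N (alias_index N k) $ i = kvec k $ i" for i
    using exhaust_3[of i] unfolding alias_index_def xi_def
    by (elim disjE) (simp_all add: idx_props[OF l l l] f)
  then show ?thesis by (simp add: afreq_def Finite_Cartesian_Product.vec_eq_iff)
qed

lemma has_sum_cdot:
  assumes "\<And>j. ((\<lambda>k. v k j) has_sum V j) X"
  shows "((\<lambda>k. cdot \<kappa> (v k)) has_sum cdot \<kappa> V) X"
  unfolding cdot_def by (intro has_sum_finite_sum has_sum_cmult_right assms) auto

lemma has_sum_propC:
  assumes "\<And>j. ((\<lambda>k. v k j) has_sum V j) X"
  shows "((\<lambda>k. propC \<kappa> s (v k) i) has_sum propC \<kappa> s V i) X"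
  unfolding propC_def by (intro has_sum_add has_sum_minus has_sum_cmult_right has_sum_cdot assms)

lemma has_sum_propS:
  assumes "\<And>j. ((\<lambda>k. v k j) has_sum V j) X"
  shows "((\<lambda>k. propS \<kappa> s (v k) i) has_sum propS \<kappa> s V i) X"
proof -
  have "((\<lambda>k. cross \<kappa> (v k) i) has_sum cross \<kappa> V i) X"
    using exhaust_3[of i]
    by (elim disjE) (simp_all only: cross_simps has_sum_minus has_sum_cmult_right assms)
  then show ?thesis unfolding propS_def by (rule has_sum_cmult_right)
qed

lemma propC_cmult: "propC \<kappa> s (\<lambda>j. c * v j) i = c * propC \<kappa> s v i"
  by (simp add: propC_def cdot_cmult algebra_simps)

lemma propS_cmult: "propS \<kappa> s (\<lambda>j. c * v j) i = c * propS \<kappa> s v i"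
  by (simp add: propS_def cross_cmult)

text \<open>One form for both fields: \<rho> is sqrt \<epsilon> / sqrt \<mu> for the magnetic field
  and - sqrt \<mu> / sqrt \<epsilon> for the electric one, with U and V exchanged. The sign reflects
  the plus in the update of the electric field.\<close>

definition scheme :: "nat \<Rightarrow> real \<Rightarrow> real \<Rightarrow> (real^3 \<Rightarrow> real^3) \<Rightarrow> (real^3 \<Rightarrow> real^3) \<Rightarrow> 3 \<Rightarrow> complex Matrix.vec" where
  "scheme N s \<rho> U V i = IDFT3 N *\<^sub>v Matrix.vec (N ^ 3) (\<lambda>p.
     propC (xi N p) s (\<lambda>j. vec_index (DFT3 N *\<^sub>v grid_field N U j) p) i
     - of_real \<rho> * propS (xi N p) s (\<lambda>j. vec_index (DFT3 N *\<^sub>v grid_field N V j) p) i)"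

text \<open>The scheme consists of finite linear combinations of grid values, so the Fourier series
  of the data may be fed through it term by term.\<close>

lemma scheme_has_sum:
  assumes abc: "a < N" "b < N" "c < N"
    and U: "\<And>j a b c. a < N \<Longrightarrow> b < N \<Longrightarrow> c < N \<Longrightarrow>
      ((\<lambda>k. u k j * cis (kvec k \<bullet> gp N a b c)) has_sum of_real (U (gp N a b c) $ j)) UNIV"
    and V: "\<And>j a b c. a < N \<Longrightarrow> b < N \<Longrightarrow> c < N \<Longrightarrow>
      ((\<lambda>k. v k j * cis (kvec k \<bullet> gp N a b c)) has_sum of_real (V (gp N a b c) $ j)) UNIV"
  shows "((\<lambda>k. (propC (afreq N k) s (u k) i - of_real \<rho> * propS (afreq N k) s (v k) i) * cis (kvec k \<bullet> gp N a b c))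
    has_sum vec_index (scheme N s \<rho> U V i) (idx N a b c)) UNIV"
proof -
  have N: "N > 0" using abc by simp
  define w where "w = (\<lambda>p (k::int^3). if \<forall>i. int N dvd (k - pvec N p) $ i then (of_nat N :: complex) ^ 3 else 0)"
  define G where "G = (\<lambda>p k. propC (xi N p) s (u k) i - of_real \<rho> * propS (xi N p) s (v k) i)"
  define R where "R = (\<lambda>p. propC (xi N p) s (\<lambda>j. vec_index (DFT3 N *\<^sub>v grid_field N U j) p) i
     - of_real \<rho> * propS (xi N p) s (\<lambda>j. vec_index (DFT3 N *\<^sub>v grid_field N V j) p) i)"
  have R: "((\<lambda>k. w p k * G p k) has_sum R p) UNIV" if p: "p < N ^ 3" for p
  proof -
    have "((\<lambda>k. propC (xi N p) s (\<lambda>j. w p k * u k j) i - of_real \<rho> * propS (xi N p) s (\<lambda>j. w p k * v k j) i) has_sum R p) UNIV"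
      unfolding R_def w_def grid_field_def
      by (intro has_sum_minus has_sum_cmult_right has_sum_propC has_sum_propS DFT3_has_sum p U V)
    moreover have "propC (xi N p) s (\<lambda>j. w p k * u k j) i - of_real \<rho> * propS (xi N p) s (\<lambda>j. w p k * v k j) i = w p k * G p k" for k
      unfolding propC_cmult propS_cmult G_def right_diff_distrib by (simp only: mult.left_commute)
    ultimately show ?thesis by (simp only:)
  qed
  have "vec_index (scheme N s \<rho> U V i) (idx N a b c) = (\<Sum>p<N ^ 3. IDFT3 N $$ (idx N a b c, p) * R p)"
    unfolding scheme_def using idx_props(1)[OF abc]
    by (subst mult_mat_vec_index[where n = "N ^ 3"]) (simp_all add: dims3 R_def)
  then have "((\<lambda>k. \<Sum>p<N ^ 3. IDFT3 N $$ (idx N a b c, p) * (w p k * G p k)) has_sum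
      vec_index (scheme N s \<rho> U V i) (idx N a b c)) UNIV"
    by (simp only:) (intro has_sum_finite_sum has_sum_cmult_right R; simp)
  \<comment> \<open>For fixed k only the position \<open>alias_index N k\<close> contributes. Its
    factor N^3 cancels the normalization of the inverse transform, and on the grid its exponential
    equals that of k.\<close>
  moreover have "(\<Sum>p<N ^ 3. IDFT3 N $$ (idx N a b c, p) * (w p k * G p k)) =
      (propC (afreq N k) s (u k) i - of_real \<rho> * propS (afreq N k) s (v k) i) * cis (kvec k \<bullet> gp N a b c)" for k
  proof -
    have "(\<Sum>p<N ^ 3. IDFT3 N $$ (idx N a b c, p) * (w p k * G p k)) =
        (\<Sum>p<N ^ 3. if p = alias_index N k then IDFT3 N $$ (idx N a b c, p) * (of_nat N ^ 3 * G p k) else 0)"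
      by (intro sum.cong refl) (simp add: w_def dvd_diff_pvec_iff del: vector_minus_component)
    also have "\<dots> = IDFT3 N $$ (idx N a b c, alias_index N k) * (of_nat N ^ 3 * G (alias_index N k) k)"
      using alias_index_props(1)[OF N, of k] by simp
    also have "\<dots> = cis (kvec k \<bullet> gp N a b c) * G (alias_index N k) k"
      unfolding IDFT3_index[OF alias_index_props(1)[OF N] abc] cis_alias_gp[OF N] using N by simp
    finally show ?thesis by (simp add: G_def afreq_def mult.commute)
  qed
  ultimately show ?thesis by (simp only:)
qed

lemma dim_DFT3_mult [simp]: "dim_vec (DFT3 N *\<^sub>v v) = N ^ 3"
  by (simp add: dims3)

lemma unstack_eqI:
  assumes "\<And>p. p < n \<Longrightarrow> vec_index V (comp_index i * n + p) = f p"
  shows "unstack n V i = Matrix.vec n f"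
  by (rule eq_vecI) (simp_all add: unstack_index assms, simp_all add: unstack_def)

lemma dim_block_mult: "dim_vec (cmat N z *\<^sub>v v) = 3 * N ^ 3" "dim_vec (smat N z *\<^sub>v v) = 3 * N ^ 3"
  by (simp_all add: cmat_def smat_def block3_def)

lemma comp_index_bound: "p < n \<Longrightarrow> comp_index i * n + p < 3 * n"
  by (simp add: comp_index_def)

section \<open>The discrete fields and their distance to the exact ones\<close>

lemma H_end_scheme:
  assumes pos: "\<mu> > 0" "\<epsilon> > 0" "T > 0"
  shows "H_end N \<mu> \<epsilon> T H0 E0 i = scheme N (T / sqrt (\<mu> * \<epsilon>)) (sqrt \<epsilon> / sqrt \<mu>) H0 E0 i"
  unfolding H_end_def scheme_def
proof (intro arg_cong2[where f = "(*\<^sub>v)"] refl unstack_eqI)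
  fix p assume p: "p < N ^ 3"
  define s where "s = T / sqrt (\<mu> * \<epsilon>)"
  have s: "s > 0" using pos by (simp add: s_def)
  have tau: "tau \<mu> \<epsilon> T = of_real s" by (simp add: tau_def s_def)
  note bound = comp_index_bound[OF p, of i]
  have "vec_index (hat_H_end N \<mu> \<epsilon> T H0 E0) (comp_index i * N ^ 3 + p) = of_real (1 / sqrt \<mu>) *
     (of_real (sqrt \<mu>) * vec_index (cmat N (of_real s) *\<^sub>v hat_field N H0) (comp_index i * N ^ 3 + p)
      - of_real (sqrt \<epsilon>) * vec_index (smat N (of_real s) *\<^sub>v hat_field N E0) (comp_index i * N ^ 3 + p))"
    unfolding hat_H_end_def tau
    using bound by (simp add: dim_block_mult del: index_mult_mat_vec dim_mult_mat_vec)
  also have "\<dots> = propC (xi N p) s (\<lambda>j. vec_index (DFT3 N *\<^sub>v grid_field N H0 j) p) i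
      - of_real (sqrt \<epsilon> / sqrt \<mu>) * propS (xi N p) s (\<lambda>j. vec_index (DFT3 N *\<^sub>v grid_field N E0 j) p) i"
    unfolding hat_field_def cmat_index[OF dim_DFT3_mult p s] smat_index[OF dim_DFT3_mult p s]
    using pos by (simp add: field_simps)
  finally show "vec_index (hat_H_end N \<mu> \<epsilon> T H0 E0) (comp_index i * N ^ 3 + p) =
     propC (xi N p) (T / sqrt (\<mu> * \<epsilon>)) (\<lambda>j. vec_index (DFT3 N *\<^sub>v grid_field N H0 j) p) i
      - of_real (sqrt \<epsilon> / sqrt \<mu>) * propS (xi N p) (T / sqrt (\<mu> * \<epsilon>)) (\<lambda>j. vec_index (DFT3 N *\<^sub>v grid_field N E0 j) p) i"
    unfolding s_def .
qed

lemma E_end_scheme: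
  assumes pos: "\<mu> > 0" "\<epsilon> > 0" "T > 0"
  shows "E_end N \<mu> \<epsilon> T H0 E0 i = scheme N (T / sqrt (\<mu> * \<epsilon>)) (- (sqrt \<mu> / sqrt \<epsilon>)) E0 H0 i"
  unfolding E_end_def scheme_def
proof (intro arg_cong2[where f = "(*\<^sub>v)"] refl unstack_eqI)
  fix p assume p: "p < N ^ 3"
  define s where "s = T / sqrt (\<mu> * \<epsilon>)"
  have s: "s > 0" using pos by (simp add: s_def)
  have tau: "tau \<mu> \<epsilon> T = of_real s" by (simp add: tau_def s_def)
  note bound = comp_index_bound[OF p, of i]
  have "vec_index (hat_E_end N \<mu> \<epsilon> T H0 E0) (comp_index i * N ^ 3 + p) = of_real (1 / sqrt \<epsilon>) *
     (of_real (sqrt \<epsilon>) * vec_index (cmat N (of_real s) *\<^sub>v hat_field N E0) (comp_index i * N ^ 3 + p)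
      + of_real (sqrt \<mu>) * vec_index (smat N (of_real s) *\<^sub>v hat_field N H0) (comp_index i * N ^ 3 + p))"
    unfolding hat_E_end_def tau
    using bound by (simp add: dim_block_mult del: index_mult_mat_vec dim_mult_mat_vec)
  also have "\<dots> = propC (xi N p) s (\<lambda>j. vec_index (DFT3 N *\<^sub>v grid_field N E0 j) p) i
      - of_real (- (sqrt \<mu> / sqrt \<epsilon>)) * propS (xi N p) s (\<lambda>j. vec_index (DFT3 N *\<^sub>v grid_field N H0 j) p) i"
    unfolding hat_field_def cmat_index[OF dim_DFT3_mult p s] smat_index[OF dim_DFT3_mult p s]
    using pos by (simp add: field_simps)
  finally show "vec_index (hat_E_end N \<mu> \<epsilon> T H0 E0) (comp_index i * N ^ 3 + p) =
     propC (xi N p) (T / sqrt (\<mu> * \<epsilon>)) (\<lambda>j. vec_index (DFT3 N *\<^sub>v grid_field N E0 j) p) i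
      - of_real (- (sqrt \<mu> / sqrt \<epsilon>)) * propS (xi N p) (T / sqrt (\<mu> * \<epsilon>)) (\<lambda>j. vec_index (DFT3 N *\<^sub>v grid_field N H0 j) p) i"
    unfolding s_def .
qed

lemma grid_error_power2:
  assumes V: "\<And>i. dim_vec (V i) = N ^ 3"
  shows "(grid_error N V F)\<^sup>2 = (\<Sum>i\<in>UNIV. (\<Sum>a<N. \<Sum>b<N. \<Sum>c<N.
    (cmod (vec_index (V i) (idx N a b c) - of_real (F (gp N a b c) $ i)))\<^sup>2) / real N ^ 3)"
proof -
  let ?e = "\<lambda>i a b c. vec_index (V i) (idx N a b c) - of_real (F (gp N a b c) $ i)"
  have "grid_inner N (V i - grid_field N F i) (V i - grid_field N F i) =
      of_real ((\<Sum>a<N. \<Sum>b<N. \<Sum>c<N. (cmod (?e i a b c))\<^sup>2) / real N ^ 3)" for i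
  proof -
    have "(\<Sum>j=1..N. \<Sum>k=1..N. \<Sum>l=1..N.
        vec_index (V i - grid_field N F i) (grid_index N j k l) * cnj (vec_index (V i - grid_field N F i) (grid_index N j k l)))
      = (\<Sum>a<N. \<Sum>b<N. \<Sum>c<N. of_real ((cmod (?e i a b c))\<^sup>2))"
      unfolding One_nat_def sum.atLeast1_atMost_eq grid_index_idx
    proof (intro sum.cong refl)
      fix a b c assume "a \<in> {..<N}" "b \<in> {..<N}" "c \<in> {..<N}"
      then have abc: "a < N" "b < N" "c < N" by auto
      have "vec_index (V i - grid_field N F i) (idx N a b c) = ?e i a b c"
        using idx_props(1)[OF abc] V by (simp add: grid_field_def grid_vec_index[OF abc] index_minus_vec grid_vec_def[THEN arg_cong[where f = dim_vec]])
      then show "vec_index (V i - grid_field N F i) (idx N a b c) * cnj (vec_index (V i - grid_field N F i) (idx N a b c)) =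
          of_real ((cmod (?e i a b c))\<^sup>2)"
        by (simp only: complex_norm_square)
    qed
    then show ?thesis unfolding grid_inner_def by simp
  qed
  then have "grid_error N V F = sqrt (\<Sum>i\<in>UNIV. (\<Sum>a<N. \<Sum>b<N. \<Sum>c<N. (cmod (?e i a b c))\<^sup>2) / real N ^ 3)"
    unfolding grid_error_def grid_norm_def by (simp only: of_real_sum[symmetric] Re_complex_of_real)
  then show ?thesis by (simp add: sum_nonneg)
qed

section \<open>The error estimate\<close>

definition err_const :: "nat \<Rightarrow> real" where
  "err_const M = 2 ^ (2 * M - 4) * lat_bound"

lemma err_const_nonneg: "0 \<le> err_const M"
  unfolding err_const_def lat_bound_def using lat_const_pos by simp

lemma power2_norm_diff_le: "(cmod (x - y))\<^sup>2 \<le> 2 * (cmod x)\<^sup>2 + 2 * (cmod y)\<^sup>2"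
proof -
  have "(cmod (x - y))\<^sup>2 \<le> (cmod x + cmod y)\<^sup>2"
    by (intro power_mono norm_triangle_ineq4) simp
  also have "\<dots> \<le> 2 * (cmod x)\<^sup>2 + 2 * (cmod y)\<^sup>2"
    using sum_squares_bound[of "cmod x" "cmod y"] by (simp add: power2_sum)
  finally show ?thesis .
qed

text \<open>At low frequencies \<open>afreq\<close> equals k, so d vanishes; at high ones both parts
  are bounded separately by \<open>norm_prop_power2_le\<close>. This gives 600 = 4 * 150 and 24 = 4
  * 6; one factor 3 counts the components of the data and another the components of the
  error.\<close>

lemma scheme_error_le:
  assumes N: "N > 0" "even N" and M: "M \<ge> 2"
    and U: "\<And>j x. x \<in> cube \<Longrightarrow> ((\<lambda>k. u k j * cis (kvec k \<bullet> x)) has_sum of_real (U x $ j)) UNIV"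
    and V: "\<And>j x. x \<in> cube \<Longrightarrow> ((\<lambda>k. v k j * cis (kvec k \<bullet> x)) has_sum of_real (V x $ j)) UNIV"
    and W: "\<And>j x. x \<in> cube \<Longrightarrow> ((\<lambda>k. w k j * cis (kvec k \<bullet> x)) has_sum of_real (W x $ j)) UNIV"
    and w: "\<And>k j. w k j = propC (kvec k) s (u k) j - of_real \<rho> * propS (kvec k) s (v k) j"
    and BU: "\<And>j F. finite F \<Longrightarrow> (\<Sum>k\<in>F. l1 k ^ (2 * M) * (cmod (u k j))\<^sup>2) \<le> BU"
    and BV: "\<And>j F. finite F \<Longrightarrow> (\<Sum>k\<in>F. l1 k ^ (2 * M) * (cmod (v k j))\<^sup>2) \<le> BV"
  shows "(grid_error N (scheme N s \<rho> U V) W)\<^sup>2 \<le> err_const M / real N ^ (2 * M) * (5400 * BU + 216 * \<rho>\<^sup>2 * BV)"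
proof -
  define d where "d = (\<lambda>i k. (propC (afreq N k) s (u k) i - of_real \<rho> * propS (afreq N k) s (v k) i) - w k i)"
  define f where "f = (\<lambda>i x. \<Sum>\<^sub>\<infinity>k. d i k * cis (kvec k \<bullet> x))"
  have hs: "((\<lambda>k. d i k * cis (kvec k \<bullet> gp N a b c)) has_sum
      (vec_index (scheme N s \<rho> U V i) (idx N a b c) - of_real (W (gp N a b c) $ i))) UNIV"
    if abc: "a < N" "b < N" "c < N" for i a b c
    unfolding d_def left_diff_distrib[of _ "w _ _"]
    by (intro has_sum_minus scheme_has_sum[OF abc] U V W gp_cube abc)
  then have f: "f i (gp N a b c) = vec_index (scheme N s \<rho> U V i) (idx N a b c) - of_real (W (gp N a b c) $ i)"
    if "a < N" "b < N" "c < N" for i a b c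
    unfolding f_def using that by (intro infsumI) auto
  have "grid_mean_square N (f i) \<le> err_const M / real N ^ (2 * M) * (1800 * BU + 72 * \<rho>\<^sup>2 * BV)" for i
    unfolding err_const_def
  proof (rule grid_mean_square_series_le[OF N(1) M])
    show "((\<lambda>k. d i k * cis (kvec k \<bullet> gp N a b c)) has_sum f i (gp N a b c)) UNIV" if "a < N" "b < N" "c < N" for a b c
      using hs[OF that] f[OF that] by simp
    show "d i k = 0" if "l1 k < real N / 2" for k
      by (simp add: d_def w afreq_low[OF N that])
    show "(\<Sum>k\<in>F. l1 k ^ (2 * M) * (cmod (d i k))\<^sup>2) \<le> 1800 * BU + 72 * \<rho>\<^sup>2 * BV" if F: "finite F" for F
    proof -
      have "(cmod (d i k))\<^sup>2 \<le> 600 * (\<Sum>j\<in>UNIV. (cmod (u k j))\<^sup>2) + 24 * \<rho>\<^sup>2 * (\<Sum>j\<in>UNIV. (cmod (v k j))\<^sup>2)" for k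
        using power2_norm_diff_le[of "propC (afreq N k) s (u k) i - of_real \<rho> * propS (afreq N k) s (v k) i" "w k i"]
          norm_prop_power2_le[of "afreq N k" s "u k" i \<rho> "v k"] norm_prop_power2_le[of "kvec k" s "u k" i \<rho> "v k"]
        unfolding w d_def by linarith
      then have "(\<Sum>k\<in>F. l1 k ^ (2 * M) * (cmod (d i k))\<^sup>2) \<le>
          (\<Sum>k\<in>F. l1 k ^ (2 * M) * (600 * (\<Sum>j\<in>UNIV. (cmod (u k j))\<^sup>2) + 24 * \<rho>\<^sup>2 * (\<Sum>j\<in>UNIV. (cmod (v k j))\<^sup>2)))"
        by (intro sum_mono mult_left_mono) (simp_all add: l1_nonneg)
      also have "\<dots> = 600 * (\<Sum>j\<in>UNIV. \<Sum>k\<in>F. l1 k ^ (2 * M) * (cmod (u k j))\<^sup>2)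
          + 24 * \<rho>\<^sup>2 * (\<Sum>j\<in>UNIV. \<Sum>k\<in>F. l1 k ^ (2 * M) * (cmod (v k j))\<^sup>2)"
        unfolding distrib_left mult.left_commute[of "l1 _ ^ _"] sum_distrib_left[of "l1 _ ^ _"]
          sum.distrib sum_distrib_left[of 600, of _ F, symmetric] sum_distrib_left[of "24 * \<rho>\<^sup>2", of _ F, symmetric]
          sum.swap[of _ UNIV F] ..
      also have "\<dots> \<le> 600 * (\<Sum>j\<in>(UNIV::3 set). BU) + 24 * \<rho>\<^sup>2 * (\<Sum>j\<in>(UNIV::3 set). BV)"
        by (intro add_mono mult_left_mono sum_mono BU BV F) auto
      finally show ?thesis by simp
    qed
  qed
  then have "(\<Sum>i\<in>UNIV. grid_mean_square N (f i)) \<le>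
      (\<Sum>i\<in>(UNIV::3 set). err_const M / real N ^ (2 * M) * (1800 * BU + 72 * \<rho>\<^sup>2 * BV))"
    by (intro sum_mono)
  also have "\<dots> = err_const M / real N ^ (2 * M) * (5400 * BU + 216 * \<rho>\<^sup>2 * BV)"
    by (simp add: algebra_simps)
  finally have "(\<Sum>i\<in>UNIV. grid_mean_square N (f i)) \<le> err_const M / real N ^ (2 * M) * (5400 * BU + 216 * \<rho>\<^sup>2 * BV)" .
  moreover have "(grid_error N (scheme N s \<rho> U V) W)\<^sup>2 = (\<Sum>i\<in>UNIV. grid_mean_square N (f i))"
    unfolding grid_mean_square_def
    by (subst grid_error_power2) (auto simp: scheme_def dims3 f intro!: sum.cong arg_cong2[where f = "(/)"])
  ultimately show ?thesis by simp
qed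

lemma maxwell_series:
  assumes r: "r > 3 / 2" and pos: "\<mu> > 0" "\<epsilon> > 0" "T > 0"
    and sol: "maxwell_solution r \<mu> \<epsilon> T H0 E0 H E" and t: "t \<in> {0..T}" and x: "x \<in> cube"
  shows "((\<lambda>k. vcoef (H t) k j * cis (kvec k \<bullet> x)) has_sum of_real (H t x $ j)) UNIV"
    and "((\<lambda>k. vcoef (E t) k j * cis (kvec k \<bullet> x)) has_sum of_real (E t x $ j)) UNIV"
proof -
  have M: "Suc (nat \<lfloor>r\<rfloor>) \<ge> 2" using r by (simp add: le_nat_iff le_floor_iff Suc_le_eq)
  have c: "continuous_on cube (H t)" "continuous_on cube (E t)"
    using sol t unfolding maxwell_solution_def by blast+
  note wb = weighted_bounded_maxwell[OF r pos sol t]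
  show "((\<lambda>k. vcoef (H t) k j * cis (kvec k \<bullet> x)) has_sum of_real (H t x $ j)) UNIV"
    using weighted_bounded_summable[OF wb(1) M] x c unfolding vcoef_def
    by (intro fourier_series_has_sum) (auto intro!: continuous_intros)
  show "((\<lambda>k. vcoef (E t) k j * cis (kvec k \<bullet> x)) has_sum of_real (E t x $ j)) UNIV"
    using weighted_bounded_summable[OF wb(2) M] x c unfolding vcoef_def
    by (intro fourier_series_has_sum) (auto intro!: continuous_intros)
qed

lemma uniform_weighted_bound:
  fixes c :: "int^3 \<Rightarrow> 3 \<Rightarrow> complex"
  assumes "\<And>j. weighted_bounded M (\<lambda>k. c k j)"
  obtains B where "B \<ge> 0" "\<And>j F. finite F \<Longrightarrow> (\<Sum>k\<in>F. l1 k ^ (2 * M) * (cmod (c k j))\<^sup>2) \<le> B"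
proof -
  have "\<forall>j. \<exists>B. \<forall>F. finite F \<longrightarrow> (\<Sum>k\<in>F. l1 k ^ (2 * M) * (cmod (c k j))\<^sup>2) \<le> B"
    using assms unfolding weighted_bounded_def by (intro allI)
  from choice[OF this] obtain B where B: "\<forall>j F. finite F \<longrightarrow> (\<Sum>k\<in>F. l1 k ^ (2 * M) * (cmod (c k j))\<^sup>2) \<le> B j"
    by (elim exE)
  have B0: "0 \<le> B j" for j using B[rule_format, of "{}" j] by simp
  have le: "B j \<le> (\<Sum>j\<in>UNIV. B j)" for j by (rule member_le_sum) (use B0 in auto)
  show thesis
  proof (rule that)
    show "0 \<le> (\<Sum>j\<in>UNIV. B j)" by (intro sum_nonneg B0)
    show "(\<Sum>k\<in>F. l1 k ^ (2 * M) * (cmod (c k j))\<^sup>2) \<le> (\<Sum>j\<in>UNIV. B j)" if "finite F" for F j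
      using B[rule_format, OF that, of j] le by (rule order_trans)
  qed
qed

text \<open>The weights \<mu> and \<epsilon> cancel the ratios \<epsilon>/\<mu> and \<mu>/\<epsilon>
  of the two estimates, and T enters only through s, which the bounds do not contain; so the
  constant depends on neither. The sum has the factor 5400 + 216 = 5616, and 10800 leaves
  room.\<close>

lemma maxwell_error_le:
  assumes r: "r > 3 / 2" and pos: "\<mu> > 0" "\<epsilon> > 0" "T > 0" and N: "N > 0" "even N"
    and sol: "maxwell_solution r \<mu> \<epsilon> T H0 E0 H E"
    and M: "M = Suc (nat \<lfloor>r\<rfloor>)"
    and B: "B \<ge> 0" "\<And>j F. finite F \<Longrightarrow> (\<Sum>k\<in>F. l1 k ^ (2 * M) * (cmod (vcoef H0 k j))\<^sup>2) \<le> B"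
      "\<And>j F. finite F \<Longrightarrow> (\<Sum>k\<in>F. l1 k ^ (2 * M) * (cmod (vcoef E0 k j))\<^sup>2) \<le> B"
  shows "sqrt (\<mu> * (grid_error N (H_end N \<mu> \<epsilon> T H0 E0) (H T))\<^sup>2 + \<epsilon> * (grid_error N (E_end N \<mu> \<epsilon> T H0 E0) (E T))\<^sup>2)
    \<le> sqrt (10800 * err_const M * B) * (sqrt \<mu> + sqrt \<epsilon>) * real N powr (- r)"
proof -
  define s where "s = T / sqrt (\<mu> * \<epsilon>)"
  define K where "K = err_const M / real N ^ (2 * M)"
  have N0: "real N \<ge> 1" using N by simp
  have K0: "K \<ge> 0" unfolding K_def using err_const_nonneg N0 by simp
  have M2: "M \<ge> 2" using r unfolding M by (simp add: le_nat_iff le_floor_iff Suc_le_eq)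
  have t: "(0::real) \<in> {0..T}" "T \<in> {0..T}" using pos by auto
  have init: "H 0 x = H0 x" "E 0 x = E0 x" if "x \<in> cube" for x
    using sol that unfolding maxwell_solution_def by blast+
  have v0: "vcoef (H 0) k = vcoef H0 k" "vcoef (E 0) k = vcoef E0 k" for k
    by (intro ext vcoef_cong init; assumption)+
  note ser = maxwell_series[OF r pos sol]
  have sH0: "((\<lambda>k. vcoef H0 k j * cis (kvec k \<bullet> x)) has_sum of_real (H0 x $ j)) UNIV"
    and sE0: "((\<lambda>k. vcoef E0 k j * cis (kvec k \<bullet> x)) has_sum of_real (E0 x $ j)) UNIV" if "x \<in> cube" for x j
    using ser[OF t(1) that, of j] unfolding v0 init[OF that] by simp_all
  have pH: "vcoef (H T) k j = propC (kvec k) s (vcoef H0 k) j - of_real (sqrt \<epsilon> / sqrt \<mu>) * propS (kvec k) s (vcoef E0 k) j" for k j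
    using maxwell_propagation(1)[OF r pos sol t, of k j] unfolding v0 s_def by simp
  have pE: "vcoef (E T) k j = propC (kvec k) s (vcoef E0 k) j - of_real (- (sqrt \<mu> / sqrt \<epsilon>)) * propS (kvec k) s (vcoef H0 k) j" for k j
    using maxwell_propagation(2)[OF r pos sol t, of k j] propS_cmult[of "kvec k" s "-1" "vcoef H0 k" j]
    unfolding v0 s_def by simp
  have "(grid_error N (scheme N s (sqrt \<epsilon> / sqrt \<mu>) H0 E0) (H T))\<^sup>2 \<le> K * (5400 * B + 216 * (sqrt \<epsilon> / sqrt \<mu>)\<^sup>2 * B)"
    unfolding K_def by (rule scheme_error_le[OF N M2 sH0 sE0 ser(1)[OF t(2)] pH B(2,3)])
  then have 1: "\<mu> * (grid_error N (H_end N \<mu> \<epsilon> T H0 E0) (H T))\<^sup>2 \<le> \<mu> * (K * (5400 * B + 216 * (sqrt \<epsilon> / sqrt \<mu>)\<^sup>2 * B))"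
    unfolding H_end_scheme[OF pos, abs_def, folded s_def] using pos by (intro mult_left_mono) auto
  have "(grid_error N (scheme N s (- (sqrt \<mu> / sqrt \<epsilon>)) E0 H0) (E T))\<^sup>2 \<le> K * (5400 * B + 216 * (- (sqrt \<mu> / sqrt \<epsilon>))\<^sup>2 * B)"
    unfolding K_def by (rule scheme_error_le[OF N M2 sE0 sH0 ser(2)[OF t(2)] pE B(3,2)])
  then have 2: "\<epsilon> * (grid_error N (E_end N \<mu> \<epsilon> T H0 E0) (E T))\<^sup>2 \<le> \<epsilon> * (K * (5400 * B + 216 * (- (sqrt \<mu> / sqrt \<epsilon>))\<^sup>2 * B))"
    unfolding E_end_scheme[OF pos, abs_def, folded s_def] using pos by (intro mult_left_mono) auto
  have eqs: "\<mu> * (K * (5400 * B + 216 * (sqrt \<epsilon> / sqrt \<mu>)\<^sup>2 * B)) = K * B * (5400 * \<mu> + 216 * \<epsilon>)"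
    "\<epsilon> * (K * (5400 * B + 216 * (- (sqrt \<mu> / sqrt \<epsilon>))\<^sup>2 * B)) = K * B * (5400 * \<epsilon> + 216 * \<mu>)"
    using pos by (simp_all add: power_divide field_simps)
  have "\<mu> * (grid_error N (H_end N \<mu> \<epsilon> T H0 E0) (H T))\<^sup>2 + \<epsilon> * (grid_error N (E_end N \<mu> \<epsilon> T H0 E0) (E T))\<^sup>2
      \<le> K * B * (5400 * \<mu> + 216 * \<epsilon>) + K * B * (5400 * \<epsilon> + 216 * \<mu>)"
    using add_mono[OF 1 2] unfolding eqs .
  also have "\<dots> = K * B * (5616 * (\<mu> + \<epsilon>))" by (simp add: algebra_simps)
  also have "\<dots> \<le> K * B * (10800 * (sqrt \<mu> + sqrt \<epsilon>)\<^sup>2)"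
  proof (rule mult_left_mono)
    have "0 \<le> sqrt \<mu> * sqrt \<epsilon>" using pos by simp
    then have "\<mu> + \<epsilon> \<le> (sqrt \<mu> + sqrt \<epsilon>)\<^sup>2" using pos by (simp add: power2_sum)
    then show "5616 * (\<mu> + \<epsilon>) \<le> 10800 * (sqrt \<mu> + sqrt \<epsilon>)\<^sup>2" using pos by simp
  qed (use K0 B in simp)
  also have "\<dots> = 10800 * err_const M * B * ((sqrt \<mu> + sqrt \<epsilon>) * (1 / real N ^ M))\<^sup>2"
    by (simp add: K_def power_mult_distrib power_divide power_mult[symmetric] mult.commute[of M])
  finally have "sqrt (\<mu> * (grid_error N (H_end N \<mu> \<epsilon> T H0 E0) (H T))\<^sup>2 + \<epsilon> * (grid_error N (E_end N \<mu> \<epsilon> T H0 E0) (E T))\<^sup>2)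
      \<le> sqrt (10800 * err_const M * B * ((sqrt \<mu> + sqrt \<epsilon>) * (1 / real N ^ M))\<^sup>2)"
    by (rule real_sqrt_le_mono)
  also have "\<dots> = sqrt (10800 * err_const M * B) * ((sqrt \<mu> + sqrt \<epsilon>) * (1 / real N ^ M))"
    unfolding real_sqrt_mult[of "10800 * err_const M * B"] real_sqrt_abs using pos by simp
  also have "\<dots> \<le> sqrt (10800 * err_const M * B) * ((sqrt \<mu> + sqrt \<epsilon>) * real N powr (- r))"
  proof (intro mult_left_mono)
    have "real M > r" unfolding M using r by linarith
    then have "real N powr (- real M) \<le> real N powr (- r)" using N0 by (intro powr_mono) auto
    then show "1 / real N ^ M \<le> real N powr (- r)"
      using N0 by (simp add: powr_minus_divide powr_realpow)
  qed (use pos B err_const_nonneg in auto)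
  finally show ?thesis by (simp only: mult.assoc)
qed

theorem theorem3p4:
  fixes r :: real and H0 E0 :: "real^3 \<Rightarrow> real^3"
  assumes "r > 3 / 2"
    and "H0 \<in> vsobolev_per r" and "E0 \<in> vsobolev_per r"
    and "bounded (H0 ` cube)" and "bounded (E0 ` cube)"
  shows "\<exists>C>0. \<forall>(\<mu>::real) (\<epsilon>::real) (t_end::real) (N::nat)
      (H :: real \<Rightarrow> real^3 \<Rightarrow> real^3) (E :: real \<Rightarrow> real^3 \<Rightarrow> real^3).
      \<mu> > 0 \<longrightarrow> \<epsilon> > 0 \<longrightarrow> t_end > 0 \<longrightarrow> N > 0 \<longrightarrow> even N \<longrightarrow>
      maxwell_solution r \<mu> \<epsilon> t_end H0 E0 H E \<longrightarrow>
      sqrt (\<mu> * (grid_error N (H_end N \<mu> \<epsilon> t_end H0 E0) (H t_end))\<^sup>2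
          + \<epsilon> * (grid_error N (E_end N \<mu> \<epsilon> t_end H0 E0) (E t_end))\<^sup>2)
        \<le> C * (sqrt \<mu> + sqrt \<epsilon>) * real N powr (- r)"
proof (cases "\<exists>\<mu> \<epsilon> T H E. \<mu> > 0 \<and> \<epsilon> > 0 \<and> T > 0 \<and> maxwell_solution r \<mu> \<epsilon> T H0 E0 H E")
  case False
  then show ?thesis by (intro exI[of _ 1]) auto
next
  case True
  then obtain \<mu> \<epsilon> T H E where pos: "\<mu> > 0" "\<epsilon> > 0" "T > 0" and sol: "maxwell_solution r \<mu> \<epsilon> T H0 E0 H E"
    by blast
  define M where "M = Suc (nat \<lfloor>r\<rfloor>)"
  have t: "(0::real) \<in> {0..T}" using pos by simp
  have "vcoef (H 0) k j = vcoef H0 k j" "vcoef (E 0) k j = vcoef E0 k j" for k j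
    using sol unfolding maxwell_solution_def by (auto intro: vcoef_cong)
  then have wb: "weighted_bounded M (\<lambda>k. vcoef H0 k j)" "weighted_bounded M (\<lambda>k. vcoef E0 k j)" for j
    using weighted_bounded_maxwell[OF assms(1) pos sol t, of j] unfolding M_def by simp_all
  \<comment> \<open>The bounds concern the coefficients of \<open>H0\<close> and \<open>E0\<close>
    alone; the solution chosen above has done its work.\<close>
  obtain B1 where B1: "B1 \<ge> 0" "\<And>j F. finite F \<Longrightarrow> (\<Sum>k\<in>F. l1 k ^ (2 * M) * (cmod (vcoef H0 k j))\<^sup>2) \<le> B1"
    by (rule uniform_weighted_bound[of M "vcoef H0", OF wb(1)]) (rule that; assumption)
  obtain B2 where B2: "B2 \<ge> 0" "\<And>j F. finite F \<Longrightarrow> (\<Sum>k\<in>F. l1 k ^ (2 * M) * (cmod (vcoef E0 k j))\<^sup>2) \<le> B2"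
    by (rule uniform_weighted_bound[of M "vcoef E0", OF wb(2)]) (rule that; assumption)
  define B where "B = B1 + B2"
  have B: "B \<ge> 0" "\<And>j F. finite F \<Longrightarrow> (\<Sum>k\<in>F. l1 k ^ (2 * M) * (cmod (vcoef H0 k j))\<^sup>2) \<le> B"
    "\<And>j F. finite F \<Longrightarrow> (\<Sum>k\<in>F. l1 k ^ (2 * M) * (cmod (vcoef E0 k j))\<^sup>2) \<le> B"
  proof -
    show "B \<ge> 0" unfolding B_def using B1(1) B2(1) by simp
    fix j and F :: "(int^3) set" assume F: "finite F"
    show "(\<Sum>k\<in>F. l1 k ^ (2 * M) * (cmod (vcoef H0 k j))\<^sup>2) \<le> B"
      "(\<Sum>k\<in>F. l1 k ^ (2 * M) * (cmod (vcoef E0 k j))\<^sup>2) \<le> B"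
      unfolding B_def using B1(1) B1(2)[OF F, of j] B2(1) B2(2)[OF F, of j] by linarith+
  qed
  \<comment> \<open>The summand 1 keeps C positive even if B = 0.\<close>
  define C where "C = sqrt (10800 * err_const M * B) + 1"
  have S0: "0 \<le> sqrt (10800 * err_const M * B)" using err_const_nonneg B by simp
  show ?thesis
  proof (intro exI[of _ C] conjI allI impI)
    show "C > 0" unfolding C_def using S0 by linarith
  next
    fix \<mu> \<epsilon> t_end :: real and N :: nat and H E :: "real \<Rightarrow> real^3 \<Rightarrow> real^3"
    assume "\<mu> > 0" "\<epsilon> > 0" "t_end > 0" "N > 0" "even N" "maxwell_solution r \<mu> \<epsilon> t_end H0 E0 H E"
    then have "sqrt (\<mu> * (grid_error N (H_end N \<mu> \<epsilon> t_end H0 E0) (H t_end))\<^sup>2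
          + \<epsilon> * (grid_error N (E_end N \<mu> \<epsilon> t_end H0 E0) (E t_end))\<^sup>2)
        \<le> sqrt (10800 * err_const M * B) * (sqrt \<mu> + sqrt \<epsilon>) * real N powr (- r)"
      by (intro maxwell_error_le[OF assms(1) _ _ _ _ _ _ M_def B])
    also have "\<dots> \<le> C * (sqrt \<mu> + sqrt \<epsilon>) * real N powr (- r)"
      using \<open>\<mu> > 0\<close> \<open>\<epsilon> > 0\<close> unfolding C_def by (intro mult_right_mono) auto
    finally show "sqrt (\<mu> * (grid_error N (H_end N \<mu> \<epsilon> t_end H0 E0) (H t_end))\<^sup>2
          + \<epsilon> * (grid_error N (E_end N \<mu> \<epsilon> t_end H0 E0) (E t_end))\<^sup>2)
        \<le> C * (sqrt \<mu> + sqrt \<epsilon>) * real N powr (- r)" .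
  qed
qed

end
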